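(* Let $n,n'\in N^+$ with $\{n',n\}=c>0$, and let $b,b'\in(1/\delta_0)\mathbb{Z}$, where $c/2\in(1/\delta_0)\mathbb{Z}$. Then, in $G$, $$\begin{aligned} [n']_{c/2,b'}\,[n]_{c/2,b} =&\ \Bigl(\overrightarrow{\prod_{p\ge0}}\,[(p+1)n+pn']_{c/2,\,(p+1)b+pb'}\Bigr)\\ &\times\Bigl(\prod_{p\ge0}[2^p(n+n')]_{2^{p-1}c,\,2^p(b+b')-2^{p-1}c}\,[2^p(n+n')]_{2^{p-1}c,\,2^p(b+b')+2^{p-1}c}\Bigr)\\ &\times\Bigl(\overleftarrow{\prod_{p\ge0}}\,[pn+(p+1)n']_{c/2,\,pb+(p+1)b'}\Bigr). \end{aligned}$$ In particular, when $r=2$, $(\delta_1,\delta_2)=(2,2)$ and $\{e_2,e_1\}=1$, taking $n=e_1$, $n'=e_2$, $c=1$, $b=b'=0$ gives $$\begin{aligned} [e_2]_{\frac12,0}[e_1]_{\frac12,0} =&\ \Bigl(\overrightarrow{\prod_{p\ge0}}[(p+1)e_1+pe_2]_{\frac12,0}\Bigr) \Bigl(\prod_{j\ge0}[2^j(e_1+e_2)]_{2^{j-1},-2^{j-1}}[2^j(e_1+e_2)]_{2^{j-1},2^{j-1}}\Bigr)\\ &\times\Bigl(\overleftarrow{\prod_{p\ge0}}[pe_1+(p+1)e_2]_{\frac12,0}\Bigr). \end{aligned}$$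
   Context: Fixed data: $N$ is a lattice of finite rank $r$ with basis $(e_1,\dots,e_r)$; $\{\cdot,\cdot\}:N\times N\to\mathbb{Q}$ is a skew-symmetric bilinear form; $\delta_1,\dots,\delta_r$ are positive integers such that $N^\circ=\bigoplus_i\mathbb{Z}\,\delta_ie_i$ satisfies $\{N^\circ,N\}\subset\mathbb{Z}$. Let $\delta_0=\mathrm{lcm}(\delta_1,\dots,\delta_r)$; then $\{\cdot,\cdot\}$ takes values in $(1/\delta_0)\mathbb{Z}$. Let $N^+=\{\sum_i a_ie_i\mid a_i\in\mathbb{Z}_{\ge0},\ \sum_i a_i>0\}$ and $\deg(\sum_i a_ie_i)=\sum_i a_i$. Let $q$ be an indeterminate, $[\alpha]_q=\frac{q^\alpha-q^{-\alpha}}{q-q^{-1}}$ for $\alpha\in(1/\delta_0)\mathbb{Z}$. Let $\mathfrak{g}=\bigoplus_{n\in N^+}\mathbb{Q}(q^{1/\delta_0})X_n$ be the Lie algebra over $\mathbb{Q}(q^{1/\delta_0})$ with $[X_n,X_{n'}]=[\{n,n'\}]_q X_{n+n'}$, $\widehat{\mathfrak{g}}$ its completion with respect to $\deg$, and $G=\exp(\widehat{\mathfrak{g}})$ with the Baker–Campbell–Hausdorff product. Let $G^{>\ell}$ be the normal subgroup of elements $\exp(\sum_{\deg n>\ell}c_nX_n)$; infinite products in $G$ are understood as limits with respect to the quotients $G/G^{>\ell}$ (in each of which only finitely many factors are nontrivial). Quantum dilogarithm elements, for $n\in N^+$, $a\in(1/\delta_0)\mathbb{Z}_{>0}$, $b\in(1/\delta_0)\mathbb{Z}$: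 $$[n]_{a,b}:=\Psi_{a,b}[n]=\exp\Bigl(\sum_{j=1}^\infty\frac{(-1)^{j+1}}{j\,[ja]_q}q^{jb}X_{jn}\Bigr)\in G.$$ $\overrightarrow{\prod}$ (resp. $\overleftarrow{\prod}$) denotes the ordered product with the index $p$ increasing from left to right (resp. from right to left). *)

theory Defs
  imports
    "HOL-Analysis.Finite_Cartesian_Product"
    "HOL-Algebra.Coset"
    "HOL-Computational_Algebra.Fraction_Field"
    "HOL-Computational_Algebra.Polynomial"
    "HOL-Library.Numeral_Type"
begin

text \<open>
  The lattice \<open>N\<close> with its basis is \<open>int ^ 'r\<close> with the basis vectors \<open>e\<^sub>i = axis i 1\<close>;
  the rank is \<open>CARD('r)\<close>.
\<close>

definition sublattice :: "('r::finite \<Rightarrow> nat) \<Rightarrow> (int ^ 'r) set" where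
  "sublattice d = {\<Sum>i\<in>UNIV. (a i * int (d i)) *s axis i 1 | a. True}"

locale fixed_data =
  fixes B :: "int ^ 'r::finite \<Rightarrow> int ^ 'r \<Rightarrow> rat"
    and d :: "'r \<Rightarrow> nat"
  assumes add_left: "B (x + y) z = B x z + B y z"
    and add_right: "B x (y + z) = B x y + B x z"
    and skew: "B x y = - B y x"
    and d_pos: "d i > 0"
    and integral: "x \<in> sublattice d \<Longrightarrow> B x y \<in> \<int>"

definition delta0 :: "('r::finite \<Rightarrow> nat) \<Rightarrow> nat" where
  "delta0 d = Lcm (range d)"

definition fracs :: "('r::finite \<Rightarrow> nat) \<Rightarrow> rat set" where
  "fracs d = {of_int k / of_nat (delta0 d) | k. True}"

definition Nplus :: "(int ^ 'r::finite) set" where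
  "Nplus = {n. (\<forall>i. 0 \<le> n $ i) \<and> 0 < (\<Sum>i\<in>UNIV. n $ i)}"

definition deg :: "int ^ 'r::finite \<Rightarrow> nat" where
  "deg n = nat (\<Sum>i\<in>UNIV. n $ i)"

text \<open>
  The field \<open>\<rat>(q\<^sup>1\<^sup>/\<^sup>\<delta>\<^sup>0)\<close> is the field of rational functions in the indeterminate \<open>t = q\<^sup>1\<^sup>/\<^sup>\<delta>\<^sup>0\<close>,
  so that \<open>q\<^sup>\<alpha>\<close> is the integer power \<open>t\<^sup>\<delta>\<^sup>0\<^sup>\<alpha>\<close> for \<open>\<alpha> \<in> (1/\<delta>\<^sub>0)\<int>\<close>. The floor only turns the
  integral rational \<open>\<delta>\<^sub>0 \<alpha>\<close> into an element of type \<open>int\<close>.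
\<close>

type_synonym ratfun = "rat poly fract"

definition tvar :: ratfun where
  "tvar = Fract [:0, 1:] 1"

definition qpow :: "('r::finite \<Rightarrow> nat) \<Rightarrow> rat \<Rightarrow> ratfun" where
  "qpow d \<alpha> = tvar powi \<lfloor>of_nat (delta0 d) * \<alpha>\<rfloor>"

definition qnum :: "('r::finite \<Rightarrow> nat) \<Rightarrow> rat \<Rightarrow> ratfun" where
  "qnum d \<alpha> = (qpow d \<alpha> - qpow d (- \<alpha>)) / (qpow d 1 - qpow d (- 1))"

text \<open>
  There are finitely many elements of \<open>N\<^sup>+\<close> of each degree, so the completion of the Lie algebra
  with respect to the degree consists of all formal sums \<open>\<Sum>\<^sub>n x\<^sub>n X\<^sub>n\<close> over \<open>N\<^sup>+\<close>. Such a sum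
  is represented by its coefficient function \<open>x\<close>, extended by \<open>0\<close> outside \<open>N\<^sup>+\<close>.
\<close>

type_synonym 'r series = "int ^ 'r \<Rightarrow> ratfun"

definition ghat :: "'r::finite series set" where
  "ghat = {x. \<forall>n. n \<notin> Nplus \<longrightarrow> x n = 0}"

definition lie ::
    "(int ^ 'r::finite \<Rightarrow> int ^ 'r \<Rightarrow> rat) \<Rightarrow> ('r \<Rightarrow> nat) \<Rightarrow> 'r series \<Rightarrow> 'r series \<Rightarrow> 'r series" where
  "lie B d x y = (\<lambda>n. \<Sum>(m, m') \<in> {(m, m'). m \<in> Nplus \<and> m' \<in> Nplus \<and> m + m' = n}.
     x m * y m' * qnum d (B m m'))"

text \<open>
  The Baker--Campbell--Hausdorff series in Dynkin's form:
  the sum over \<open>k \<ge> 1\<close> and over all \<open>(r\<^sub>1, s\<^sub>1), \<dots>, (r\<^sub>k, s\<^sub>k)\<close> with \<open>r\<^sub>i + s\<^sub>i > 0\<close> of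
  \<open>(-1)\<^sup>k\<^sup>-\<^sup>1 / k\<close> times \<open>1 / ((\<Sum>\<^sub>i (r\<^sub>i + s\<^sub>i)) \<Prod>\<^sub>i r\<^sub>i! s\<^sub>i!)\<close> times the right-nested bracket
  \<open>[x, [x, \<dots> [y, \<dots>]]]\<close> of the word \<open>x\<close> (\<open>r\<^sub>1\<close> times), \<open>y\<close> (\<open>s\<^sub>1\<close> times), \<open>\<dots>\<close>,
  \<open>x\<close> (\<open>r\<^sub>k\<close> times), \<open>y\<close> (\<open>s\<^sub>k\<close> times).
\<close>

fun nested ::
    "(int ^ 'r::finite \<Rightarrow> int ^ 'r \<Rightarrow> rat) \<Rightarrow> ('r \<Rightarrow> nat) \<Rightarrow> 'r series list \<Rightarrow> 'r series" where
  "nested B d [] = (\<lambda>_. 0)"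
| "nested B d [x] = x"
| "nested B d (x # y # ws) = lie B d x (nested B d (y # ws))"

definition dynkin_word :: "'a \<Rightarrow> 'a \<Rightarrow> (nat \<times> nat) list \<Rightarrow> 'a list" where
  "dynkin_word x y ps = concat (map (\<lambda>(r, s). replicate r x @ replicate s y) ps)"

definition dynkin_index :: "nat \<Rightarrow> (nat \<times> nat) list set" where
  "dynkin_index m = {ps. ps \<noteq> [] \<and> (\<forall>(r, s) \<in> set ps. r + s > 0) \<and> (\<Sum>(r, s)\<leftarrow>ps. r + s) = m}"

definition dynkin_coeff :: "(nat \<times> nat) list \<Rightarrow> ratfun" where
  "dynkin_coeff ps = (-1) ^ (length ps - 1) / of_nat (length ps)
     / of_nat ((\<Sum>(r, s)\<leftarrow>ps. r + s) * (\<Prod>(r, s)\<leftarrow>ps. fact r * fact s))"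

text \<open>
  A bracket of \<open>m\<close> elements has no component of degree less than \<open>m\<close>; hence only the terms
  with \<open>m \<le> deg n\<close> contribute to the coefficient of \<open>X\<^sub>n\<close>.
\<close>

definition bch ::
    "(int ^ 'r::finite \<Rightarrow> int ^ 'r \<Rightarrow> rat) \<Rightarrow> ('r \<Rightarrow> nat) \<Rightarrow> 'r series \<Rightarrow> 'r series \<Rightarrow> 'r series" where
  "bch B d x y = (\<lambda>n. \<Sum>m = 1..deg n. \<Sum>ps \<in> dynkin_index m.
     dynkin_coeff ps * nested B d (dynkin_word x y ps) n)"

text \<open>The group element \<open>exp x\<close> is represented by \<open>x\<close> itself.\<close>

definition qgroup ::
    "(int ^ 'r::finite \<Rightarrow> int ^ 'r \<Rightarrow> rat) \<Rightarrow> ('r \<Rightarrow> nat) \<Rightarrow> 'r series monoid" where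
  "qgroup B d = \<lparr>carrier = ghat, monoid.mult = bch B d, one = (\<lambda>_. 0)\<rparr>"

definition qgroup_gt :: "nat \<Rightarrow> 'r::finite series set" where
  "qgroup_gt l = {x \<in> ghat. \<forall>n. x n \<noteq> 0 \<longrightarrow> deg n > l}"

definition has_limit ::
    "(int ^ 'r::finite \<Rightarrow> int ^ 'r \<Rightarrow> rat) \<Rightarrow> ('r \<Rightarrow> nat) \<Rightarrow> (nat \<Rightarrow> 'r series) \<Rightarrow> 'r series \<Rightarrow> bool" where
  "has_limit B d s g \<longleftrightarrow> g \<in> carrier (qgroup B d) \<and>
     (\<forall>l. \<forall>\<^sub>F k in sequentially. qgroup_gt l #>\<^bsub>qgroup B d\<^esub> s k = qgroup_gt l #>\<^bsub>qgroup B d\<^esub> g)"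

definition list_prod :: "('a, 'b) monoid_scheme \<Rightarrow> 'a list \<Rightarrow> 'a" where
  "list_prod G gs = foldr (\<otimes>\<^bsub>G\<^esub>) gs \<one>\<^bsub>G\<^esub>"

text \<open>Infinite products \<open>f 0 \<cdot> f 1 \<cdot> f 2 \<cdots>\<close> and \<open>\<cdots> f 2 \<cdot> f 1 \<cdot> f 0\<close>.\<close>

definition has_prod_right ::
    "(int ^ 'r::finite \<Rightarrow> int ^ 'r \<Rightarrow> rat) \<Rightarrow> ('r \<Rightarrow> nat) \<Rightarrow> (nat \<Rightarrow> 'r series) \<Rightarrow> 'r series \<Rightarrow> bool" where
  "has_prod_right B d f g \<longleftrightarrow> has_limit B d (\<lambda>k. list_prod (qgroup B d) (map f [0..<k])) g"

definition has_prod_left ::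
    "(int ^ 'r::finite \<Rightarrow> int ^ 'r \<Rightarrow> rat) \<Rightarrow> ('r \<Rightarrow> nat) \<Rightarrow> (nat \<Rightarrow> 'r series) \<Rightarrow> 'r series \<Rightarrow> bool" where
  "has_prod_left B d f g \<longleftrightarrow> has_limit B d (\<lambda>k. list_prod (qgroup B d) (map f (rev [0..<k]))) g"

text \<open>For \<open>n \<in> N\<^sup>+\<close> there is at most one \<open>j\<close> with \<open>j n = m\<close>, so the sum has at most one term.\<close>

definition qdilog :: "('r::finite \<Rightarrow> nat) \<Rightarrow> int ^ 'r \<Rightarrow> rat \<Rightarrow> rat \<Rightarrow> 'r series" where
  "qdilog d n a b = (\<lambda>m. \<Sum>j | j \<ge> 1 \<and> int j *s n = m.
     (-1) ^ (j + 1) / (of_nat j * qnum d (of_nat j * a)) * qpow d (of_nat j * b))"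

lemma finite_dynkin_index: "finite (dynkin_index m)"
proof (rule finite_subset)
  show "dynkin_index m \<subseteq> {ps. set ps \<subseteq> {..m} \<times> {..m} \<and> length ps \<le> m}"
  proof
    fix ps assume "ps \<in> dynkin_index m"
    then have *: "\<forall>(r, s) \<in> set ps. r + s > 0" and sum: "(\<Sum>(r, s)\<leftarrow>ps. r + s) = m"
      by (auto simp: dynkin_index_def)
    from * have "length ps \<le> (\<Sum>(r, s)\<leftarrow>ps. r + s)"
      by (induction ps) (auto simp: Suc_le_eq intro: add_less_le_mono)
    moreover have "r \<le> m \<and> s \<le> m" if "(r, s) \<in> set ps" for r s
      using member_le_sum_list[of "r + s" "map (\<lambda>(r, s). r + s) ps"] that sum by force
    ultimately show "ps \<in> {ps. set ps \<subseteq> {..m} \<times> {..m} \<and> length ps \<le> m}"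
      using sum by auto
  qed
  show "finite {ps. set ps \<subseteq> {..m} \<times> {..m} \<and> length ps \<le> m}"
    by (rule finite_lists_length_le) auto
qed

lemma dynkin_index_1: "dynkin_index 1 = {[(1, 0)], [(0, 1)]}"
proof -
  have "ps \<in> {[(1, 0)], [(0, 1)]}" if "ps \<in> dynkin_index 1" for ps
  proof -
    from that obtain r s qs where ps: "ps = (r, s) # qs" and rs: "r + s > 0"
      and sum: "r + s + (\<Sum>(r, s)\<leftarrow>qs. r + s) = 1" and qs: "\<forall>(r, s) \<in> set qs. r + s > 0"
      by (cases ps) (auto simp: dynkin_index_def)
    from sum rs have "(\<Sum>(r, s)\<leftarrow>qs. r + s) = 0" by linarith
    with qs have "qs = []" by (cases qs) auto
    with ps sum show ?thesis by auto
  qed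
  moreover have "[(1, 0)] \<in> dynkin_index 1" "[(0, 1)] \<in> dynkin_index 1"
    by (auto simp: dynkin_index_def)
  ultimately show ?thesis by blast
qed

lemma deg_add: "m \<in> Nplus \<Longrightarrow> m' \<in> Nplus \<Longrightarrow> deg (m + m') = deg m + deg m'"
  by (simp add: Nplus_def deg_def sum.distrib nat_add_distrib)

lemma Nplus_add: "m \<in> Nplus \<Longrightarrow> m' \<in> Nplus \<Longrightarrow> m + m' \<in> Nplus"
  by (auto simp: Nplus_def sum.distrib)

lemma lie_in_ghat: "lie B d x y \<in> ghat"
  by (auto simp: ghat_def lie_def intro!: sum.neutral dest: Nplus_add)

lemma finite_lie_index: "finite {(m, m'). m \<in> Nplus \<and> m' \<in> Nplus \<and> m + m' = (n :: int ^ 'r::finite)}"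
proof (rule finite_subset)
  let ?A = "(\<lambda>f. (\<chi> i. f i)) ` (\<Pi>\<^sub>E i\<in>UNIV. {0..n $ i})"
  have *: "m \<in> ?A" if "\<forall>i. m $ i \<in> {0..n $ i}" for m
    using that by (intro image_eqI[of _ _ "($) m"]) auto
  show "{(m, m'). m \<in> Nplus \<and> m' \<in> Nplus \<and> m + m' = n} \<subseteq> ?A \<times> ?A"
  proof (rule subsetI, elim CollectE case_prodE conjE)
    fix p m m' assume m: "m \<in> Nplus" "m' \<in> Nplus" "m + m' = n" and p: "p = (m, m')"
    then have "\<forall>i. m $ i \<in> {0..n $ i}" "\<forall>i. m' $ i \<in> {0..n $ i}"
      by (auto simp: Nplus_def)
    then show "p \<in> ?A \<times> ?A" using * p by blast
  qed
  show "finite (?A \<times> ?A)" by (intro finite_cartesian_product finite_imageI finite_PiE) auto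
qed

lemma lie_gt:
  assumes "x \<in> qgroup_gt l \<or> y \<in> qgroup_gt l"
  shows "lie B d x y \<in> qgroup_gt l"
proof -
  have "lie B d x y n = 0" if "\<not> deg n > l" for n
    unfolding lie_def
  proof (rule sum.neutral, clarify)
    fix m m' assume m: "m \<in> Nplus" "m' \<in> Nplus" "n = m + m'"
    then have "\<not> deg m > l" "\<not> deg m' > l"
      using that by (auto simp: deg_add)
    then have "x m = 0 \<or> y m' = 0"
      using assms by (auto simp: qgroup_gt_def)
    then show "x m * y m' * qnum d (B m m') = 0" by auto
  qed
  then show ?thesis using lie_in_ghat by (auto simp: qgroup_gt_def)
qed

lemma nested_gt:
  assumes "x \<in> qgroup_gt l" "x \<in> set ws"
  shows "nested B d ws \<in> qgroup_gt l"
  using assms(2)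
proof (induction ws rule: induct_list012)
  case (3 y z ws)
  then show ?case using assms(1) by (auto intro!: lie_gt)
qed (use assms(1) in auto)

text \<open>Limits in \<open>G\<close> are unique, so \<open>has_limit\<close> determines the value of an infinite product.\<close>

context fixed_data
begin

lemma lie_self: "lie B d y y = (\<lambda>_. 0)"
proof
  fix n :: "int ^ 'r"
  let ?S = "{(m, m'). m \<in> Nplus \<and> m' \<in> Nplus \<and> m + m' = n}"
  let ?f = "\<lambda>(m, m'). y m * y m' * qnum d (B m m')"
  have neg: "qnum d (B m' m) = - qnum d (B m m')" for m m'
    using skew[of m' m] by (simp add: qnum_def minus_divide_left)
  have "?f p = - ?f (prod.swap p)" for p
    using neg[of "snd p" "fst p"] by (simp add: case_prod_beta mult.commute)
  then have "sum ?f ?S = (\<Sum>p\<in>?S. - ?f p)"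
    by (intro sum.reindex_bij_witness[of _ prod.swap prod.swap])
       (auto simp: add.commute simp del: minus_mult_left minus_mult_right)
  then show "lie B d y y n = 0"
    by (simp add: lie_def sum_negf)
qed

lemma nested_replicate: "nested B d (replicate (Suc (Suc m)) y) = (\<lambda>_. 0)"
proof (induction m)
  case 0
  then show ?case by (simp add: lie_self)
next
  case (Suc m)
  then have "nested B d (replicate (Suc (Suc (Suc m))) y) = lie B d y (\<lambda>_. 0)" by simp
  also have "\<dots> = (\<lambda>_. 0)" by (auto simp: lie_def intro!: sum.neutral)
  finally show ?case .
qed

lemma nested_dynkin_gt:
  assumes x: "x \<in> qgroup_gt l" and n: "deg n \<le> l" and ps: "ps \<in> dynkin_index m" and m: "m > 1"
  shows "nested B d (dynkin_word x y ps) n = 0"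
proof (cases "\<exists>(r, s) \<in> set ps. r > 0")
  case True
  then obtain r s where "(r, s) \<in> set ps" "r > 0" by auto
  then have "x \<in> set (replicate r x @ replicate s y)" by simp
  with \<open>(r, s) \<in> set ps\<close> have "x \<in> set (dynkin_word x y ps)"
    unfolding dynkin_word_def set_concat set_map by (intro UN_I) auto
  then have "nested B d (dynkin_word x y ps) \<in> qgroup_gt l" by (rule nested_gt[OF x])
  then show ?thesis using n unfolding qgroup_gt_def by (metis (mono_tags, lifting) mem_Collect_eq not_less)
next
  case False
  then have "dynkin_word x y ps = replicate (\<Sum>(r, s)\<leftarrow>ps. r + s) y"
    by (induction ps) (auto simp: dynkin_word_def replicate_add)
  also have "(\<Sum>(r, s)\<leftarrow>ps. r + s) = Suc (Suc (m - 2))"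
    using ps m by (simp add: dynkin_index_def)
  finally show ?thesis using nested_replicate by metis
qed

lemma bch_gt:
  assumes x: "x \<in> qgroup_gt l" and n: "n \<in> Nplus" "deg n \<le> l"
  shows "bch B d x y n = y n"
proof -
  let ?T = "\<lambda>m. \<Sum>ps \<in> dynkin_index m. dynkin_coeff ps * nested B d (dynkin_word x y ps) n"
  have "deg n \<ge> 1" using n(1) by (auto simp: Nplus_def deg_def)
  then have "bch B d x y n = ?T 1 + (\<Sum>m = 2..deg n. ?T m)"
    by (simp add: bch_def sum.atLeast_Suc_atMost numeral_2_eq_2)
  also have "(\<Sum>m = 2..deg n. ?T m) = 0"
    using nested_dynkin_gt[OF x n(2)] by (intro sum.neutral ballI) auto
  also have "?T 1 = x n + y n"
    by (simp add: dynkin_index_1[unfolded One_nat_def] dynkin_coeff_def dynkin_word_def)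
  also have "x n = 0" using x n by (auto simp: qgroup_gt_def)
  finally show ?thesis by simp
qed

lemma has_limit_unique:
  assumes g: "has_limit B d s g" and h: "has_limit B d s h"
  shows "g = h"
proof
  fix n
  show "g n = h n"
  proof (cases "n \<in> Nplus")
    case False
    then show ?thesis using g h by (simp add: has_limit_def qgroup_def ghat_def)
  next
    case True
    define l where "l = deg n"
    let ?C = "\<lambda>u. qgroup_gt l #>\<^bsub>qgroup B d\<^esub> u"
    have "\<forall>\<^sub>F k in sequentially. ?C (s k) = ?C g \<and> ?C (s k) = ?C h"
      using g h by (auto simp: has_limit_def intro: eventually_conj)
    then have eq: "?C g = ?C h"
      by (metis (mono_tags, lifting) eventually_happens' sequentially_bot)
    have zero: "(\<lambda>_. 0) \<in> qgroup_gt l" by (simp add: qgroup_gt_def ghat_def)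
    then have "bch B d (\<lambda>_. 0) g \<in> ?C g"
      by (auto simp: r_coset_def qgroup_def)
    then obtain x where x: "x \<in> qgroup_gt l" "bch B d (\<lambda>_. 0) g = bch B d x h"
      unfolding eq by (auto simp: r_coset_def qgroup_def)
    have "g n = bch B d (\<lambda>_. 0) g n" using bch_gt[OF zero True] by (simp add: l_def)
    also have "\<dots> = h n" using bch_gt[OF x(1) True] x(2) by (simp add: l_def)
    finally show ?thesis .
  qed
qed

end

end

theory Submission
  imports Defs "HOL-Computational_Algebra.Formal_Power_Series" "HOL-Analysis.Cartesian_Space"
begin

text \<open>
  The Lie algebra embeds into the quantum torus with \<open>Y\<^sub>n Y\<^sub>k = q\<^sup>{\<^sup>n\<^sup>,\<^sup>k\<^sup>} Y\<^sub>n\<^sub>+\<^sub>k\<close> by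
  \<open>X\<^sub>n = Y\<^sub>n / (q - q\<^sup>-\<^sup>1)\<close>, and by the Baker--Campbell--Hausdorff theorem the exponential embeds the
  group into the invertible series over the quantum torus. There \<open>[n]\<^sub>a\<^sub>,\<^sub>b\<close> becomes \<open>\<Phi>\<^sub>Q (q\<^sup>b Y\<^sub>n)\<close> for
  \<open>Q = q\<^sup>a\<close>, where \<open>\<Phi>\<^sub>Q (Q z) = (1 + z) \<Phi>\<^sub>Q (Q\<^sup>-\<^sup>1 z)\<close>. This functional equation yields the pentagon
  relation, and \<open>\<Phi>\<^sub>Q (z) = \<Phi>\<^sub>R (Q z) \<Phi>\<^sub>R (Q\<^sup>-\<^sup>1 z)\<close> for \<open>R = Q\<^sup>2\<close>. Let \<open>Q = q\<^sup>c\<^sup>/\<^sup>2\<close>, write \<open>\<Phi>\<close> and \<open>\<Phi>\<^sub>2\<close>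
  for \<open>\<Phi>\<^sub>Q\<close> and \<open>\<Phi>\<^sub>R\<close>, and \<open>(i, j)\<close> for the normalised monomial of exponent \<open>i n + j n'\<close>. These two
  facts give
  \<open>\<Phi>(0,1) \<Phi>(1,0) = \<Phi>(1,0) \<Phi>\<^sub>2(Q(2,1)) \<Phi>(Q(1,1)) \<cdot> \<Phi>\<^sub>2(Q(0,1)) \<Phi>\<^sub>2(Q\<^sup>-\<^sup>1(2,1)) \<cdot>
  \<Phi>(Q\<^sup>-\<^sup>1(1,1)) \<Phi>\<^sub>2(Q\<^sup>-\<^sup>1(0,1))\<close>.
  The two factors in the middle are again of the form of the left-hand side, with \<open>c\<close> doubled and in
  higher degree, so modulo each degree they are factorized by induction. Moving
  \<open>\<Phi>(Q\<^sup>\<plusminus>\<^sup>1(1,1))\<close> to the centre by pentagon relations recombines the pairs of \<open>\<Phi>\<^sub>2\<close> into the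
  remaining \<open>\<Phi>(p+1,p)\<close> and \<open>\<Phi>(p,p+1)\<close>.
\<close>

section \<open>Power series modulo powers of the variable\<close>

unbundle no vec_syntax
unbundle fps_syntax

definition fps_cong :: "nat \<Rightarrow> 'a::zero fps \<Rightarrow> 'a fps \<Rightarrow> bool" where
  "fps_cong m f g \<longleftrightarrow> (\<forall>k<m. f $ k = g $ k)"

lemma fps_cong_refl [simp]: "fps_cong m f f"
  by (simp add: fps_cong_def)

lemma fps_cong_sym: "fps_cong m f g \<Longrightarrow> fps_cong m g f"
  by (simp add: fps_cong_def)

lemma fps_cong_trans [trans]: "fps_cong m f g \<Longrightarrow> fps_cong m g h \<Longrightarrow> fps_cong m f h"
  by (simp add: fps_cong_def)

lemma fps_cong_mono: "fps_cong m f g \<Longrightarrow> n \<le> m \<Longrightarrow> fps_cong n f g"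
  by (simp add: fps_cong_def)

lemma fps_cong_0 [simp]: "fps_cong 0 f g"
  by (simp add: fps_cong_def)

lemma fps_cong_Suc_0 [simp]: "fps_cong (Suc 0) f g \<longleftrightarrow> f $ 0 = g $ 0"
  by (simp add: fps_cong_def)

lemma fps_cong_all_imp_eq: "(\<And>m. fps_cong m f g) \<Longrightarrow> f = g"
  by (auto simp: fps_eq_iff fps_cong_def)

lemma fps_cong_diff:
  fixes f g :: "'a::group_add fps"
  shows "fps_cong m f f' \<Longrightarrow> fps_cong m g g' \<Longrightarrow> fps_cong m (f - g) (f' - g')"
  by (simp add: fps_cong_def)

lemma fps_cong_diff_0_iff: "fps_cong m (f - g) 0 \<longleftrightarrow> fps_cong m f g"
  for f g :: "'a::group_add fps"
  by (simp add: fps_cong_def)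

lemma fps_cong_sum:
  fixes f g :: "'b \<Rightarrow> 'a::comm_monoid_add fps"
  shows "(\<And>i. i \<in> I \<Longrightarrow> fps_cong m (f i) (g i)) \<Longrightarrow> fps_cong m (\<Sum>i\<in>I. f i) (\<Sum>i\<in>I. g i)"
  by (simp add: fps_cong_def fps_sum_nth)

lemma fps_cong_mult:
  fixes f g :: "'a::semiring_0 fps"
  shows "fps_cong m f f' \<Longrightarrow> fps_cong m g g' \<Longrightarrow> fps_cong m (f * g) (f' * g')"
  by (auto simp: fps_cong_def fps_mult_nth intro!: sum.cong)

lemma fps_cong_power:
  fixes f g :: "'a::semiring_1 fps"
  shows "fps_cong m f g \<Longrightarrow> fps_cong m (f ^ k) (g ^ k)"
  by (induction k) (auto intro: fps_cong_mult)

lemma fps_cong_deriv: "fps_cong (Suc m) f g \<Longrightarrow> fps_cong m (fps_deriv f) (fps_deriv g)"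
  by (simp add: fps_cong_def)

lemma fps_cong_mult_0:
  fixes f g :: "'a::semiring_0 fps"
  assumes "fps_cong m f 0" "fps_cong n g 0"
  shows "fps_cong (m + n) (f * g) 0"
  unfolding fps_cong_def fps_mult_nth fps_zero_nth
proof (intro allI impI sum.neutral ballI)
  fix k i assume "k < m + n" "i \<in> {0..k}"
  then have "i < m \<or> k - i < n" by auto
  with assms show "f $ i * g $ (k - i) = 0"
    by (auto simp: fps_cong_def)
qed

lemma fps_cong_power_0:
  fixes f :: "'a::semiring_1 fps"
  shows "fps_cong m f 0 \<Longrightarrow> fps_cong (m * k) (f ^ k) 0"
  by (induction k) (auto intro: fps_cong_mult_0)

lemma fps_power_nth_eq_0:
  fixes f :: "'a::semiring_1 fps"
  shows "f $ 0 = 0 \<Longrightarrow> n < k \<Longrightarrow> (f ^ k) $ n = 0"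
  using fps_cong_power_0[of 1 f k] by (simp add: fps_cong_def)

lemma fps_cong_sum_triangle:
  fixes t :: "nat \<Rightarrow> nat \<Rightarrow> 'a::comm_monoid_add fps"
  assumes "\<And>i j. fps_cong (i + j) (t i j) 0"
  shows "fps_cong m (\<Sum>i<m. \<Sum>j<m. t i j) (\<Sum>k<m. \<Sum>i\<le>k. t i (k - i))"
  unfolding fps_cong_def
proof (intro allI impI)
  fix n assume "n < m"
  then have "i + j < m" if "t i j $ n \<noteq> 0" for i j
    using assms[of i j] that \<open>n < m\<close> unfolding fps_cong_def
    by (metis fps_zero_nth le_less_trans not_le)
  then have "(\<Sum>i<m. \<Sum>j<m. t i j $ n) = (\<Sum>(i, j)\<in>{(i, j). i + j < m}. t i j $ n)"
    unfolding sum.cartesian_product by (intro sum.mono_neutral_right) auto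
  then show "(\<Sum>i<m. \<Sum>j<m. t i j) $ n = (\<Sum>k<m. \<Sum>i\<le>k. t i (k - i)) $ n"
    by (simp add: fps_sum_nth sum.triangle_reindex)
qed

corollary fps_cong_Cauchy_product:
  fixes a b :: "nat \<Rightarrow> 'a::semiring_0 fps"
  assumes "\<And>i. fps_cong i (a i) 0" "\<And>i. fps_cong i (b i) 0"
  shows "fps_cong m ((\<Sum>i<m. a i) * (\<Sum>i<m. b i)) (\<Sum>k<m. \<Sum>i\<le>k. a i * b (k - i))"
  unfolding sum_product by (intro fps_cong_sum_triangle fps_cong_mult_0 assms)

lemma fps_monomial_mult:
  fixes x y :: "'a::semiring_1"
  shows "(fps_const x * fps_X ^ m) * (fps_const y * fps_X ^ n) =
      fps_const (x * y) * fps_X ^ (m + n)"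
proof -
  have "(fps_const x * fps_X ^ m) * (fps_const y * fps_X ^ n) =
      fps_const x * (fps_X ^ m * fps_const y) * fps_X ^ n"
    by (simp add: mult.assoc)
  also have "fps_X ^ m * fps_const y = fps_const y * fps_X ^ m"
    by (rule fps_mult_fps_X_power_commute)
  finally show ?thesis
    by (simp add: power_add mult.assoc flip: fps_const_mult)
qed

lemma fps_monomial_power:
  fixes x :: "'a::semiring_1"
  shows "(fps_const x * fps_X ^ m) ^ k = fps_const (x ^ k) * fps_X ^ (k * m)"
  by (induction k) (simp_all add: fps_monomial_mult)

section \<open>Functional calculus over noncommutative algebras\<close>

lemma (in module) module_hom_funpow:
  assumes "module_hom scale scale T"
  shows "module_hom scale scale (T ^^ k)"
proof (induction k)
  case 0
  show ?case using module_hom_id by (simp add: id_def)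
next
  case (Suc k)
  from module_hom_compose[OF this assms] show ?case by (simp add: comp_def)
qed

locale unital_algebra = module scale
  for scale :: "'k::comm_ring_1 \<Rightarrow> 'a::ring_1 \<Rightarrow> 'a" (infixr "*\<^sub>K" 73) +
  assumes scale_mult_left: "(c *\<^sub>K x) * y = c *\<^sub>K (x * y)"
    and scale_mult_right: "x * (c *\<^sub>K y) = c *\<^sub>K (x * y)"
begin

lemmas scale_mult = scale_mult_left scale_mult_right

lemma scale_power: "(c *\<^sub>K x) ^ k = c ^ k *\<^sub>K x ^ k"
  by (induction k) (auto simp: scale_mult mult.commute)

lemma scale_of_nat: "of_nat k *\<^sub>K x = of_nat k * x"
  by (induction k) (auto simp: scale_left_distrib distrib_right)

end

definition fps_scale :: "('k \<Rightarrow> 'a \<Rightarrow> 'a) \<Rightarrow> 'k \<Rightarrow> 'a::zero fps \<Rightarrow> 'a fps" where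
  "fps_scale s c f = Abs_fps (\<lambda>n. s c (f $ n))"

lemma fps_scale_nth [simp]: "fps_scale s c f $ n = s c (f $ n)"
  by (simp add: fps_scale_def)

context unital_algebra
begin

abbreviation scale_fps :: "'k \<Rightarrow> 'a fps \<Rightarrow> 'a fps" (infixr "*\<^sub>F" 73) where
  "c *\<^sub>F f \<equiv> fps_scale scale c f"

lemma unital_algebra_fps: "unital_algebra (fps_scale scale)"
  by unfold_locales
    (auto simp: fps_eq_iff fps_mult_nth scale_mult scale_sum_right scale_right_distrib
        scale_left_distrib)

lemma fps_cong_scale: "fps_cong m f g \<Longrightarrow> fps_cong m (c *\<^sub>F f) (c *\<^sub>F g)"
  by (simp add: fps_cong_def)

lemma fps_cong_scale_0: "fps_cong m f 0 \<Longrightarrow> fps_cong m (c *\<^sub>F f) 0"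
  by (simp add: fps_cong_def)

lemma fps_deriv_scale: "fps_deriv (c *\<^sub>F f) = c *\<^sub>F fps_deriv f"
  by (simp add: fps_eq_iff scale_mult)

text \<open>
  The series \<open>\<Sum>\<^sub>k p\<^sub>k T\<^sup>k w\<close> and \<open>\<Sum>\<^sub>k p\<^sub>k z\<^sup>k\<close>. They are only used for an operator \<open>T\<close> that raises
  orders and for \<open>z\<close> without constant term, where the terms with \<open>k > n\<close> do not contribute to the
  coefficient of index \<open>n\<close>.
\<close>

definition op_eval :: "'k fps \<Rightarrow> ('a fps \<Rightarrow> 'a fps) \<Rightarrow> 'a fps \<Rightarrow> 'a fps" where
  "op_eval p T w = Abs_fps (\<lambda>n. \<Sum>k\<le>n. p $ k *\<^sub>K (T ^^ k) w $ n)"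

definition fps_eval :: "'k fps \<Rightarrow> 'a fps \<Rightarrow> 'a fps" where
  "fps_eval p z = Abs_fps (\<lambda>n. \<Sum>k\<le>n. p $ k *\<^sub>K (z ^ k) $ n)"

lemma op_eval_diff_left: "op_eval (p - q) T w = op_eval p T w - op_eval q T w"
  by (simp add: op_eval_def fps_eq_iff scale_left_diff_distrib sum_subtractf)

lemma op_eval_1 [simp]: "op_eval 1 T w = w"
  by (simp add: op_eval_def fps_eq_iff if_distrib[of "\<lambda>c. c *\<^sub>K _"] cong: if_cong)

end

locale raising_operator = unital_algebra scale + module_hom "fps_scale scale" "fps_scale scale" T
  for scale :: "'k::comm_ring_1 \<Rightarrow> 'a::ring_1 \<Rightarrow> 'a" (infixr "*\<^sub>K" 73) and T :: "'a fps \<Rightarrow> 'a fps" +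
  assumes raising: "fps_cong m v 0 \<Longrightarrow> fps_cong (Suc m) (T v) 0"
begin

sublocale funpow: module_hom "fps_scale scale" "fps_scale scale" "T ^^ k" for k
  by (rule m1.module_hom_funpow[OF module_hom_axioms])

lemma fps_cong_funpow_0: "fps_cong m v 0 \<Longrightarrow> fps_cong (m + k) ((T ^^ k) v) 0"
  by (induction k) (auto intro: raising)

lemma funpow_nth_eq_0: "n < k \<Longrightarrow> (T ^^ k) v $ n = 0"
  using fps_cong_funpow_0[of 0 v k] by (simp add: fps_cong_def)

lemma fps_cong_funpow:
  assumes "fps_cong m v w"
  shows "fps_cong m ((T ^^ k) v) ((T ^^ k) w)"
proof -
  have "fps_cong m (v - w) 0"
    using assms by (simp only: fps_cong_diff_0_iff)
  then have "fps_cong (m + k) ((T ^^ k) v - (T ^^ k) w) 0"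
    unfolding funpow.diff[symmetric] by (rule fps_cong_funpow_0)
  then show ?thesis
    unfolding fps_cong_diff_0_iff by (rule fps_cong_mono) simp
qed

lemma op_eval_cong_sum: "fps_cong m (op_eval p T w) (\<Sum>k<m. p $ k *\<^sub>F (T ^^ k) w)"
  unfolding fps_cong_def op_eval_def fps_sum_nth fps_nth_Abs_fps fps_scale_nth
  by (intro allI impI sum.mono_neutral_left) (auto simp: funpow_nth_eq_0)

lemma fps_cong_op_eval:
  assumes "fps_cong m v w"
  shows "fps_cong m (op_eval p T v) (op_eval p T w)"
proof -
  have "fps_cong m (op_eval p T v) (\<Sum>k<m. p $ k *\<^sub>F (T ^^ k) v)"
    by (rule op_eval_cong_sum)
  also have "fps_cong m \<dots> (\<Sum>k<m. p $ k *\<^sub>F (T ^^ k) w)"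
    by (intro fps_cong_sum fps_cong_scale fps_cong_funpow assms)
  also have "fps_cong m \<dots> (op_eval p T w)"
    by (rule fps_cong_sym[OF op_eval_cong_sum])
  finally show ?thesis .
qed

lemma op_eval_mult: "op_eval (p * q) T w = op_eval p T (op_eval q T w)"
proof (rule fps_cong_all_imp_eq)
  fix m
  let ?t = "\<lambda>i j. (p $ i * q $ j) *\<^sub>F (T ^^ (i + j)) w"
  have "fps_cong m (op_eval p T (op_eval q T w)) (op_eval p T (\<Sum>j<m. q $ j *\<^sub>F (T ^^ j) w))"
    by (intro fps_cong_op_eval op_eval_cong_sum)
  also have "fps_cong m \<dots> (\<Sum>i<m. p $ i *\<^sub>F (T ^^ i) (\<Sum>j<m. q $ j *\<^sub>F (T ^^ j) w))"
    by (rule op_eval_cong_sum)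
  also have "\<dots> = (\<Sum>i<m. \<Sum>j<m. ?t i j)"
    by (simp add: funpow.sum funpow.scale m1.scale_sum_right funpow_add)
  also have "fps_cong m \<dots> (\<Sum>k<m. \<Sum>i\<le>k. ?t i (k - i))"
    by (intro fps_cong_sum_triangle fps_cong_scale_0 fps_cong_funpow_0[of 0, simplified])
  also have "\<dots> = (\<Sum>k<m. (p * q) $ k *\<^sub>F (T ^^ k) w)"
    by (auto simp: fps_mult_nth m1.scale_sum_left atLeast0AtMost intro!: sum.cong)
  also have "fps_cong m \<dots> (op_eval (p * q) T w)"
    by (rule fps_cong_sym[OF op_eval_cong_sum])
  finally show "fps_cong m (op_eval (p * q) T w) (op_eval p T (op_eval q T w))"
    by (rule fps_cong_sym)
qed

lemma funpow_op_eval: "(op_eval q T ^^ k) w = op_eval (q ^ k) T w"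
  by (induction k) (auto simp: op_eval_mult)

lemma op_eval_compose:
  assumes "q $ 0 = 0"
  shows "op_eval (p oo q) T w = op_eval p (op_eval q T) w"
proof (rule fps_ext)
  fix n
  have "op_eval p (op_eval q T) w $ n = (\<Sum>k\<le>n. \<Sum>j\<le>n. (p $ k * (q ^ k) $ j) *\<^sub>K (T ^^ j) w $ n)"
    by (simp add: op_eval_def[of p "op_eval q T"] funpow_op_eval)
      (simp add: op_eval_def scale_sum_right)
  also have "\<dots> = (\<Sum>j\<le>n. \<Sum>k\<le>n. (p $ k * (q ^ k) $ j) *\<^sub>K (T ^^ j) w $ n)"
    by (rule sum.swap)
  also have "\<dots> = (\<Sum>j\<le>n. (p oo q) $ j *\<^sub>K (T ^^ j) w $ n)"
  proof (intro sum.cong refl)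
    fix j assume "j \<in> {..n}"
    then have "(p oo q) $ j = (\<Sum>k\<le>n. p $ k * (q ^ k) $ j)"
      using assms unfolding fps_compose_nth
      by (intro sum.mono_neutral_left) (auto simp: fps_power_nth_eq_0)
    then show "(\<Sum>k\<le>n. (p $ k * (q ^ k) $ j) *\<^sub>K (T ^^ j) w $ n) = (p oo q) $ j *\<^sub>K (T ^^ j) w $ n"
      by (simp flip: scale_sum_left)
  qed
  finally show "op_eval (p oo q) T w $ n = op_eval p (op_eval q T) w $ n"
    by (simp add: op_eval_def)
qed

end

context unital_algebra
begin

lemma raising_operator_mult_left:
  assumes "z $ 0 = 0"
  shows "raising_operator scale ((*) z)"
proof -
  interpret fps: unital_algebra "fps_scale scale" by (rule unital_algebra_fps)
  show ?thesis
  proof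
    fix m v assume "fps_cong m v (0 :: 'a fps)"
    then show "fps_cong (Suc m) (z * v) 0"
      using fps_cong_mult_0[of 1 z m v] assms by simp
  qed (simp_all add: distrib_left fps.scale_mult)
qed

lemma funpow_mult_left: "((*) z ^^ k) w = z ^ k * w" for w :: "'b::monoid_mult"
  by (induction k) (auto simp: mult.assoc)

lemma fps_eval_cong_sum:
  assumes "z $ 0 = 0"
  shows "fps_cong m (fps_eval p z) (\<Sum>k<m. p $ k *\<^sub>F z ^ k)"
proof -
  have "fps_eval p z = op_eval p ((*) z) 1"
    by (simp add: fps_eval_def op_eval_def funpow_mult_left)
  then show ?thesis
    using raising_operator.op_eval_cong_sum[OF raising_operator_mult_left[OF assms], of m p 1]
    by (simp add: funpow_mult_left)
qed

lemma op_eval_mult_left: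
  assumes "z $ 0 = 0"
  shows "op_eval p ((*) z) w = fps_eval p z * w"
proof (rule fps_cong_all_imp_eq)
  interpret fps: unital_algebra "fps_scale scale" by (rule unital_algebra_fps)
  interpret raising_operator scale "(*) z" by (rule raising_operator_mult_left) fact
  fix m
  have "fps_cong m (op_eval p ((*) z) w) (\<Sum>k<m. p $ k *\<^sub>F ((*) z ^^ k) w)"
    by (rule op_eval_cong_sum)
  also have "\<dots> = (\<Sum>k<m. p $ k *\<^sub>F z ^ k) * w"
    by (simp add: funpow_mult_left sum_distrib_right fps.scale_mult)
  also have "fps_cong m \<dots> (fps_eval p z * w)"
    by (intro fps_cong_mult fps_cong_sym[OF fps_eval_cong_sum[OF assms]]) simp
  finally show "fps_cong m (op_eval p ((*) z) w) (fps_eval p z * w)" .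
qed

lemma fps_eval_nth_0 [simp]: "fps_eval p z $ 0 = p $ 0 *\<^sub>K 1"
  by (simp add: fps_eval_def)

lemma fps_eval_1 [simp]: "fps_eval 1 z = 1"
  by (simp add: fps_eval_def fps_eq_iff if_distrib[of "\<lambda>c. c *\<^sub>K _"] cong: if_cong)

lemma fps_eval_0_right: "fps_eval p 0 = fps_const (p $ 0 *\<^sub>K 1)"
  by (rule fps_ext)
    (simp add: fps_eval_def power_0_left if_distrib[of "\<lambda>f. _ *\<^sub>K (f $ _)"] cong: if_cong)

lemma fps_eval_add: "fps_eval (p + q) z = fps_eval p z + fps_eval q z"
  by (simp add: fps_eval_def fps_eq_iff scale_left_distrib sum.distrib)

lemma fps_eval_diff: "fps_eval (p - q) z = fps_eval p z - fps_eval q z"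
  by (simp add: fps_eval_def fps_eq_iff scale_left_diff_distrib sum_subtractf)

lemma fps_eval_scale: "fps_eval p (c *\<^sub>F z) = fps_eval (p oo (fps_const c * fps_X)) z"
proof -
  interpret fps: unital_algebra "fps_scale scale" by (rule unital_algebra_fps)
  show ?thesis
    by (simp add: fps_eval_def fps_eq_iff fps.scale_power mult.commute[of "p $ _"])
qed

lemma fps_eval_mult: "z $ 0 = 0 \<Longrightarrow> fps_eval (p * q) z = fps_eval p z * fps_eval q z"
  using raising_operator.op_eval_mult[OF raising_operator_mult_left, of z p q 1]
  by (simp add: op_eval_mult_left)

lemma fps_eval_compose:
  assumes "z $ 0 = 0" "q $ 0 = 0"
  shows "fps_eval (p oo q) z = fps_eval p (fps_eval q z)"
proof -
  have "op_eval q ((*) z) = (*) (fps_eval q z)"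
    using assms by (auto simp: op_eval_mult_left)
  then show ?thesis
    using assms
      raising_operator.op_eval_compose[OF raising_operator_mult_left[OF assms(1)] assms(2), of p 1]
    by (simp add: op_eval_mult_left)
qed

lemma fps_eval_fps_X:
  assumes "z $ 0 = 0"
  shows "fps_eval fps_X z = z"
proof (rule fps_ext)
  fix n
  have "(\<Sum>k\<le>n. fps_X $ k *\<^sub>K (z ^ k) $ n) = (\<Sum>k\<le>n. if k = 1 then z $ n else 0)"
    by (intro sum.cong) (auto simp: fps_X_def)
  also have "\<dots> = z $ n"
    using assms by (cases n) auto
  finally show "fps_eval fps_X z $ n = z $ n"
    by (simp add: fps_eval_def)
qed

lemma fps_cong_fps_eval: "fps_cong m z z' \<Longrightarrow> fps_cong m (fps_eval p z) (fps_eval p z')"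
  using fps_cong_power[of m z z'] unfolding fps_cong_def fps_eval_def by simp

lemma fps_eval_intertwine:
  assumes "z * a = a * z'" "z $ 0 = 0" "z' $ 0 = 0"
  shows "fps_eval p z * a = a * fps_eval p z'"
proof (rule fps_cong_all_imp_eq)
  interpret fps: unital_algebra "fps_scale scale" by (rule unital_algebra_fps)
  fix m
  have powers: "z ^ k * a = a * z' ^ k" for k
  proof (induction k)
    case (Suc k)
    have "z ^ Suc k * a = z * (a * z' ^ k)"
      by (simp add: mult.assoc Suc)
    also have "\<dots> = a * z' ^ Suc k"
      by (simp add: assms(1) flip: mult.assoc)
    finally show ?case .
  qed simp
  have "fps_cong m (fps_eval p z * a) ((\<Sum>k<m. p $ k *\<^sub>F z ^ k) * a)"
    by (intro fps_cong_mult fps_eval_cong_sum assms) simp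
  also have "\<dots> = a * (\<Sum>k<m. p $ k *\<^sub>F z' ^ k)"
    by (simp add: sum_distrib_left sum_distrib_right fps.scale_mult powers)
  also have "fps_cong m \<dots> (a * fps_eval p z')"
    by (intro fps_cong_mult fps_cong_sym[OF fps_eval_cong_sum] assms) simp
  finally show "fps_cong m (fps_eval p z * a) (a * fps_eval p z')" .
qed

end

section \<open>Exponentials over algebras of characteristic zero\<close>

locale char_0_algebra = unital_algebra scale
  for scale :: "'k::field_char_0 \<Rightarrow> 'a::ring_1 \<Rightarrow> 'a" (infixr "*\<^sub>K" 73)
begin

sublocale vector_space scale
  using module_axioms by (simp add: module_iff_vector_space)

sublocale fps: unital_algebra "fps_scale scale"
  by (rule unital_algebra_fps)

lemma char_0_algebra_fps: "char_0_algebra (fps_scale scale)"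
  by (rule char_0_algebra.intro) (rule unital_algebra_fps)

lemma fps_deriv_eq_imp_eq:
  assumes "fps_deriv f = fps_deriv g" "f $ 0 = g $ 0"
  shows "f = (g :: 'a fps)"
proof (rule fps_ext)
  fix n
  show "f $ n = g $ n"
  proof (cases n)
    case (Suc m)
    have "of_nat (Suc m) *\<^sub>K f $ Suc m = of_nat (Suc m) *\<^sub>K g $ Suc m"
      using arg_cong[OF assms(1), of "\<lambda>h. h $ m"] by (simp add: scale_of_nat del: of_nat_Suc)
    then show ?thesis
      unfolding Suc scale_cancel_left by (simp del: of_nat_Suc)
  qed (simp add: assms)
qed

definition nc_exp :: "'a fps \<Rightarrow> 'a fps" where
  "nc_exp z = fps_eval (fps_exp 1) z"

lemma nc_exp_nth_0 [simp]: "nc_exp z $ 0 = 1"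
  by (simp add: nc_exp_def)

lemma nc_exp_0 [simp]: "nc_exp 0 = 1"
  by (simp add: nc_exp_def fps_eval_0_right)

lemma nc_exp_mult_uminus:
  assumes "z $ 0 = 0"
  shows "nc_exp z * nc_exp (- z) = 1"
proof -
  have "nc_exp (- z) = fps_eval (fps_exp 1 oo (fps_const (- 1) * fps_X)) z"
    unfolding nc_exp_def fps_eval_scale[symmetric] by simp
  then have "nc_exp z * nc_exp (- z) = fps_eval (fps_exp 1 * fps_exp (- 1)) z"
    using assms by (simp only: nc_exp_def fps_eval_mult fps_exp_compose_linear) simp
  also have "fps_exp 1 * fps_exp (- 1) = (1 :: 'k fps)"
    by (simp flip: fps_exp_add_mult)
  finally show ?thesis by simp
qed

lemma nc_exp_right_cancel:
  assumes "v * nc_exp z = w * nc_exp z" "z $ 0 = 0"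
  shows "v = w"
proof -
  from assms(1) have "v * (nc_exp z * nc_exp (- z)) = w * (nc_exp z * nc_exp (- z))"
    by (simp only: mult.assoc[symmetric])
  with assms(2) show ?thesis by (simp add: nc_exp_mult_uminus)
qed

end

lemma fps_ln_compose_exp: "fps_ln 1 oo (fps_exp 1 - 1) = (fps_X :: 'k::field_char_0 fps)"
  by (simp add: fps_ln_fps_exp_inv fps_inv)

lemma fps_exp_compose_ln: "fps_exp 1 oo fps_ln 1 = (1 + fps_X :: 'k::field_char_0 fps)"
proof -
  have "(fps_exp 1 - 1) oo fps_ln 1 = (fps_X :: 'k fps)"
    by (simp add: fps_ln_fps_exp_inv fps_inv_right)
  then show ?thesis
    by (simp add: fps_compose_sub_distrib algebra_simps)
qed

lemma fps_ln_over_X_compose_exp: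
  "(fps_shift 1 (fps_ln 1) oo (fps_exp 1 - 1)) * fps_shift 1 (fps_exp 1) =
    (1 :: 'k::field_char_0 fps)"
proof -
  let ?E = "fps_exp 1 - 1 :: 'k fps"
  have exp_minus_1_eq: "?E = fps_X * fps_shift 1 (fps_exp 1)"
    by (simp add: fps_eq_iff)
  have ln_eq: "fps_ln 1 = fps_X * fps_shift 1 (fps_ln 1 :: 'k fps)"
    by (simp add: fps_eq_iff)
  have "fps_X * ((fps_shift 1 (fps_ln 1) oo ?E) * fps_shift 1 (fps_exp 1)) =
      (fps_X oo ?E) * (fps_shift 1 (fps_ln 1) oo ?E)"
    by (simp add: exp_minus_1_eq mult_ac)
  also have "\<dots> = fps_X * fps_shift 1 (fps_ln 1) oo ?E"
    by (simp add: fps_compose_mult_distrib)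
  also have "\<dots> = fps_X"
    unfolding ln_eq[symmetric] by (rule fps_ln_compose_exp)
  finally show ?thesis by simp
qed

context char_0_algebra
begin

lemma fps_eval_ln_nc_exp:
  assumes "z $ 0 = 0"
  shows "fps_eval (fps_ln 1) (nc_exp z - 1) = z"
proof -
  have "nc_exp z - 1 = fps_eval (fps_exp 1 - 1) z"
    by (simp add: fps_eval_diff nc_exp_def)
  with assms show ?thesis
    by (simp add: fps_eval_fps_X fps_ln_compose_exp flip: fps_eval_compose)
qed

lemma nc_exp_surj:
  assumes "u $ 0 = 1"
  obtains z where "z $ 0 = 0" "nc_exp z = u"
proof
  show "fps_eval (fps_ln 1) (u - 1) $ 0 = 0"
    by simp
  show "nc_exp (fps_eval (fps_ln 1) (u - 1)) = u"
    using assms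
    by (simp add: nc_exp_def fps_exp_compose_ln fps_eval_add fps_eval_fps_X flip: fps_eval_compose)
qed

lemma fps_cong_nc_exp_iff:
  assumes "z $ 0 = 0" "z' $ 0 = 0"
  shows "fps_cong m (nc_exp z) (nc_exp z') \<longleftrightarrow> fps_cong m z z'"
proof
  assume "fps_cong m (nc_exp z) (nc_exp z')"
  then have "fps_cong m (fps_eval (fps_ln 1) (nc_exp z - 1)) (fps_eval (fps_ln 1) (nc_exp z' - 1))"
    by (intro fps_cong_fps_eval fps_cong_diff) auto
  then show "fps_cong m z z'"
    by (simp add: fps_eval_ln_nc_exp assms)
qed (simp add: nc_exp_def fps_cong_fps_eval)

lemma nc_exp_cong_sum: "z $ 0 = 0 \<Longrightarrow> fps_cong m (nc_exp z) (\<Sum>k<m. (1 / fact k) *\<^sub>F z ^ k)"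
  using fps_eval_cong_sum[of z m "fps_exp 1"] by (simp add: nc_exp_def)

end

definition ad :: "'a::ring \<Rightarrow> 'a \<Rightarrow> 'a" where
  "ad x w = x * w - w * x"

lemma ad_zero_right [simp]: "ad x 0 = 0"
  by (simp add: ad_def)

lemma ad_self [simp]: "ad x x = 0"
  by (simp add: ad_def)

lemma power_mult_ad:
  fixes z w :: "'a::ring_1"
  shows "z ^ k * w = (\<Sum>i\<le>k. of_nat (k choose i) * (ad z ^^ i) w * z ^ (k - i))"
proof (induction k)
  case (Suc k)
  let ?a = "\<lambda>i. (ad z ^^ i) w"
  let ?b = "\<lambda>i. of_nat (k choose i) * ?a i * z ^ (Suc k - i)"
  have step: "z * (of_nat c * ?a i * z ^ j) =
      of_nat c * ?a (Suc i) * z ^ j + of_nat c * ?a i * z ^ Suc j" for c i j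
    by (simp add: ad_def algebra_simps mult_of_nat_commute power_commutes)
  have "z ^ Suc k * w = z * (\<Sum>i\<le>k. of_nat (k choose i) * ?a i * z ^ (k - i))"
    by (simp add: mult.assoc[of z] Suc)
  also have "\<dots> = (\<Sum>i\<le>k. of_nat (k choose i) * ?a (Suc i) * z ^ (k - i)) + (\<Sum>i\<le>k. ?b i)"
    by (simp add: sum_distrib_left step sum.distrib Suc_diff_le del: power_Suc funpow.simps)
  also have "(\<Sum>i\<le>k. ?b i) = (\<Sum>i\<le>Suc k. ?b i)"
    by (simp add: binomial_eq_0)
  also have "\<dots> = ?b 0 + (\<Sum>i\<le>k. ?b (Suc i))"
    by (rule sum.atMost_Suc_shift)
  finally have "z ^ Suc k * w =
      ?b 0 + (\<Sum>i\<le>k. of_nat (Suc k choose Suc i) * ?a (Suc i) * z ^ (k - i))"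
    by (simp add: sum.distrib[symmetric] distrib_right del: funpow.simps)
  then show ?case
    unfolding sum.atMost_Suc_shift by simp
qed simp

lemma fps_deriv_power_ad:
  fixes z :: "'a::ring_1 fps"
  shows "fps_deriv (z ^ Suc k) =
      (\<Sum>i\<le>k. of_nat (Suc k choose Suc i) * (ad z ^^ i) (fps_deriv z) * z ^ (k - i))"
proof (induction k)
  case (Suc k)
  let ?b = "\<lambda>c i. of_nat c * (ad z ^^ i) (fps_deriv z) * z ^ (Suc k - i)"
  have "fps_deriv (z ^ Suc (Suc k)) = z ^ Suc k * fps_deriv z + fps_deriv (z ^ Suc k) * z"
    by (simp only: power_Suc2[of z "Suc k"] fps_deriv_mult)
  also have "fps_deriv (z ^ Suc k) * z = (\<Sum>i\<le>k. ?b (Suc k choose Suc i) i)"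
    by (simp add: Suc sum_distrib_right mult.assoc power_Suc2[symmetric] Suc_diff_le
        del: power_Suc binomial_Suc_Suc)
  also have "\<dots> = (\<Sum>i\<le>Suc k. ?b (Suc k choose Suc i) i)"
    by (simp add: binomial_eq_0 del: binomial_Suc_Suc)
  also have "z ^ Suc k * fps_deriv z + \<dots> = (\<Sum>i\<le>Suc k. ?b (Suc (Suc k) choose Suc i) i)"
    unfolding power_mult_ad
    by (simp only: sum.distrib[symmetric] distrib_right of_nat_add binomial_Suc_Suc)
  finally show ?case .
qed simp

context char_0_algebra
begin

abbreviation exp_ad :: "'a fps \<Rightarrow> 'a fps \<Rightarrow> 'a fps" where
  "exp_ad z \<equiv> op_eval (fps_exp 1) (ad z)"

lemma raising_operator_ad:
  assumes "z $ 0 = 0"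
  shows "raising_operator scale (ad z)"
proof
  fix m v assume "fps_cong m v (0 :: 'a fps)"
  then have "fps_cong (Suc m) (z * v) 0" "fps_cong (Suc m) (v * z) 0"
    using fps_cong_mult_0[of 1 z m v] fps_cong_mult_0[of m v 1 z] assms by simp_all
  then show "fps_cong (Suc m) (ad z v) 0"
    using fps_cong_diff[of "Suc m" "z * v" 0 "v * z" 0] by (simp add: ad_def)
qed (simp_all add: algebra_simps ad_def fps.scale_mult)

lemma scale_binomial:
  assumes "i \<le> k"
  shows "(1 / fact k) *\<^sub>K (of_nat (k choose i) * x * y) =
      ((1 / fact i) *\<^sub>K x) * ((1 / fact (k - i)) *\<^sub>K y)"
  using assms by (simp add: scale_mult binomial_fact mult.assoc flip: scale_of_nat)

lemma op_eval_ad_mult_nc_exp_cong: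
  assumes "z $ 0 = 0"
  shows "fps_cong m (op_eval p (ad z) w * nc_exp z)
    (\<Sum>k<m. \<Sum>i\<le>k. (p $ i *\<^sub>F (ad z ^^ i) w) * ((1 / fact (k - i)) *\<^sub>F z ^ (k - i)))"
proof -
  interpret ad: raising_operator scale "ad z" by (rule raising_operator_ad) fact
  have "fps_cong m (op_eval p (ad z) w * nc_exp z)
      ((\<Sum>i<m. p $ i *\<^sub>F (ad z ^^ i) w) * (\<Sum>j<m. (1 / fact j) *\<^sub>F z ^ j))"
    by (intro fps_cong_mult ad.op_eval_cong_sum nc_exp_cong_sum assms)
  also have "fps_cong m \<dots> (\<Sum>k<m. \<Sum>i\<le>k. (p $ i *\<^sub>F (ad z ^^ i) w) *
      ((1 / fact (k - i)) *\<^sub>F z ^ (k - i)))"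
    using ad.fps_cong_funpow_0[of 0] fps_cong_power_0[of 1 z] assms
    by (intro fps_cong_Cauchy_product fps_cong_scale_0) auto
  finally show ?thesis .
qed

lemma nc_exp_mult_eq_exp_ad:
  assumes "z $ 0 = 0"
  shows "nc_exp z * w = exp_ad z w * nc_exp z"
proof (rule fps_cong_all_imp_eq)
  interpret fps: char_0_algebra "fps_scale scale" by (rule char_0_algebra_fps)
  fix m
  have "fps_cong m (nc_exp z * w) ((\<Sum>k<m. (1 / fact k) *\<^sub>F z ^ k) * w)"
    by (intro fps_cong_mult nc_exp_cong_sum assms) simp
  also have "\<dots> = (\<Sum>k<m. \<Sum>i\<le>k. (fps_exp 1 $ i *\<^sub>F (ad z ^^ i) w) *
      ((1 / fact (k - i)) *\<^sub>F z ^ (k - i)))"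
    by (simp add: sum_distrib_right fps.scale_mult_left power_mult_ad fps.scale_sum_right
        fps.scale_binomial)
  also have "fps_cong m \<dots> (exp_ad z w * nc_exp z)"
    by (rule fps_cong_sym[OF op_eval_ad_mult_nc_exp_cong]) fact
  finally show "fps_cong m (nc_exp z * w) (exp_ad z w * nc_exp z)" .
qed

lemma fps_deriv_nc_exp:
  assumes "z $ 0 = 0"
  shows "fps_deriv (nc_exp z) = op_eval (fps_shift 1 (fps_exp 1)) (ad z) (fps_deriv z) * nc_exp z"
proof (rule fps_cong_all_imp_eq)
  interpret fps: char_0_algebra "fps_scale scale" by (rule char_0_algebra_fps)
  fix m
  let ?p = "fps_shift 1 (fps_exp 1) :: 'k fps"
  have "fps_deriv ((1 / fact (Suc k)) *\<^sub>F z ^ Suc k) =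
      (\<Sum>i\<le>k. (?p $ i *\<^sub>F (ad z ^^ i) (fps_deriv z)) * ((1 / fact (k - i)) *\<^sub>F z ^ (k - i)))" for k
    unfolding fps_deriv_scale fps_deriv_power_ad fps.scale_sum_right
    by (intro sum.cong refl)
      (use fps.scale_binomial[of "Suc _" "Suc k"] in \<open>simp del: fact_Suc binomial_Suc_Suc\<close>)
  moreover have "fps_cong m (fps_deriv (nc_exp z)) (fps_deriv (\<Sum>k<Suc m. (1 / fact k) *\<^sub>F z ^ k))"
    by (intro fps_cong_deriv nc_exp_cong_sum assms)
  ultimately have "fps_cong m (fps_deriv (nc_exp z))
      (\<Sum>k<m. \<Sum>i\<le>k. (?p $ i *\<^sub>F (ad z ^^ i) (fps_deriv z)) * ((1 / fact (k - i)) *\<^sub>F z ^ (k - i)))"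
    by (simp add: sum.lessThan_Suc_shift fps_deriv_sum del: sum.lessThan_Suc fact_Suc power_Suc)
  also have "fps_cong m \<dots> (op_eval ?p (ad z) (fps_deriv z) * nc_exp z)"
    by (rule fps_cong_sym[OF op_eval_ad_mult_nc_exp_cong]) fact
  finally show "fps_cong m (fps_deriv (nc_exp z)) (op_eval ?p (ad z) (fps_deriv z) * nc_exp z)" .
qed

lemma exp_ad_mult:
  assumes "nc_exp z = nc_exp x * nc_exp y" "x $ 0 = 0" "y $ 0 = 0" "z $ 0 = 0"
  shows "exp_ad z w = exp_ad x (exp_ad y w)"
proof (rule nc_exp_right_cancel)
  have "exp_ad z w * nc_exp z = nc_exp x * (nc_exp y * w)"
    using nc_exp_mult_eq_exp_ad[OF assms(4), of w] by (simp add: assms(1) mult.assoc)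
  also have "\<dots> = nc_exp x * exp_ad y w * nc_exp y"
    using assms(3) by (simp add: nc_exp_mult_eq_exp_ad mult.assoc)
  also have "\<dots> = exp_ad x (exp_ad y w) * nc_exp z"
    using assms(1,2) by (simp add: nc_exp_mult_eq_exp_ad mult.assoc)
  finally show "exp_ad z w * nc_exp z = exp_ad x (exp_ad y w) * nc_exp z" .
qed fact

lemma nc_exp_const_X_nth: "nc_exp (fps_const x * fps_X) $ n = (1 / fact n) *\<^sub>K x ^ n"
proof -
  have "((fps_const x * fps_X) ^ k) $ n = (if k = n then x ^ k else 0)" for k
    using fps_monomial_power[of x 1 k] by simp
  then show ?thesis
    by (simp add: nc_exp_def fps_eval_def if_distrib[of "\<lambda>c. _ *\<^sub>K c"] cong: if_cong)
qed

lemma fps_deriv_nc_exp_const_X: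
  "fps_deriv (nc_exp (fps_const x * fps_X)) = fps_const x * nc_exp (fps_const x * fps_X)"
  by (rule fps_ext) (simp add: nc_exp_const_X_nth scale_mult del: of_nat_Suc flip: scale_of_nat)

end

section \<open>The Baker--Campbell--Hausdorff series in Dynkin's form\<close>

fun right_nested :: "'a::ring list \<Rightarrow> 'a" where
  "right_nested [] = 0"
| "right_nested [x] = x"
| "right_nested (x # y # ws) = ad x (right_nested (y # ws))"

lemma right_nested_Cons: "ws \<noteq> [] \<Longrightarrow> right_nested (x # ws) = ad x (right_nested ws)"
  by (cases ws) auto

lemma right_nested_replicate_append:
  "ws \<noteq> [] \<Longrightarrow> right_nested (replicate r x @ ws) = (ad x ^^ r) (right_nested ws)"
  by (induction r) (auto simp: right_nested_Cons)

lemma right_nested_replicate: "right_nested (replicate (Suc s) y) = (if s = 0 then y else 0)"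
proof (induction s)
  case (Suc s)
  then show ?case
    using right_nested_Cons[of "replicate (Suc s) y" y] by (simp split: if_splits)
qed simp

lemma dynkin_word_Cons:
  "dynkin_word x y ((r, s) # ps) = replicate r x @ replicate s y @ dynkin_word x y ps"
  by (simp add: dynkin_word_def)

lemma dynkin_word_eq_Nil_iff: "dynkin_word x y ps = [] \<longleftrightarrow> (\<forall>(r, s)\<in>set ps. r + s = 0)"
  by (auto simp: dynkin_word_def)

lemma length_dynkin_word: "length (dynkin_word x y ps) = (\<Sum>(r, s)\<leftarrow>ps. r + s)"
  by (induction ps) (auto simp: dynkin_word_def)

lemma set_dynkin_word: "set (dynkin_word x y ps) \<subseteq> {x, y}"
proof (induction ps)
  case (Cons p ps)
  then show ?case
    by (cases p) (simp add: dynkin_word_Cons set_replicate_conv_if)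
qed (simp add: dynkin_word_def)

lemma map_dynkin_word: "map f (dynkin_word x y ps) = dynkin_word (f x) (f y) ps"
  by (induction ps) (auto simp: dynkin_word_def)

lemma dynkin_word_not_Nil: "ps \<in> dynkin_index m \<Longrightarrow> dynkin_word x y ps \<noteq> []"
  by (cases ps) (auto simp: dynkin_index_def dynkin_word_eq_Nil_iff)

lemma dynkin_index_length:
  assumes "ps \<in> dynkin_index m"
  shows "0 < length ps" "length ps \<le> m"
proof -
  show "0 < length ps" using assms by (auto simp: dynkin_index_def)
  have "(\<forall>(r, s) \<in> set ps. r + s > 0) \<Longrightarrow> length ps \<le> (\<Sum>(r, s)\<leftarrow>ps. r + s)"
    by (induction ps) (auto simp: Suc_le_eq intro: add_less_le_mono)
  with assms show "length ps \<le> m"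
    by (auto simp: dynkin_index_def)
qed

lemma dynkin_index_0 [simp]: "dynkin_index 0 = {}"
  using dynkin_index_length by fastforce

definition dynkin_index_len :: "nat \<Rightarrow> nat \<Rightarrow> (nat \<times> nat) list set" where
  "dynkin_index_len m k = {ps \<in> dynkin_index m. length ps = k}"

lemma finite_dynkin_index_len [simp]: "finite (dynkin_index_len m k)"
  by (simp add: dynkin_index_len_def finite_dynkin_index)

lemma dynkin_index_len_1:
  "dynkin_index_len (Suc n) (Suc 0) = (\<lambda>s. [(Suc n - s, s)]) ` {..Suc n}"
proof (intro equalityI subsetI)
  fix ps assume "ps \<in> dynkin_index_len (Suc n) (Suc 0)"
  then obtain r s where "ps = [(r, s)]" "r + s = Suc n"
    by (cases ps) (auto simp: dynkin_index_len_def dynkin_index_def)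
  then show "ps \<in> (\<lambda>s. [(Suc n - s, s)]) ` {..Suc n}"
    by (intro image_eqI[of _ _ s]) auto
qed (auto simp: dynkin_index_len_def dynkin_index_def)

lemma sum_dynkin_index_by_length:
  fixes f :: "(nat \<times> nat) list \<Rightarrow> 'a::comm_monoid_add"
  shows "(\<Sum>ps\<in>dynkin_index (Suc n). f ps) = (\<Sum>k\<le>n. \<Sum>ps\<in>dynkin_index_len (Suc n) (Suc k). f ps)"
proof -
  have "dynkin_index_len (Suc n) (Suc k) = {ps \<in> dynkin_index (Suc n). length ps - 1 = k}" for k
    using dynkin_index_length(1) by (fastforce simp: dynkin_index_len_def)
  moreover have "(\<lambda>ps. length ps - 1) ` dynkin_index (Suc n) \<subseteq> {..n}"
    using dynkin_index_length(2) by fastforce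
  ultimately show ?thesis
    by (simp add: sum.group finite_dynkin_index)
qed

definition block_index :: "nat \<Rightarrow> (nat \<times> nat) set" where
  "block_index n = {(r, s). 0 < r + s \<and> r + s \<le> n}"

lemma finite_block_index [simp]: "finite (block_index n)"
  by (rule finite_subset[of _ "{..n} \<times> {..n}"]) (auto simp: block_index_def)

lemma sum_dynkin_index_len_Suc:
  fixes f :: "(nat \<times> nat) list \<Rightarrow> 'a::comm_monoid_add"
  shows "(\<Sum>ps\<in>dynkin_index_len (Suc n) (Suc (Suc k)). f ps) =
    (\<Sum>(r, s)\<in>block_index n. \<Sum>qs\<in>dynkin_index_len (Suc (n - r - s)) (Suc k). f ((r, s) # qs))"
proof -
  have "(\<Sum>(r, s)\<in>block_index n. \<Sum>qs\<in>dynkin_index_len (Suc (n - r - s)) (Suc k). f ((r, s) # qs)) =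
    (\<Sum>(p, qs)\<in>Sigma (block_index n) (\<lambda>p. dynkin_index_len (Suc (n - fst p - snd p)) (Suc k)).
      f (p # qs))"
    by (subst sum.Sigma[symmetric]) (auto simp: case_prod_beta)
  also have "\<dots> = (\<Sum>ps\<in>dynkin_index_len (Suc n) (Suc (Suc k)). f ps)"
  proof (rule sum.reindex_bij_witness[of _ "\<lambda>ps. (hd ps, tl ps)" "\<lambda>(p, qs). p # qs"], goal_cases)
    case (4 ps)
    then obtain r s qs where ps_eq: "ps = (r, s) # qs"
      by (cases ps) (auto simp: dynkin_index_len_def)
    with 4 have block: "0 < r + s" and rest: "qs \<in> dynkin_index (Suc n - r - s)" "length qs = Suc k"
      by (auto simp: dynkin_index_len_def dynkin_index_def)
    from rest have "Suc n - r - s = Suc (n - r - s)"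
      using dynkin_index_length[OF rest(1)] by simp
    with block rest show ?case
      by (auto simp: ps_eq block_index_def dynkin_index_len_def)
  qed (auto simp: dynkin_index_len_def dynkin_index_def block_index_def)
  finally show ?thesis ..
qed

definition block_coeff :: "(nat \<times> nat) list \<Rightarrow> 'k::field_char_0" where
  "block_coeff ps = 1 / of_nat (\<Prod>(r, s)\<leftarrow>ps. fact r * fact s)"

lemma block_coeff_Cons: "block_coeff ((r, s) # ps) = (1 / fact r) * (1 / fact s) * block_coeff ps"
  by (simp add: block_coeff_def)

definition bch_coeff :: "(nat \<times> nat) list \<Rightarrow> 'k::field_char_0" where
  "bch_coeff ps = (- 1) ^ (length ps - 1) / of_nat (length ps)
     / of_nat ((\<Sum>(r, s)\<leftarrow>ps. r + s) * (\<Prod>(r, s)\<leftarrow>ps. fact r * fact s))"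

lemma of_nat_mult_bch_coeff:
  assumes "ps \<in> dynkin_index (Suc n)"
  shows "of_nat (Suc n) * bch_coeff ps =
      (- 1) ^ (length ps - 1) / of_nat (length ps) * block_coeff ps"
proof -
  have "(\<Sum>(r, s)\<leftarrow>ps. r + s) = Suc n"
    using assms by (simp add: dynkin_index_def)
  then show ?thesis
    by (simp add: bch_coeff_def block_coeff_def del: of_nat_Suc mult_Suc)
qed

lemma ad_const_X_funpow_nth:
  fixes x :: "'a::ring_1"
  shows "(ad (fps_const x * fps_X) ^^ r) w $ n = (if r \<le> n then (ad x ^^ r) (w $ (n - r)) else 0)"
proof (induction r arbitrary: n)
  case (Suc r)
  have "ad (fps_const x * fps_X) v $ n = (if n = 0 then 0 else ad x (v $ (n - 1)))" for v n
    by (simp add: ad_def mult.assoc[of "fps_const x"] mult.assoc[of v, symmetric])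
  then show ?case
    using Suc.IH[of "n - 1"] by auto
qed simp

context char_0_algebra
begin

lemma module_hom_ad_funpow: "module_hom scale scale (ad x ^^ k)"
proof (rule module_hom_funpow)
  show "module_hom scale scale (ad x)"
    by unfold_locales (simp_all add: ad_def algebra_simps scale_mult)
qed

lemma exp_ad_const_X_nth:
  "exp_ad (fps_const x * fps_X) w $ n = (\<Sum>r\<le>n. (1 / fact r) *\<^sub>K (ad x ^^ r) (w $ (n - r)))"
  by (simp add: op_eval_def ad_const_X_funpow_nth)

definition ad_exp_prod :: "'a \<Rightarrow> 'a \<Rightarrow> 'a fps \<Rightarrow> 'a fps" where
  "ad_exp_prod x y w = exp_ad (fps_const x * fps_X) (exp_ad (fps_const y * fps_X) w) - w"

lemma ad_exp_prod_nth:
  "ad_exp_prod x y w $ n = (\<Sum>(r, s)\<in>block_index n.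
     ((1 / fact r) * (1 / fact s)) *\<^sub>K (ad x ^^ r) ((ad y ^^ s) (w $ (n - r - s))))"
proof -
  let ?f = "\<lambda>(r, s). ((1 / fact r) * (1 / fact s)) *\<^sub>K (ad x ^^ r) ((ad y ^^ s) (w $ (n - r - s)))"
  have "exp_ad (fps_const x * fps_X) (exp_ad (fps_const y * fps_X) w) $ n =
      (\<Sum>r\<le>n. \<Sum>s\<le>n - r. ?f (r, s))"
    by (simp add: exp_ad_const_X_nth scale_sum_right
        module_hom.sum[OF module_hom_ad_funpow] module_hom.scale[OF module_hom_ad_funpow])
  also have "\<dots> = (\<Sum>p\<in>Sigma {..n} (\<lambda>r. {..n - r}). ?f p)"
    by (simp add: sum.Sigma)
  also have "Sigma {..n} (\<lambda>r. {..n - r}) = insert (0, 0) (block_index n)"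
    by (auto simp: block_index_def)
  also have "sum ?f \<dots> = w $ n + sum ?f (block_index n)"
    by (subst sum.insert) (simp_all, simp add: block_index_def)
  finally show ?thesis
    by (simp add: ad_exp_prod_def)
qed

definition dynkin_sum :: "'a \<Rightarrow> 'a \<Rightarrow> nat \<Rightarrow> nat \<Rightarrow> 'a" where
  "dynkin_sum x y m k =
     (\<Sum>ps\<in>dynkin_index_len m k. block_coeff ps *\<^sub>K right_nested (dynkin_word x y ps))"

definition log_deriv_exp_exp :: "'a \<Rightarrow> 'a \<Rightarrow> 'a fps" where
  "log_deriv_exp_exp x y = fps_const x + exp_ad (fps_const x * fps_X) (fps_const y)"

lemma log_deriv_exp_exp_nth:
  "log_deriv_exp_exp x y $ n = (if n = 0 then x else 0) + (1 / fact n) *\<^sub>K (ad x ^^ n) y"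
proof -
  have "(\<Sum>r\<le>n. (1 / fact r) *\<^sub>K (ad x ^^ r) (fps_const y $ (n - r))) =
      (\<Sum>r\<le>n. if r = n then (1 / fact n) *\<^sub>K (ad x ^^ n) y else 0)"
    by (intro sum.cong) (auto simp: module_hom.zero[OF module_hom_ad_funpow])
  then show ?thesis
    by (simp add: log_deriv_exp_exp_def exp_ad_const_X_nth)
qed

lemma dynkin_sum_1: "dynkin_sum x y (Suc n) (Suc 0) = log_deriv_exp_exp x y $ n"
proof -
  let ?t = "\<lambda>s. block_coeff [(Suc n - s, s)] *\<^sub>K right_nested (dynkin_word x y [(Suc n - s, s)])"
  have only_x: "?t 0 = (if n = 0 then x else 0)"
    using right_nested_replicate[of n x]
    by (cases n) (auto simp: dynkin_word_def block_coeff_def simp del: replicate_Suc)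
  have one_y: "?t 1 = (1 / fact n) *\<^sub>K (ad x ^^ n) y"
    by (simp add: dynkin_word_def block_coeff_def right_nested_replicate_append)
  have many_y: "?t s = 0" if s_neq: "s \<noteq> 0" "s \<noteq> 1" for s
  proof -
    obtain s' where "s = Suc (Suc s')"
      using s_neq by (cases s; cases "s - 1") auto
    then show ?thesis
      using right_nested_replicate[of "Suc s'" y]
      by (simp add: dynkin_word_def right_nested_replicate_append
          module_hom.zero[OF module_hom_ad_funpow] del: replicate_Suc)
  qed
  have "dynkin_sum x y (Suc n) (Suc 0) = (\<Sum>s\<le>Suc n. ?t s)"
    unfolding dynkin_sum_def dynkin_index_len_1 by (subst sum.reindex) (auto simp: inj_on_def)
  also have "\<dots> = (\<Sum>s\<in>{0, 1}. ?t s)"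
  proof (rule sum.mono_neutral_right)
    show "\<forall>s\<in>{..Suc n} - {0, 1}. ?t s = 0"
      by (intro ballI many_y) auto
  qed auto
  also have "\<dots> = ?t 0 + ?t 1"
    by simp
  finally show ?thesis
    unfolding only_x one_y log_deriv_exp_exp_nth .
qed

lemma dynkin_sum_Suc:
  "dynkin_sum x y (Suc n) (Suc (Suc k)) = (\<Sum>(r, s)\<in>block_index n.
     ((1 / fact r) * (1 / fact s)) *\<^sub>K
       (ad x ^^ r) ((ad y ^^ s) (dynkin_sum x y (Suc (n - r - s)) (Suc k))))"
proof -
  have "right_nested (dynkin_word x y ((r, s) # qs)) =
      (ad x ^^ r) ((ad y ^^ s) (right_nested (dynkin_word x y qs)))"
    if "qs \<in> dynkin_index_len m k" for r s qs m k
  proof -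
    have "dynkin_word x y qs \<noteq> []"
      using that by (auto simp: dynkin_index_len_def dynkin_word_not_Nil)
    then show ?thesis
      by (simp add: dynkin_word_Cons right_nested_replicate_append)
  qed
  then show ?thesis
    by (simp add: dynkin_sum_def sum_dynkin_index_len_Suc block_coeff_Cons scale_sum_right
        module_hom.sum[OF module_hom_ad_funpow] module_hom.scale[OF module_hom_ad_funpow])
qed

lemma ad_exp_prod_funpow_nth:
  "(ad_exp_prod x y ^^ k) (log_deriv_exp_exp x y) $ n = dynkin_sum x y (Suc n) (Suc k)"
  by (induction k arbitrary: n) (simp_all add: dynkin_sum_1 dynkin_sum_Suc ad_exp_prod_nth)

definition dynkin_series :: "'a \<Rightarrow> 'a \<Rightarrow> 'a fps" where
  "dynkin_series x y =
     Abs_fps (\<lambda>m. \<Sum>ps\<in>dynkin_index m. bch_coeff ps *\<^sub>K right_nested (dynkin_word x y ps))"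

lemma dynkin_series_nth_0 [simp]: "dynkin_series x y $ 0 = 0"
  by (simp add: dynkin_series_def)

lemma fps_deriv_dynkin_series:
  "fps_deriv (dynkin_series x y) =
    op_eval (fps_shift 1 (fps_ln 1)) (ad_exp_prod x y) (log_deriv_exp_exp x y)"
proof (rule fps_ext)
  fix n
  let ?t = "\<lambda>ps. block_coeff ps *\<^sub>K right_nested (dynkin_word x y ps)"
  have "fps_deriv (dynkin_series x y) $ n = of_nat (Suc n) *\<^sub>K dynkin_series x y $ Suc n"
    by (simp add: scale_of_nat del: of_nat_Suc)
  also have "\<dots> = (\<Sum>ps\<in>dynkin_index (Suc n). (of_nat (Suc n) * bch_coeff ps) *\<^sub>K
      right_nested (dynkin_word x y ps))"
    by (simp add: dynkin_series_def scale_sum_right del: of_nat_Suc)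
  also have "\<dots> = (\<Sum>ps\<in>dynkin_index (Suc n).
      ((- 1) ^ (length ps - 1) / of_nat (length ps)) *\<^sub>K ?t ps)"
    by (intro sum.cong refl) (simp add: of_nat_mult_bch_coeff del: of_nat_Suc)
  also have "\<dots> = (\<Sum>k\<le>n. \<Sum>ps\<in>dynkin_index_len (Suc n) (Suc k).
      ((- 1) ^ (length ps - 1) / of_nat (length ps)) *\<^sub>K ?t ps)"
    by (rule sum_dynkin_index_by_length)
  also have "\<dots> = (\<Sum>k\<le>n. \<Sum>ps\<in>dynkin_index_len (Suc n) (Suc k). fps_shift 1 (fps_ln 1) $ k *\<^sub>K ?t ps)"
    by (intro sum.cong refl) (auto simp: dynkin_index_len_def fps_ln_nth)
  also have "\<dots> = op_eval (fps_shift 1 (fps_ln 1)) (ad_exp_prod x y) (log_deriv_exp_exp x y) $ n"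
    by (simp add: op_eval_def ad_exp_prod_funpow_nth dynkin_sum_def scale_sum_right)
  finally show "fps_deriv (dynkin_series x y) $ n = \<dots>" .
qed

lemma fps_deriv_exp_exp:
  "fps_deriv (nc_exp (fps_const x * fps_X) * nc_exp (fps_const y * fps_X)) =
    log_deriv_exp_exp x y * (nc_exp (fps_const x * fps_X) * nc_exp (fps_const y * fps_X))"
proof -
  let ?X = "fps_const x * fps_X" and ?Y = "fps_const y * fps_X"
  have "fps_deriv (nc_exp ?X * nc_exp ?Y) =
      nc_exp ?X * fps_const y * nc_exp ?Y + fps_const x * nc_exp ?X * nc_exp ?Y"
    by (simp add: fps_deriv_nc_exp_const_X mult.assoc)
  also have "nc_exp ?X * fps_const y = op_eval (fps_exp 1) (ad ?X) (fps_const y) * nc_exp ?X"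
    by (rule nc_exp_mult_eq_exp_ad) simp
  finally show ?thesis
    by (simp add: log_deriv_exp_exp_def distrib_right mult.assoc)
qed

text \<open>
  With \<open>e\<^sup>Z = e\<^sup>x\<^sup>t e\<^sup>y\<^sup>t\<close> one has \<open>f (ad Z) Z' = (e\<^sup>Z)' e\<^sup>-\<^sup>Z = x + exp (ad xt) y\<close> for
  \<open>f u = (e\<^sup>u - 1) / u\<close>. As \<open>1 / f u = \<Sum>\<^sub>k (-1)\<^sup>k / (k + 1) (e\<^sup>u - 1)\<^sup>k\<close> and
  \<open>exp (ad Z) = exp (ad xt) exp (ad yt)\<close>, solving for \<open>Z'\<close> gives Dynkin's form of the
  Baker--Campbell--Hausdorff series.
\<close>

theorem nc_exp_dynkin_series:
  "nc_exp (dynkin_series x y) = nc_exp (fps_const x * fps_X) * nc_exp (fps_const y * fps_X)"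
proof -
  obtain Z where Z_nth_0: "Z $ 0 = 0"
    and nc_exp_Z: "nc_exp Z = nc_exp (fps_const x * fps_X) * nc_exp (fps_const y * fps_X)"
    using nc_exp_surj[of "nc_exp (fps_const x * fps_X) * nc_exp (fps_const y * fps_X)"]
    by (auto simp: fps_mult_nth_0)
  interpret ad: raising_operator scale "ad Z" by (rule raising_operator_ad) fact
  let ?f = "fps_shift 1 (fps_exp 1) :: 'k fps" and ?l = "fps_shift 1 (fps_ln 1) :: 'k fps"
  have "op_eval ?f (ad Z) (fps_deriv Z) * nc_exp Z = log_deriv_exp_exp x y * nc_exp Z"
    using fps_deriv_exp_exp[of x y] unfolding nc_exp_Z[symmetric] fps_deriv_nc_exp[OF Z_nth_0] .
  then have log_deriv: "op_eval ?f (ad Z) (fps_deriv Z) = log_deriv_exp_exp x y"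
    using Z_nth_0 by (rule nc_exp_right_cancel)
  have exp_minus_1_ad: "op_eval (fps_exp 1 - 1) (ad Z) = ad_exp_prod x y"
    by (simp add: fun_eq_iff op_eval_diff_left ad_exp_prod_def exp_ad_mult[OF nc_exp_Z _ _ Z_nth_0])
  have "fps_deriv Z = op_eval ((?l oo (fps_exp 1 - 1)) * ?f) (ad Z) (fps_deriv Z)"
    unfolding fps_ln_over_X_compose_exp by simp
  also have "\<dots> = op_eval ?l (ad_exp_prod x y) (log_deriv_exp_exp x y)"
    unfolding ad.op_eval_mult log_deriv by (simp add: ad.op_eval_compose exp_minus_1_ad)
  also have "\<dots> = fps_deriv (dynkin_series x y)"
    by (rule fps_deriv_dynkin_series[symmetric])
  finally have "Z = dynkin_series x y"
    by (rule fps_deriv_eq_imp_eq) (simp add: Z_nth_0)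
  with nc_exp_Z show ?thesis by simp
qed

end

subsection \<open>Setting the auxiliary variable to one\<close>

definition graded_fps :: "'a::zero fps fps \<Rightarrow> bool" where
  "graded_fps F \<longleftrightarrow> (\<forall>m. fps_cong m (F $ m) 0)"

text \<open>For graded \<open>F\<close> the terms with \<open>m > n\<close> vanish, so this is the value of \<open>F\<close> at \<open>1\<close>.\<close>

definition fps_at_1 :: "'a::comm_monoid_add fps fps \<Rightarrow> 'a fps" where
  "fps_at_1 F = Abs_fps (\<lambda>n. \<Sum>m\<le>n. F $ m $ n)"

lemma graded_fpsD: "graded_fps F \<Longrightarrow> fps_cong m (F $ m) 0"
  by (simp add: graded_fps_def)

lemma fps_cong_sum_0:
  "(\<And>i. i \<in> I \<Longrightarrow> fps_cong m (f i) 0) \<Longrightarrow> fps_cong m (\<Sum>i\<in>I. f i) (0 :: 'a::comm_monoid_add fps)"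
  using fps_cong_sum[of I m f "\<lambda>_. 0"] by simp

lemma fps_at_1_cong_sum:
  assumes "graded_fps F"
  shows "fps_cong m (fps_at_1 F) (\<Sum>k<m. F $ k)"
  unfolding fps_cong_def
proof (intro allI impI)
  fix n assume "n < m"
  with assms show "fps_at_1 F $ n = (\<Sum>k<m. F $ k) $ n"
    unfolding fps_at_1_def fps_sum_nth fps_nth_Abs_fps
    by (intro sum.mono_neutral_left) (auto simp: graded_fps_def fps_cong_def)
qed

lemma graded_fps_1 [simp]: "graded_fps (1 :: 'a::semiring_1 fps fps)"
  by (auto simp: graded_fps_def fps_cong_def)

lemma graded_fps_mult:
  fixes F G :: "'a::semiring_0 fps fps"
  assumes "graded_fps F" "graded_fps G"
  shows "graded_fps (F * G)"
  unfolding graded_fps_def fps_mult_nth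
proof (intro allI fps_cong_sum_0)
  fix m i :: nat assume "i \<in> {0..m}"
  then show "fps_cong m (F $ i * G $ (m - i)) 0"
    using fps_cong_mult_0[OF graded_fpsD[OF assms(1), of i] graded_fpsD[OF assms(2), of "m - i"]]
    by simp
qed

lemma graded_fps_power: "graded_fps F \<Longrightarrow> graded_fps (F ^ k)" for F :: "'a::semiring_1 fps fps"
  by (induction k) (auto simp: graded_fps_mult)

lemma fps_at_1_mult:
  fixes F G :: "'a::semiring_0 fps fps"
  assumes "graded_fps F" "graded_fps G"
  shows "fps_at_1 (F * G) = fps_at_1 F * fps_at_1 G"
proof (rule fps_cong_all_imp_eq)
  fix m
  have "fps_cong m (fps_at_1 F * fps_at_1 G) ((\<Sum>k<m. F $ k) * (\<Sum>k<m. G $ k))"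
    by (intro fps_cong_mult fps_at_1_cong_sum assms)
  also have "fps_cong m \<dots> (\<Sum>k<m. \<Sum>i\<le>k. F $ i * G $ (k - i))"
    by (intro fps_cong_Cauchy_product graded_fpsD assms)
  also have "\<dots> = (\<Sum>k<m. (F * G) $ k)"
    by (simp add: fps_mult_nth atLeast0AtMost)
  also have "fps_cong m \<dots> (fps_at_1 (F * G))"
    by (intro fps_cong_sym[OF fps_at_1_cong_sum] graded_fps_mult assms)
  finally show "fps_cong m (fps_at_1 (F * G)) (fps_at_1 F * fps_at_1 G)"
    by (rule fps_cong_sym)
qed

lemma fps_at_1_1 [simp]: "fps_at_1 1 = (1 :: 'a::semiring_1 fps)"
proof (rule fps_ext)
  fix n
  have "(\<Sum>m\<le>n. (1 :: 'a fps fps) $ m $ n) = (\<Sum>m\<le>n. if m = 0 then (1 :: 'a fps) $ n else 0)"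
    by (intro sum.cong) auto
  then show "fps_at_1 (1 :: 'a fps fps) $ n = 1 $ n"
    by (simp add: fps_at_1_def)
qed

lemma fps_at_1_power: "graded_fps F \<Longrightarrow> fps_at_1 (F ^ k) = fps_at_1 F ^ k"
  for F :: "'a::semiring_1 fps fps"
  by (induction k) (auto simp: fps_at_1_mult graded_fps_power)

lemma graded_fps_const_X: "z $ 0 = 0 \<Longrightarrow> graded_fps (fps_const z * fps_X)"
  for z :: "'a::semiring_1 fps"
  by (auto simp: graded_fps_def le_Suc_eq)

lemma fps_at_1_const_X:
  fixes z :: "'a::semiring_1 fps"
  assumes "z $ 0 = 0"
  shows "fps_at_1 (fps_const z * fps_X) = z"
proof (rule fps_ext)
  fix n
  have "(\<Sum>m\<le>n. (fps_const z * fps_X) $ m $ n) = (\<Sum>m\<le>n. if m = 1 then z $ n else 0)"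
    by (intro sum.cong) auto
  then show "fps_at_1 (fps_const z * fps_X) $ n = z $ n"
    using assms by (cases n) (auto simp: fps_at_1_def)
qed

lemma fps_cong_right_nested_0:
  fixes ws :: "'a::ring fps list"
  shows "(\<And>w. w \<in> set ws \<Longrightarrow> w $ 0 = 0) \<Longrightarrow> fps_cong (length ws) (right_nested ws) 0"
proof (induction ws rule: right_nested.induct)
  case (3 x y ws)
  let ?z = "right_nested (y # ws)" and ?m = "length (y # ws)"
  have orders: "fps_cong 1 x 0" "fps_cong ?m ?z 0"
    using 3 by simp_all
  have "fps_cong (1 + ?m) (x * ?z) 0" "fps_cong (?m + 1) (?z * x) 0"
    by (intro fps_cong_mult_0 orders)+
  then show ?case
    using fps_cong_diff[of "1 + ?m" "x * ?z" 0 "?z * x" 0] by (simp add: ad_def)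
qed simp_all

context char_0_algebra
begin

lemma graded_fps_eval: "graded_fps Z \<Longrightarrow> graded_fps (unital_algebra.fps_eval (fps_scale scale) p Z)"
  unfolding fps.fps_eval_def graded_fps_def fps_nth_Abs_fps
  by (intro allI fps_cong_sum_0 fps_cong_scale_0 graded_fpsD graded_fps_power)
    (simp add: graded_fps_def)

lemma fps_at_1_eval:
  assumes "graded_fps Z" "Z $ 0 = 0"
  shows "fps_at_1 (unital_algebra.fps_eval (fps_scale scale) p Z) = fps_eval p (fps_at_1 Z)"
proof (rule fps_ext)
  fix n
  have "fps_at_1 (fps.fps_eval p Z) $ n = (\<Sum>m\<le>n. \<Sum>k\<le>m. p $ k *\<^sub>K (Z ^ k) $ m $ n)"
    by (simp add: fps_at_1_def fps.fps_eval_def fps_sum_nth)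
  also have "\<dots> = (\<Sum>m\<le>n. \<Sum>k\<le>n. p $ k *\<^sub>K (Z ^ k) $ m $ n)"
    by (intro sum.cong sum.mono_neutral_left) (auto simp: fps_power_nth_eq_0 assms)
  also have "\<dots> = (\<Sum>k\<le>n. \<Sum>m\<le>n. p $ k *\<^sub>K (Z ^ k) $ m $ n)"
    by (rule sum.swap)
  also have "\<dots> = (\<Sum>k\<le>n. p $ k *\<^sub>K fps_at_1 (Z ^ k) $ n)"
    by (simp add: fps_at_1_def scale_sum_right)
  also have "\<dots> = fps_eval p (fps_at_1 Z) $ n"
    by (simp add: fps_at_1_power assms fps_eval_def)
  finally show "fps_at_1 (fps.fps_eval p Z) $ n = fps_eval p (fps_at_1 Z) $ n" .
qed

definition bch_series :: "'a fps \<Rightarrow> 'a fps \<Rightarrow> 'a fps" where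
  "bch_series x y = fps_at_1 (char_0_algebra.dynkin_series (fps_scale scale) x y)"

lemma bch_series_nth:
  "bch_series x y $ n =
    (\<Sum>m = 1..n. \<Sum>ps\<in>dynkin_index m. bch_coeff ps *\<^sub>K right_nested (dynkin_word x y ps) $ n)"
proof -
  interpret fps: char_0_algebra "fps_scale scale" by (rule char_0_algebra_fps)
  have "bch_series x y $ n =
      (\<Sum>m\<le>n. \<Sum>ps\<in>dynkin_index m. bch_coeff ps *\<^sub>K right_nested (dynkin_word x y ps) $ n)"
    by (simp add: bch_series_def fps_at_1_def fps.dynkin_series_def fps_sum_nth)
  also have "\<dots> =
      (\<Sum>m = 1..n. \<Sum>ps\<in>dynkin_index m. bch_coeff ps *\<^sub>K right_nested (dynkin_word x y ps) $ n)"
    by (rule sum.mono_neutral_right) (auto simp: not_le)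
  finally show ?thesis .
qed

theorem nc_exp_bch_series:
  assumes "x $ 0 = 0" "y $ 0 = 0"
  shows "nc_exp (bch_series x y) = nc_exp x * nc_exp y"
proof -
  interpret fps: char_0_algebra "fps_scale scale" by (rule char_0_algebra_fps)
  have graded_exp: "graded_fps (fps.nc_exp (fps_const z * fps_X))" if "z $ 0 = 0" for z
    using that by (simp add: fps.nc_exp_def graded_fps_eval graded_fps_const_X)
  have at_1_exp: "fps_at_1 (fps.nc_exp (fps_const z * fps_X)) = nc_exp z" if "z $ 0 = 0" for z
    using that by (simp add: fps.nc_exp_def nc_exp_def fps_at_1_eval graded_fps_const_X
        fps_at_1_const_X)
  have "graded_fps (fps.dynkin_series x y)"
    unfolding graded_fps_def fps.dynkin_series_def fps_nth_Abs_fps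
  proof (intro allI fps_cong_sum_0 fps_cong_scale_0)
    fix m ps assume "ps \<in> dynkin_index m"
    then have "length (dynkin_word x y ps) = m"
      by (simp add: length_dynkin_word dynkin_index_def)
    then show "fps_cong m (right_nested (dynkin_word x y ps)) 0"
      using fps_cong_right_nested_0[of "dynkin_word x y ps"] set_dynkin_word[of x y ps] assms
      by blast
  qed
  then have "nc_exp (bch_series x y) = fps_at_1 (fps.nc_exp (fps.dynkin_series x y))"
    by (simp add: nc_exp_def fps.nc_exp_def fps_at_1_eval bch_series_def)
  also have "\<dots> = fps_at_1 (fps.nc_exp (fps_const x * fps_X)) *
      fps_at_1 (fps.nc_exp (fps_const y * fps_X))"
    unfolding fps.nc_exp_dynkin_series by (intro fps_at_1_mult graded_exp assms)
  finally show ?thesis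
    by (simp add: at_1_exp assms)
qed

end

section \<open>Quantum dilogarithms and the pentagon relation\<close>

lemma fps_exp_compose_add:
  fixes a b :: "'k::field_char_0 fps"
  assumes "a $ 0 = 0" "b $ 0 = 0"
  shows "fps_exp 1 oo (a + b) = (fps_exp 1 oo a) * (fps_exp 1 oo b)"
proof -
  let ?e = "\<lambda>c. fps_exp 1 oo c"
  have deriv: "fps_deriv (?e c) = ?e c * fps_deriv c" if "c $ 0 = 0" for c :: "'k fps"
    using that by (simp add: fps_compose_deriv)
  have deriv_0_imp_eq_1: "f = 1" if "fps_deriv f = 0" "f $ 0 = 1" for f :: "'k fps"
    using that fps_deriv_eq_0_iff[of f] by simp
  have inverse: "?e c * ?e (- c) = 1" if "c $ 0 = 0" for c :: "'k fps"
    using that by (intro deriv_0_imp_eq_1) (simp_all add: deriv)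
  have "?e (a + b) * ?e (- a) * ?e (- b) = 1"
    using assms by (intro deriv_0_imp_eq_1) (simp_all add: deriv algebra_simps)
  then have "?e (a + b) * (?e a * ?e (- a)) * (?e b * ?e (- b)) = ?e a * ?e b"
    by (simp add: mult_ac)
  then show ?thesis
    by (simp add: inverse assms)
qed

definition generic_param :: "'k::field \<Rightarrow> bool" where
  "generic_param Q \<longleftrightarrow> Q \<noteq> 0 \<and> (\<forall>j>0. Q ^ j \<noteq> 1)"

lemma generic_param_nonzero [simp]: "generic_param Q \<Longrightarrow> Q \<noteq> 0"
  by (simp add: generic_param_def)

lemma generic_param_power: "generic_param Q \<Longrightarrow> k > 0 \<Longrightarrow> generic_param (Q ^ k)"
  by (auto simp: generic_param_def simp flip: power_mult)

lemma generic_param_diff_nonzero: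
  assumes "generic_param Q" "j > 0"
  shows "Q ^ j - inverse Q ^ j \<noteq> 0"
proof
  assume "Q ^ j - inverse Q ^ j = 0"
  then have "Q ^ j * Q ^ j = 1"
    using assms(1) by (simp add: power_inverse field_simps)
  then have "Q ^ (j + j) = 1"
    by (simp add: power_add)
  with assms show False
    by (auto simp: generic_param_def)
qed

text \<open>The constant term vanishes because \<open>x / 0 = 0\<close>.\<close>

definition qdilog_log :: "'k::field_char_0 \<Rightarrow> 'k fps" where
  "qdilog_log Q = Abs_fps (\<lambda>j. (- 1) ^ (j + 1) / (of_nat j * (Q ^ j - inverse Q ^ j)))"

lemma qdilog_log_nth_0 [simp]: "qdilog_log Q $ 0 = 0"
  by (simp add: qdilog_log_def)

definition qdilog_fps :: "'k::field_char_0 \<Rightarrow> 'k fps" where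
  "qdilog_fps Q = fps_exp 1 oo qdilog_log Q"

lemma qdilog_fps_nth_0 [simp]: "qdilog_fps Q $ 0 = 1"
  by (simp add: qdilog_fps_def)

lemma qdilog_fps_functional_equation:
  fixes Q :: "'k::field_char_0"
  assumes "generic_param Q"
  shows "qdilog_fps Q oo (fps_const Q * fps_X) =
      (1 + fps_X) * (qdilog_fps Q oo (fps_const (inverse Q) * fps_X))"
proof -
  let ?L = "\<lambda>c. qdilog_log Q oo (fps_const c * fps_X)"
  have "?L Q $ j - ?L (inverse Q) $ j = fps_ln 1 $ j" for j
  proof (cases "j = 0")
    case False
    have "?L Q $ j - ?L (inverse Q) $ j = (Q ^ j - inverse Q ^ j) * qdilog_log Q $ j"
      by (simp add: left_diff_distrib)
    then show ?thesis
      using generic_param_diff_nonzero[OF assms, of j] False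
      by (cases j) (simp_all add: qdilog_log_def fps_ln_nth)
  qed simp
  then have "?L Q = fps_ln 1 + ?L (inverse Q)"
    by (simp add: fps_eq_iff diff_eq_eq)
  then have "fps_exp 1 oo ?L Q = (fps_exp 1 oo fps_ln 1) * (fps_exp 1 oo ?L (inverse Q))"
    by (simp add: fps_exp_compose_add)
  then show ?thesis
    by (simp add: qdilog_fps_def fps_exp_compose_ln fps_compose_assoc)
qed

lemma qdilog_fps_nth_Suc:
  assumes "generic_param Q"
  shows "qdilog_fps Q $ Suc k * ((Q ^ 2) ^ Suc k - 1) = Q * qdilog_fps Q $ k"
proof -
  let ?c = "\<lambda>k. qdilog_fps Q $ k"
  have "Q ^ Suc k * ?c (Suc k) = inverse Q ^ Suc k * ?c (Suc k) + inverse Q ^ k * ?c k"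
    using arg_cong[OF qdilog_fps_functional_equation[OF assms], of "\<lambda>p. p $ Suc k"]
    by (simp add: distrib_right del: power_Suc)
  then have "Q ^ Suc k * (Q ^ Suc k * ?c (Suc k)) =
      Q ^ Suc k * (inverse Q ^ Suc k * ?c (Suc k) + inverse Q ^ k * ?c k)"
    by simp
  also have "\<dots> = ?c (Suc k) + Q * ?c k"
    using assms by (simp add: power_inverse field_simps)
  finally show ?thesis
    by (simp add: power2_eq_square power_mult_distrib algebra_simps)
qed

lemma qdilog_fps_fission:
  fixes Q :: "'k::field_char_0"
  assumes "generic_param Q"
  shows "qdilog_fps Q = (qdilog_fps (Q ^ 2) oo (fps_const Q * fps_X)) *
      (qdilog_fps (Q ^ 2) oo (fps_const (inverse Q) * fps_X))"
proof -
  let ?L = "\<lambda>c. qdilog_log (Q ^ 2) oo (fps_const c * fps_X)"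
  have "qdilog_log Q $ j = ?L Q $ j + ?L (inverse Q) $ j" for j
  proof (cases "j = 0")
    case False
    let ?s = "Q ^ j + inverse Q ^ j" and ?t = "Q ^ j - inverse Q ^ j"
    have square: "(Q ^ 2) ^ j - inverse (Q ^ 2) ^ j = ?s * ?t"
      by (simp add: power2_eq_square power_mult_distrib algebra_simps)
    moreover have "(Q ^ 2) ^ j - inverse (Q ^ 2) ^ j \<noteq> 0"
      using False assms by (intro generic_param_diff_nonzero generic_param_power) auto
    ultimately have "?s \<noteq> 0" by auto
    have "?L Q $ j + ?L (inverse Q) $ j = ?s * ((- 1) ^ (j + 1) / (of_nat j * (?s * ?t)))"
      unfolding fps_nth_compose_linear qdilog_log_def fps_nth_Abs_fps square
      by (simp only: distrib_right)
    also have "\<dots> = qdilog_log Q $ j"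
      using \<open>?s \<noteq> 0\<close> by (simp add: qdilog_log_def)
    finally show ?thesis ..
  qed simp
  then have "qdilog_log Q = ?L Q + ?L (inverse Q)"
    by (simp add: fps_eq_iff)
  then show ?thesis
    by (simp add: qdilog_fps_def fps_exp_compose_add flip: fps_compose_assoc)
qed

context unital_algebra
begin

lemma commute_power_scale:
  assumes "v * u = a *\<^sub>K (u * v)"
  shows "v ^ i * u ^ j = a ^ (i * j) *\<^sub>K (u ^ j * v ^ i)"
proof -
  have commute_1: "v * u ^ j = a ^ j *\<^sub>K (u ^ j * v)"
  proof (induction j)
    case (Suc j)
    have "v * u ^ Suc j = (v * u ^ j) * u"
      by (simp add: power_Suc2 mult.assoc del: power_Suc)
    also have "\<dots> = a ^ j *\<^sub>K (u ^ j * (v * u))"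
      by (simp add: Suc scale_mult mult.assoc)
    also have "\<dots> = a ^ Suc j *\<^sub>K (u ^ Suc j * v)"
      by (simp add: assms scale_mult mult.assoc power_Suc2 mult.commute del: power_Suc)
    finally show ?case .
  qed simp
  show ?thesis
  proof (induction i)
    case (Suc i)
    have "v ^ Suc i * u ^ j = a ^ (i * j) *\<^sub>K (v * u ^ j * v ^ i)"
      by (simp add: Suc scale_mult mult.assoc)
    also have "\<dots> = a ^ (Suc i * j) *\<^sub>K (u ^ j * v ^ Suc i)"
      by (simp add: commute_1 scale_mult mult.assoc power_add mult.commute)
    finally show ?case .
  qed simp
qed

end

context char_0_algebra
begin

lemma q_binomial_recurrence:
  fixes W V :: "nat \<Rightarrow> 'a"
  assumes W_Suc: "\<And>k. r *\<^sub>K (w * W k) = (q ^ Suc k - 1) *\<^sub>K W (Suc k)"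
    and V_Suc: "\<And>k. r *\<^sub>K (v * V k) = (q ^ Suc k - 1) *\<^sub>K V (Suc k)"
    and v_W: "\<And>k. v * W k = q ^ k *\<^sub>K (W k * v)"
  shows "r *\<^sub>K ((w + v) * (\<Sum>k\<le>n. W k * V (n - k))) =
    (q ^ Suc n - 1) *\<^sub>K (\<Sum>k\<le>Suc n. W k * V (Suc n - k))"
proof -
  have summand: "r *\<^sub>K ((w + v) * (W k * V (n - k))) =
      (q ^ Suc k - 1) *\<^sub>K (W (Suc k) * V (Suc n - Suc k)) +
      (q ^ Suc n - q ^ k) *\<^sub>K (W k * V (Suc n - k))"
    if "k \<le> n" for k
  proof -
    have "r *\<^sub>K ((w + v) * (W k * V (n - k))) =
        (r *\<^sub>K (w * W k)) * V (n - k) + q ^ k *\<^sub>K (W k * (r *\<^sub>K (v * V (n - k))))"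
      by (simp add: distrib_right scale_right_distrib scale_mult mult.assoc[symmetric] v_W
          scale_left_commute)
    also have "q ^ k *\<^sub>K (W k * (r *\<^sub>K (v * V (n - k)))) =
        (q ^ k * (q ^ Suc (n - k) - 1)) *\<^sub>K (W k * V (Suc (n - k)))"
      unfolding V_Suc by (simp add: scale_mult del: power_Suc)
    also have "q ^ k * (q ^ Suc (n - k) - 1) = q ^ Suc n - q ^ k"
      using that by (simp add: algebra_simps flip: power_add)
    finally show ?thesis
      using that unfolding W_Suc by (simp add: scale_mult Suc_diff_le del: power_Suc)
  qed
  have "r *\<^sub>K ((w + v) * (\<Sum>k\<le>n. W k * V (n - k))) =
      (\<Sum>k\<le>n. (q ^ Suc k - 1) *\<^sub>K (W (Suc k) * V (Suc n - Suc k))) +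
      (\<Sum>k\<le>n. (q ^ Suc n - q ^ k) *\<^sub>K (W k * V (Suc n - k)))"
    by (simp add: sum_distrib_left scale_sum_right summand sum.distrib del: power_Suc)
  also have "\<dots> = (\<Sum>k\<le>Suc n. (q ^ k - 1) *\<^sub>K (W k * V (Suc n - k))) +
      (\<Sum>k\<le>Suc n. (q ^ Suc n - q ^ k) *\<^sub>K (W k * V (Suc n - k)))"
    by (simp add: sum.atMost_Suc_shift[of "\<lambda>k. (q ^ k - 1) *\<^sub>K _ k"] del: power_Suc sum.atMost_Suc)
      simp
  also have "\<dots> = (q ^ Suc n - 1) *\<^sub>K (\<Sum>k\<le>Suc n. W k * V (Suc n - k))"
    by (simp only: sum.distrib[symmetric] scale_left_distrib[symmetric] scale_sum_right) simp
  finally show ?thesis .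
qed

lemma q_binomial:
  fixes c :: "nat \<Rightarrow> 'k"
  assumes vw_commute: "v * w = q *\<^sub>K (w * v)" and q_generic: "\<And>k. q ^ Suc k \<noteq> 1"
    and c_0: "c 0 = 1" and c_Suc: "\<And>k. c (Suc k) * (q ^ Suc k - 1) = r * c k"
  shows "c n *\<^sub>K (w + v) ^ n = (\<Sum>k\<le>n. (c k *\<^sub>K w ^ k) * (c (n - k) *\<^sub>K v ^ (n - k)))"
proof (induction n)
  case (Suc n)
  define W V where "W k = c k *\<^sub>K w ^ k" and "V k = c k *\<^sub>K v ^ k" for k
  have r_mult_c: "r * c k = (q ^ Suc k - 1) * c (Suc k)" for k
    using c_Suc[of k] by (simp add: mult.commute)
  have "r *\<^sub>K (w * W k) = (q ^ Suc k - 1) *\<^sub>K W (Suc k)"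
    "r *\<^sub>K (v * V k) = (q ^ Suc k - 1) *\<^sub>K V (Suc k)" for k
    unfolding W_def V_def by (simp_all add: scale_mult r_mult_c del: power_Suc) simp_all
  moreover have "v * W k = q ^ k *\<^sub>K (W k * v)" for k
    using commute_power_scale[OF vw_commute, of 1 k] by (simp add: W_def scale_mult mult.commute)
  ultimately have "r *\<^sub>K ((w + v) * (\<Sum>k\<le>n. W k * V (n - k))) =
      (q ^ Suc n - 1) *\<^sub>K (\<Sum>k\<le>Suc n. W k * V (Suc n - k))"
    by (rule q_binomial_recurrence)
  moreover have "(q ^ Suc n - 1) *\<^sub>K (c (Suc n) *\<^sub>K (w + v) ^ Suc n) =
      r *\<^sub>K ((w + v) * (c n *\<^sub>K (w + v) ^ n))"
    using r_mult_c[of n] by (simp add: scale_mult del: power_Suc) simp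
  ultimately have "(q ^ Suc n - 1) *\<^sub>K (c (Suc n) *\<^sub>K (w + v) ^ Suc n) =
      (q ^ Suc n - 1) *\<^sub>K (\<Sum>k\<le>Suc n. W k * V (Suc n - k))"
    unfolding Suc W_def V_def by (simp only:)
  then show ?case
    using q_generic[of n] unfolding scale_cancel_left W_def V_def by simp
qed (simp add: c_0)

definition quantum_dilog :: "'k \<Rightarrow> 'a fps \<Rightarrow> 'a fps" where
  "quantum_dilog Q z = fps_eval (qdilog_fps Q) z"

lemma quantum_dilog_eq_nc_exp: "z $ 0 = 0 \<Longrightarrow> quantum_dilog Q z = nc_exp (fps_eval (qdilog_log Q) z)"
  by (simp add: quantum_dilog_def qdilog_fps_def nc_exp_def fps_eval_compose)

lemma quantum_dilog_scale:
  "quantum_dilog Q (c *\<^sub>F z) = fps_eval (qdilog_fps Q oo (fps_const c * fps_X)) z"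
  by (simp add: quantum_dilog_def fps_eval_scale)

lemma quantum_dilog_functional_equation:
  assumes "generic_param Q" "z $ 0 = 0"
  shows "quantum_dilog Q (Q *\<^sub>F z) = (1 + z) * quantum_dilog Q (inverse Q *\<^sub>F z)"
  using assms by (simp add: quantum_dilog_scale qdilog_fps_functional_equation fps_eval_mult
      fps_eval_add fps_eval_fps_X)

lemma quantum_dilog_fission:
  assumes "generic_param Q" "z $ 0 = 0"
  shows "quantum_dilog Q z =
      quantum_dilog (Q ^ 2) (Q *\<^sub>F z) * quantum_dilog (Q ^ 2) (inverse Q *\<^sub>F z)"
  using assms by (simp add: quantum_dilog_scale fps_eval_mult[symmetric]
      qdilog_fps_fission[symmetric])
    (simp add: quantum_dilog_def)

lemma quantum_dilog_cong_sum:
  "z $ 0 = 0 \<Longrightarrow> fps_cong m (quantum_dilog Q z) (\<Sum>k<m. qdilog_fps Q $ k *\<^sub>F z ^ k)"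
  unfolding quantum_dilog_def by (rule fps_eval_cong_sum)

lemma quantum_dilog_cong_1:
  assumes "fps_cong m z 0"
  shows "fps_cong m (quantum_dilog Q z) 1"
  using fps_cong_fps_eval[OF assms, of "qdilog_fps Q"]
  by (simp add: quantum_dilog_def fps_eval_0_right)

lemma quantum_dilog_add:
  assumes generic: "generic_param Q" and vw_commute: "v * w = Q ^ 2 *\<^sub>F (w * v)"
    and "v $ 0 = 0" "w $ 0 = 0"
  shows "quantum_dilog Q (w + v) = quantum_dilog Q w * quantum_dilog Q v"
proof (rule fps_cong_all_imp_eq)
  interpret fps: char_0_algebra "fps_scale scale" by (rule char_0_algebra_fps)
  fix m
  let ?c = "\<lambda>k. qdilog_fps Q $ k"
  have "generic_param (Q ^ 2)"
    using generic by (rule generic_param_power) simp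
  then have square_generic: "(Q ^ 2) ^ Suc k \<noteq> 1" for k
    by (auto simp: generic_param_def simp del: power_Suc)
  have "fps_cong m (quantum_dilog Q (w + v)) (\<Sum>k<m. ?c k *\<^sub>F (w + v) ^ k)"
    by (rule quantum_dilog_cong_sum) (simp add: assms)
  also have "\<dots> = (\<Sum>k<m. \<Sum>i\<le>k. (?c i *\<^sub>F w ^ i) * (?c (k - i) *\<^sub>F v ^ (k - i)))"
    by (intro sum.cong refl
        fps.q_binomial[OF vw_commute square_generic _ qdilog_fps_nth_Suc[OF generic]]) simp
  also have "fps_cong m \<dots> ((\<Sum>i<m. ?c i *\<^sub>F w ^ i) * (\<Sum>j<m. ?c j *\<^sub>F v ^ j))"
    using fps_cong_power_0[of 1 w] fps_cong_power_0[of 1 v] assms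
    by (intro fps_cong_sym[OF fps_cong_Cauchy_product] fps_cong_scale_0) auto
  also have "fps_cong m \<dots> (quantum_dilog Q w * quantum_dilog Q v)"
    by (intro fps_cong_mult fps_cong_sym[OF quantum_dilog_cong_sum] assms)
  finally show "fps_cong m (quantum_dilog Q (w + v)) (quantum_dilog Q w * quantum_dilog Q v)" .
qed

text \<open>
  As \<open>\<Phi> (Q\<^sup>2 u) = (1 + Q u) \<Phi> (u)\<close>, conjugation by \<open>\<Phi> (u)\<close> maps \<open>v\<close> to \<open>v + Q u v\<close>.
\<close>

theorem quantum_dilog_pentagon:
  assumes generic: "generic_param Q" and u_nth_0: "u $ 0 = 0" and v_nth_0: "v $ 0 = 0"
    and vu_commute: "v * u = Q ^ 2 *\<^sub>F (u * v)"
  shows "quantum_dilog Q v * quantum_dilog Q u =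
    quantum_dilog Q u * quantum_dilog Q (Q *\<^sub>F (u * v)) * quantum_dilog Q v"
proof -
  let ?w = "Q *\<^sub>F (u * v)"
  have "quantum_dilog Q (Q ^ 2 *\<^sub>F u) = (1 + Q *\<^sub>F u) * quantum_dilog Q u"
    using quantum_dilog_functional_equation[OF generic, of "Q *\<^sub>F u"] generic u_nth_0
    by (simp add: power2_eq_square)
  also have "\<dots> = quantum_dilog Q u * (1 + Q *\<^sub>F u)"
    using fps_eval_intertwine[of u "1 + Q *\<^sub>F u" u "qdilog_fps Q"] u_nth_0
    by (simp add: quantum_dilog_def distrib_left distrib_right fps.scale_mult)
  finally have shift: "quantum_dilog Q (Q ^ 2 *\<^sub>F u) = quantum_dilog Q u * (1 + Q *\<^sub>F u)" .
  have "v * quantum_dilog Q u = quantum_dilog Q (Q ^ 2 *\<^sub>F u) * v"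
    unfolding quantum_dilog_def
    by (rule fps_eval_intertwine[symmetric]) (simp_all add: vu_commute u_nth_0 fps.scale_mult)
  also have "\<dots> = quantum_dilog Q u * (?w + v)"
    by (simp add: shift mult.assoc distrib_right fps.scale_mult add.commute)
  finally have "quantum_dilog Q v * quantum_dilog Q u =
      quantum_dilog Q u * quantum_dilog Q (?w + v)"
    unfolding quantum_dilog_def
    by (rule fps_eval_intertwine) (simp_all add: u_nth_0 v_nth_0 fps_mult_nth_0)
  moreover have "v * ?w = Q ^ 2 *\<^sub>F (?w * v)"
    by (simp add: fps.scale_mult mult.commute flip: mult.assoc)
      (simp add: vu_commute fps.scale_mult mult_ac)
  ultimately show ?thesis
    using quantum_dilog_add[OF generic, of v ?w] u_nth_0 v_nth_0 by (simp add: mult.assoc)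
qed

end

section \<open>Factorization in a quantum plane\<close>

definition prod_right :: "(nat \<Rightarrow> 'a::monoid_mult) \<Rightarrow> nat \<Rightarrow> 'a" where
  "prod_right f k = prod_list (map f [0..<k])"

definition prod_left :: "(nat \<Rightarrow> 'a::monoid_mult) \<Rightarrow> nat \<Rightarrow> 'a" where
  "prod_left f k = prod_list (map f (rev [0..<k]))"

lemma prod_right_simps [simp]: "prod_right f 0 = 1" "prod_right f (Suc k) = prod_right f k * f k"
  by (simp_all add: prod_right_def)

lemma prod_left_simps [simp]: "prod_left f 0 = 1" "prod_left f (Suc k) = f k * prod_left f k"
  by (simp_all add: prod_left_def)

lemma prod_right_Suc_shift: "prod_right f (Suc k) = f 0 * prod_right (\<lambda>p. f (Suc p)) k"
  by (induction k) (simp_all add: mult.assoc)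

lemma prod_right_commute:
  assumes "\<And>p. a * f p = f p * a"
  shows "a * prod_right f k = prod_right f k * a"
proof (induction k)
  case (Suc k)
  have "a * prod_right f (Suc k) = prod_right f k * (a * f k)"
    by (simp add: Suc flip: mult.assoc)
  also have "\<dots> = prod_right f (Suc k) * a"
    by (simp add: assms mult.assoc)
  finally show ?case .
qed simp

lemma fps_cong_prod_right_add:
  fixes f :: "nat \<Rightarrow> 'a::semiring_1 fps"
  assumes "\<And>p. k \<le> p \<Longrightarrow> fps_cong m (f p) 1"
  shows "fps_cong m (prod_right f (k + n)) (prod_right f k)"
proof (induction n)
  case (Suc n)
  have "fps_cong m (prod_right f (k + n) * f (k + n)) (prod_right f k * 1)"
    by (intro fps_cong_mult Suc assms) simp
  then show ?case by simp
qed simp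

lemma fps_cong_prod_left_add:
  fixes f :: "nat \<Rightarrow> 'a::semiring_1 fps"
  assumes "\<And>p. k \<le> p \<Longrightarrow> fps_cong m (f p) 1"
  shows "fps_cong m (prod_left f (k + n)) (prod_left f k)"
proof (induction n)
  case (Suc n)
  have "fps_cong m (f (k + n) * prod_left f (k + n)) (1 * prod_left f k)"
    by (intro fps_cong_mult Suc assms) simp
  then show ?case by simp
qed simp

context char_0_algebra
begin

definition central_prod :: "'k \<Rightarrow> 'a fps \<Rightarrow> nat \<Rightarrow> 'a fps" where
  "central_prod Q w = prod_right (\<lambda>p. quantum_dilog (Q ^ 2 ^ p) (inverse (Q ^ 2 ^ p) *\<^sub>F w ^ 2 ^ p) *
     quantum_dilog (Q ^ 2 ^ p) (Q ^ 2 ^ p *\<^sub>F w ^ 2 ^ p))"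

lemma quantum_dilog_commute:
  assumes "x * z = z * x" "z $ 0 = 0"
  shows "x * quantum_dilog Q z = quantum_dilog Q z * x"
  using fps_eval_intertwine[of z x z] assms by (simp add: quantum_dilog_def)

lemma central_prod_Suc:
  assumes w_nth_0: "w $ 0 = 0"
  shows "central_prod Q w (Suc K) =
    quantum_dilog Q (Q *\<^sub>F w) * central_prod (Q ^ 2) (w ^ 2) K * quantum_dilog Q (inverse Q *\<^sub>F w)"
proof -
  let ?a = "quantum_dilog Q (inverse Q *\<^sub>F w)"
  have power_nth_0: "(c *\<^sub>F w ^ k) $ 0 = 0" if "k > 0" for c k
    using w_nth_0 that by (simp add: fps_nth_power_0 zero_power)
  have "w ^ k * ?a = ?a * w ^ k" for k
    using w_nth_0 by (intro quantum_dilog_commute) (simp_all add: fps.scale_mult power_commutes)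
  then have commute: "?a * quantum_dilog R (c *\<^sub>F w ^ k) = quantum_dilog R (c *\<^sub>F w ^ k) * ?a"
    if "k > 0" for R c k
    using power_nth_0[OF that] by (intro quantum_dilog_commute) (simp_all add: fps.scale_mult)
  have "?a * central_prod (Q ^ 2) (w ^ 2) K = central_prod (Q ^ 2) (w ^ 2) K * ?a"
    unfolding central_prod_def power_mult[symmetric]
    by (rule prod_right_commute) (simp add: commute flip: mult.assoc, simp add: commute mult.assoc)
  moreover have "central_prod Q w (Suc K) =
      ?a * quantum_dilog Q (Q *\<^sub>F w) * central_prod (Q ^ 2) (w ^ 2) K"
    unfolding central_prod_def prod_right_Suc_shift by (simp add: power_mult)
  moreover have "?a * quantum_dilog Q (Q *\<^sub>F w) = quantum_dilog Q (Q *\<^sub>F w) * ?a"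
    using commute[of 1] by simp
  ultimately show ?thesis
    by (simp add: mult.assoc)
qed

text \<open>
  If \<open>v u = Q\<^sup>4 u v\<close>, this normalisation makes the scalars that arise when two such monomials are
  multiplied in either order inverse to each other.
\<close>

definition weyl_monomial :: "'k \<Rightarrow> 'a fps \<Rightarrow> 'a fps \<Rightarrow> nat \<Rightarrow> nat \<Rightarrow> 'a fps" where
  "weyl_monomial Q u v i j = Q ^ (2 * i * j) *\<^sub>F (u ^ i * v ^ j)"

lemma weyl_monomial_simps [simp]:
  "weyl_monomial Q u v 0 0 = 1"
  "weyl_monomial Q u v (Suc 0) 0 = u" "weyl_monomial Q u v 0 (Suc 0) = v"
  by (simp_all add: weyl_monomial_def)

lemma fps_cong_weyl_monomial_0:
  "fps_cong m u 0 \<Longrightarrow> fps_cong n v 0 \<Longrightarrow> fps_cong (m * i + n * j) (weyl_monomial Q u v i j) 0"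
  unfolding weyl_monomial_def by (intro fps_cong_scale_0 fps_cong_mult_0 fps_cong_power_0)

end

locale quantum_plane = char_0_algebra scale
  for scale :: "'k::field_char_0 \<Rightarrow> 'a::ring_1 \<Rightarrow> 'a" (infixr "*\<^sub>K" 73) +
  fixes Q :: 'k and u v :: "'a fps"
  assumes generic: "generic_param Q" and u_nth_0: "u $ 0 = 0" and v_nth_0: "v $ 0 = 0"
    and vu_commute: "v * u = Q ^ 4 *\<^sub>F (u * v)"
begin

abbreviation weyl :: "nat \<Rightarrow> nat \<Rightarrow> 'a fps" where
  "weyl \<equiv> weyl_monomial Q u v"

abbreviation \<Phi> :: "'a fps \<Rightarrow> 'a fps" where
  "\<Phi> \<equiv> quantum_dilog Q"

abbreviation \<Phi>\<^sub>2 :: "'a fps \<Rightarrow> 'a fps" where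
  "\<Phi>\<^sub>2 \<equiv> quantum_dilog (Q ^ 2)"

lemma fps_cong_weyl_0: "fps_cong (i + j) (weyl i j) 0"
  using fps_cong_weyl_monomial_0[of 1 u 1 v i j Q] u_nth_0 v_nth_0 by simp

lemma weyl_nth_0: "i + j > 0 \<Longrightarrow> weyl i j $ 0 = 0"
  using fps_cong_weyl_0[of i j] by (auto simp: fps_cong_def)

lemma weyl_mult:
  "weyl i j * weyl k m = Q powi (2 * (int j * int k - int i * int m)) *\<^sub>F weyl (i + k) (j + m)"
proof -
  have "weyl i j * weyl k m =
      (Q ^ (2 * i * j) * Q ^ (2 * k * m)) *\<^sub>F (u ^ i * (v ^ j * u ^ k) * v ^ m)"
    by (simp add: weyl_monomial_def fps.scale_mult mult_ac)
  also have "\<dots> = Q ^ (2 * i * j + 2 * k * m + 4 * (j * k)) *\<^sub>F (u ^ (i + k) * v ^ (j + m))"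
    unfolding fps.commute_power_scale[OF vu_commute]
    by (simp add: fps.scale_mult power_add mult.assoc power_mult)
  also have "Q ^ (2 * i * j + 2 * k * m + 4 * (j * k)) =
      Q powi (2 * (int j * int k - int i * int m)) * Q ^ (2 * (i + k) * (j + m))"
    using generic by (simp flip: power_int_of_nat power_int_add) (simp add: algebra_simps)
  finally show ?thesis
    by (simp add: weyl_monomial_def)
qed

lemma weyl_power: "weyl i j ^ k = weyl (k * i) (k * j)"
  by (induction k) (simp_all add: weyl_mult mult_ac)

text \<open>
  Two monomials whose exponents span a sublattice of index \<open>l\<close> generate a quantum plane with
  parameter \<open>Q ^ l\<close>.
\<close>

lemma quantum_plane_weyl:
  assumes det: "j * k = i * m + l" and l_pos: "l > 0"
  shows "quantum_plane scale (Q ^ l) (e *\<^sub>F weyl k m) (c *\<^sub>F weyl i j)"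
proof
  have "0 < i + j" "0 < k + m"
    using assms by (auto intro!: Nat.gr0I)
  then show "(e *\<^sub>F weyl k m) $ 0 = 0" "(c *\<^sub>F weyl i j) $ 0 = 0"
    by (simp_all add: weyl_nth_0)
  show "generic_param (Q ^ l)"
    using generic l_pos by (rule generic_param_power)
  have "int j * int k - int i * int m = int l" "int m * int i - int k * int j = - int l"
    using arg_cong[OF det, of int] by (simp_all add: mult.commute)
  then have mult: "weyl i j * weyl k m = Q powi int (2 * l) *\<^sub>F weyl (i + k) (j + m)"
    "weyl k m * weyl i j = Q powi (- int (2 * l)) *\<^sub>F weyl (i + k) (j + m)"
    by (simp_all add: weyl_mult add.commute)
  have "(Q ^ l) ^ 4 = Q ^ (2 * l) * Q ^ (2 * l)"
    by (simp flip: power_mult power_add) (simp add: mult.commute)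
  then have "weyl i j * weyl k m = (Q ^ l) ^ 4 *\<^sub>F (weyl k m * weyl i j)"
    using generic unfolding mult power_int_minus power_int_of_nat by (simp add: mult.assoc)
  then show "c *\<^sub>F weyl i j * e *\<^sub>F weyl k m = (Q ^ l) ^ 4 *\<^sub>F (e *\<^sub>F weyl k m * c *\<^sub>F weyl i j)"
    by (simp add: fps.scale_mult mult_ac)
qed

lemma weyl_monomial_weyl:
  assumes det: "j * k = i * m + l"
  shows "weyl_monomial (Q ^ l) (e *\<^sub>F weyl k m) (c *\<^sub>F weyl i j) a b =
      (e ^ a * c ^ b) *\<^sub>F weyl (a * k + b * i) (a * m + b * j)"
proof -
  have "int j * int k = int i * int m + int l"
    using det by (metis of_nat_add of_nat_mult)
  then have "2 * (int (a * m) * int (b * i) - int (a * k) * int (b * j)) = - int (l * (2 * a * b))"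
    by (simp add: algebra_simps)
  then have "weyl (a * k) (a * m) * weyl (b * i) (b * j) =
      inverse ((Q ^ l) ^ (2 * a * b)) *\<^sub>F weyl (a * k + b * i) (a * m + b * j)"
    by (simp only: weyl_mult power_int_minus power_int_of_nat power_mult)
  then show ?thesis
    using generic by (simp add: weyl_monomial_def[of "Q ^ l"] fps.scale_power weyl_power
        fps.scale_mult mult_ac)
qed

lemma fission: "z $ 0 = 0 \<Longrightarrow> \<Phi> z = \<Phi>\<^sub>2 (Q *\<^sub>F z) * \<Phi>\<^sub>2 (inverse Q *\<^sub>F z)"
  using generic by (rule quantum_dilog_fission)

lemma pentagon: "\<Phi>\<^sub>2 v * \<Phi>\<^sub>2 u = \<Phi>\<^sub>2 u * \<Phi>\<^sub>2 (weyl 1 1) * \<Phi>\<^sub>2 v"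
proof -
  have "v * u = (Q ^ 2) ^ 2 *\<^sub>F (u * v)"
    by (simp add: vu_commute flip: power_mult)
  then show ?thesis
    using quantum_dilog_pentagon[of "Q ^ 2" u v] generic u_nth_0 v_nth_0
    by (simp add: generic_param_power weyl_monomial_def)
qed

lemma pentagon_weyl:
  assumes "j * k = i * m + 1"
  shows "\<Phi>\<^sub>2 (c *\<^sub>F weyl i j) * \<Phi>\<^sub>2 (e *\<^sub>F weyl k m) =
    \<Phi>\<^sub>2 (e *\<^sub>F weyl k m) * \<Phi>\<^sub>2 ((e * c) *\<^sub>F weyl (k + i) (m + j)) * \<Phi>\<^sub>2 (c *\<^sub>F weyl i j)"
  using quantum_plane.pentagon[OF quantum_plane_weyl[OF assms, of e c]]
    weyl_monomial_weyl[OF assms, of e c 1 1] by simp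

lemma exchange_left:
  "\<Phi>\<^sub>2 v * \<Phi> u = \<Phi> u * \<Phi>\<^sub>2 (weyl 2 1) * \<Phi> (weyl 1 1) * \<Phi>\<^sub>2 v"
proof -
  let ?w = "weyl 1 1"
  have w_nth_0: "?w $ 0 = 0"
    by (simp add: weyl_nth_0)
  have pentagon_v_u: "\<Phi>\<^sub>2 v * \<Phi>\<^sub>2 (c *\<^sub>F u) = \<Phi>\<^sub>2 (c *\<^sub>F u) * \<Phi>\<^sub>2 (c *\<^sub>F ?w) * \<Phi>\<^sub>2 v" for c
    using pentagon_weyl[of 1 1 0 0 1 c] by simp
  have pentagon_w_u: "\<Phi>\<^sub>2 (Q *\<^sub>F ?w) * \<Phi>\<^sub>2 (inverse Q *\<^sub>F u) =
      \<Phi>\<^sub>2 (inverse Q *\<^sub>F u) * \<Phi>\<^sub>2 (weyl 2 1) * \<Phi>\<^sub>2 (Q *\<^sub>F ?w)"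
    using pentagon_weyl[of 1 1 1 0 Q "inverse Q"] generic by (simp add: numeral_2_eq_2)
  have "\<Phi>\<^sub>2 v * \<Phi> u = \<Phi>\<^sub>2 v * \<Phi>\<^sub>2 (Q *\<^sub>F u) * \<Phi>\<^sub>2 (inverse Q *\<^sub>F u)"
    by (simp add: fission[OF u_nth_0] mult.assoc)
  also have "\<dots> = \<Phi>\<^sub>2 (Q *\<^sub>F u) * (\<Phi>\<^sub>2 (Q *\<^sub>F ?w) * \<Phi>\<^sub>2 (inverse Q *\<^sub>F u)) * \<Phi>\<^sub>2 (inverse Q *\<^sub>F ?w) * \<Phi>\<^sub>2 v"
    using pentagon_v_u[of "inverse Q"] by (simp add: pentagon_v_u[of Q] mult.assoc)
  also have "\<dots> = \<Phi> u * \<Phi>\<^sub>2 (weyl 2 1) * \<Phi> ?w * \<Phi>\<^sub>2 v"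
    unfolding pentagon_w_u fission[OF u_nth_0] fission[OF w_nth_0] by (simp only: mult.assoc)
  finally show ?thesis .
qed

lemma exchange_right:
  "\<Phi> v * \<Phi>\<^sub>2 u = \<Phi>\<^sub>2 u * \<Phi> (weyl 1 1) * \<Phi>\<^sub>2 (weyl 1 2) * \<Phi> v"
proof -
  let ?w = "weyl 1 1"
  have w_nth_0: "?w $ 0 = 0"
    by (simp add: weyl_nth_0)
  have pentagon_v_u: "\<Phi>\<^sub>2 (c *\<^sub>F v) * \<Phi>\<^sub>2 u = \<Phi>\<^sub>2 u * \<Phi>\<^sub>2 (c *\<^sub>F ?w) * \<Phi>\<^sub>2 (c *\<^sub>F v)" for c
    using pentagon_weyl[of 1 1 0 0 c 1] by simp
  have pentagon_v_w: "\<Phi>\<^sub>2 (Q *\<^sub>F v) * \<Phi>\<^sub>2 (inverse Q *\<^sub>F ?w) =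
      \<Phi>\<^sub>2 (inverse Q *\<^sub>F ?w) * \<Phi>\<^sub>2 (weyl 1 2) * \<Phi>\<^sub>2 (Q *\<^sub>F v)"
    using pentagon_weyl[of 1 1 0 1 Q "inverse Q"] generic by (simp add: numeral_2_eq_2)
  have "\<Phi> v * \<Phi>\<^sub>2 u = \<Phi>\<^sub>2 (Q *\<^sub>F v) * (\<Phi>\<^sub>2 (inverse Q *\<^sub>F v) * \<Phi>\<^sub>2 u)"
    by (simp add: fission[OF v_nth_0] mult.assoc)
  also have "\<dots> = \<Phi>\<^sub>2 u * \<Phi>\<^sub>2 (Q *\<^sub>F ?w) * (\<Phi>\<^sub>2 (Q *\<^sub>F v) * \<Phi>\<^sub>2 (inverse Q *\<^sub>F ?w)) * \<Phi>\<^sub>2 (inverse Q *\<^sub>F v)"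
    by (simp add: pentagon_v_u[of "inverse Q"] flip: mult.assoc) (simp add: pentagon_v_u[of Q])
  also have "\<dots> = \<Phi>\<^sub>2 u * \<Phi> ?w * \<Phi>\<^sub>2 (weyl 1 2) * \<Phi> v"
    unfolding pentagon_v_w fission[OF v_nth_0] fission[OF w_nth_0] by (simp only: mult.assoc)
  finally show ?thesis .
qed

lemma exchange_weyl_right:
  "\<Phi> (Q *\<^sub>F weyl 1 1) * \<Phi>\<^sub>2 (inverse Q *\<^sub>F weyl (Suc i) i) =
    \<Phi>\<^sub>2 (inverse Q *\<^sub>F weyl (Suc i) i) * \<Phi> (weyl (i + 2) (i + 1)) *
    \<Phi>\<^sub>2 (Q *\<^sub>F weyl (i + 3) (i + 2)) * \<Phi> (Q *\<^sub>F weyl 1 1)"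
proof -
  have det: "1 * Suc i = 1 * i + 1" by simp
  have cancel: "inverse Q * (Q * Q) = Q"
    using generic by (simp flip: mult.assoc)
  show ?thesis
    using quantum_plane.exchange_right[OF quantum_plane_weyl[OF det, of "inverse Q" Q]] generic
    by (simp add: weyl_monomial_weyl[OF det, simplified] cancel numeral_eq_Suc)
qed

lemma exchange_weyl_left:
  "\<Phi>\<^sub>2 (Q *\<^sub>F weyl j (Suc j)) * \<Phi> (inverse Q *\<^sub>F weyl 1 1) =
    \<Phi> (inverse Q *\<^sub>F weyl 1 1) * \<Phi>\<^sub>2 (inverse Q *\<^sub>F weyl (j + 2) (j + 3)) *
    \<Phi> (weyl (j + 1) (j + 2)) * \<Phi>\<^sub>2 (Q *\<^sub>F weyl j (Suc j))"
proof -
  have det: "Suc j * 1 = j * 1 + 1" by simp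
  have cancel: "inverse Q * inverse Q * Q = inverse Q"
    using generic by (simp add: mult.assoc)
  show ?thesis
    using quantum_plane.exchange_left[OF quantum_plane_weyl[OF det, of "inverse Q" Q]] generic
    by (simp add: weyl_monomial_weyl[OF det, simplified] cancel numeral_eq_Suc)
qed

lemma shuffle_right:
  "\<Phi> u * \<Phi>\<^sub>2 (Q *\<^sub>F weyl 2 1) * \<Phi> (Q *\<^sub>F weyl 1 1) *
     prod_right (\<lambda>p. \<Phi>\<^sub>2 (inverse Q *\<^sub>F weyl (2 * p + 2) (2 * p + 1))) K =
   prod_right (\<lambda>p. \<Phi> (weyl (p + 1) p)) (2 * K + 1) *
     \<Phi>\<^sub>2 (Q *\<^sub>F weyl (2 * K + 2) (2 * K + 1)) * \<Phi> (Q *\<^sub>F weyl 1 1)"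
proof (induction K)
  case (Suc K)
  let ?P = "prod_right (\<lambda>p. \<Phi> (weyl (p + 1) p)) (2 * K + 1)"
  let ?y = "weyl (2 * K + 2) (2 * K + 1)" and ?z = "weyl (2 * K + 4) (2 * K + 3)"
  have y_nth_0: "?y $ 0 = 0" by (simp add: weyl_nth_0)
  have "\<Phi> u * \<Phi>\<^sub>2 (Q *\<^sub>F weyl 2 1) * \<Phi> (Q *\<^sub>F weyl 1 1) *
      prod_right (\<lambda>p. \<Phi>\<^sub>2 (inverse Q *\<^sub>F weyl (2 * p + 2) (2 * p + 1))) (Suc K)
      = ?P * \<Phi>\<^sub>2 (Q *\<^sub>F ?y) * (\<Phi> (Q *\<^sub>F weyl 1 1) * \<Phi>\<^sub>2 (inverse Q *\<^sub>F ?y))"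
    unfolding prod_right_simps mult.assoc[symmetric] Suc ..
  also have "\<Phi> (Q *\<^sub>F weyl 1 1) * \<Phi>\<^sub>2 (inverse Q *\<^sub>F ?y) = \<Phi>\<^sub>2 (inverse Q *\<^sub>F ?y) *
      \<Phi> (weyl (2 * K + 3) (2 * K + 2)) * \<Phi>\<^sub>2 (Q *\<^sub>F ?z) * \<Phi> (Q *\<^sub>F weyl 1 1)"
    using exchange_weyl_right[of "2 * K + 1"] by (simp add: numeral_eq_Suc)
  also have "?P * \<Phi>\<^sub>2 (Q *\<^sub>F ?y) * \<dots> = ?P * \<Phi> ?y * \<Phi> (weyl (2 * K + 3) (2 * K + 2)) *
      \<Phi>\<^sub>2 (Q *\<^sub>F ?z) * \<Phi> (Q *\<^sub>F weyl 1 1)"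
    unfolding fission[OF y_nth_0] by (simp only: mult.assoc)
  also have "?P * \<Phi> ?y * \<Phi> (weyl (2 * K + 3) (2 * K + 2)) =
      prod_right (\<lambda>p. \<Phi> (weyl (p + 1) p)) (2 * Suc K + 1)"
    by (simp add: numeral_3_eq_3)
  finally show ?case
    by (simp add: numeral_eq_Suc)
qed (simp add: numeral_2_eq_2)

lemma shuffle_left:
  "prod_left (\<lambda>p. \<Phi>\<^sub>2 (Q *\<^sub>F weyl (2 * p) (2 * p + 1))) K * \<Phi> (inverse Q *\<^sub>F weyl 1 1) *
    \<Phi>\<^sub>2 (inverse Q *\<^sub>F v) =
   \<Phi> (inverse Q *\<^sub>F weyl 1 1) * \<Phi>\<^sub>2 (inverse Q *\<^sub>F weyl (2 * K) (2 * K + 1)) *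
     prod_left (\<lambda>p. \<Phi> (weyl p (p + 1))) (2 * K)"
proof (induction K)
  case (Suc K)
  let ?P = "prod_left (\<lambda>p. \<Phi> (weyl p (p + 1))) (2 * K)"
  let ?y = "weyl (2 * K) (2 * K + 1)" and ?z = "weyl (2 * K + 2) (2 * K + 3)"
  have y_nth_0: "?y $ 0 = 0" by (simp add: weyl_nth_0)
  have "prod_left (\<lambda>p. \<Phi>\<^sub>2 (Q *\<^sub>F weyl (2 * p) (2 * p + 1))) (Suc K) *
      \<Phi> (inverse Q *\<^sub>F weyl 1 1) * \<Phi>\<^sub>2 (inverse Q *\<^sub>F v)
      = \<Phi>\<^sub>2 (Q *\<^sub>F ?y) * \<Phi> (inverse Q *\<^sub>F weyl 1 1) * \<Phi>\<^sub>2 (inverse Q *\<^sub>F ?y) * ?P"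
    using Suc by (simp add: mult.assoc)
  also have "\<Phi>\<^sub>2 (Q *\<^sub>F ?y) * \<Phi> (inverse Q *\<^sub>F weyl 1 1) = \<Phi> (inverse Q *\<^sub>F weyl 1 1) *
      \<Phi>\<^sub>2 (inverse Q *\<^sub>F ?z) * \<Phi> (weyl (2 * K + 1) (2 * K + 2)) * \<Phi>\<^sub>2 (Q *\<^sub>F ?y)"
    using exchange_weyl_left[of "2 * K"] by (simp add: numeral_eq_Suc)
  also have "\<dots> * \<Phi>\<^sub>2 (inverse Q *\<^sub>F ?y) * ?P = \<Phi> (inverse Q *\<^sub>F weyl 1 1) * \<Phi>\<^sub>2 (inverse Q *\<^sub>F ?z) *
      (\<Phi> (weyl (2 * K + 1) (2 * K + 2)) * (\<Phi> ?y * ?P))"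
    unfolding fission[OF y_nth_0] by (simp only: mult.assoc)
  also have "\<Phi> (weyl (2 * K + 1) (2 * K + 2)) * (\<Phi> ?y * ?P) =
      prod_left (\<lambda>p. \<Phi> (weyl p (p + 1))) (2 * Suc K)"
    by simp
  finally show ?case
    by (simp add: numeral_eq_Suc)
qed simp

lemma expand_middle:
  "\<Phi> v * \<Phi> u = (\<Phi> u * \<Phi>\<^sub>2 (Q *\<^sub>F weyl 2 1) * \<Phi> (Q *\<^sub>F weyl 1 1)) *
     (\<Phi>\<^sub>2 (Q *\<^sub>F v) * \<Phi>\<^sub>2 (inverse Q *\<^sub>F weyl 2 1)) * (\<Phi> (inverse Q *\<^sub>F weyl 1 1) * \<Phi>\<^sub>2 (inverse Q *\<^sub>F v))"
proof -
  have exchange: "\<Phi>\<^sub>2 (c *\<^sub>F v) * \<Phi> u = \<Phi> u * \<Phi>\<^sub>2 (c *\<^sub>F weyl 2 1) * \<Phi> (c *\<^sub>F weyl 1 1) * \<Phi>\<^sub>2 (c *\<^sub>F v)"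
    for c
    using quantum_plane.exchange_left[OF quantum_plane_weyl[of 1 1 0 0 1 1 c]]
    by (simp add: weyl_monomial_weyl[of 1 1 0 0 1 1 c, simplified])
  have "\<Phi> v * \<Phi> u = \<Phi>\<^sub>2 (Q *\<^sub>F v) * (\<Phi>\<^sub>2 (inverse Q *\<^sub>F v) * \<Phi> u)"
    unfolding fission[OF v_nth_0] by (simp only: mult.assoc)
  also have "\<dots> = (\<Phi>\<^sub>2 (Q *\<^sub>F v) * \<Phi> u) *
      (\<Phi>\<^sub>2 (inverse Q *\<^sub>F weyl 2 1) * (\<Phi> (inverse Q *\<^sub>F weyl 1 1) * \<Phi>\<^sub>2 (inverse Q *\<^sub>F v)))"
    unfolding exchange[of "inverse Q"] by (simp only: mult.assoc)
  finally show ?thesis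
    unfolding exchange[of Q] by (simp only: mult.assoc)
qed

end

context char_0_algebra
begin

definition kronecker_prod :: "'k \<Rightarrow> 'a fps \<Rightarrow> 'a fps \<Rightarrow> nat \<Rightarrow> nat \<Rightarrow> 'a fps" where
  "kronecker_prod Q u v K N =
     prod_right (\<lambda>p. quantum_dilog Q (weyl_monomial Q u v (p + 1) p)) K *
     central_prod Q (weyl_monomial Q u v 1 1) N *
     prod_left (\<lambda>p. quantum_dilog Q (weyl_monomial Q u v p (p + 1))) K"

end

context quantum_plane
begin

lemma fps_cong_dilog_weyl_1: "l \<le> i + j \<Longrightarrow> fps_cong l (quantum_dilog R (c *\<^sub>F weyl i j)) 1"
  by (intro quantum_dilog_cong_1 fps_cong_scale_0 fps_cong_mono[OF fps_cong_weyl_0])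

lemma kronecker_prod_0_cong:
  assumes u_cong_0: "fps_cong l u 0" and l_le_K: "l \<le> K"
  shows "fps_cong l (\<Phi> v * \<Phi> u) (kronecker_prod Q u v K 0)"
proof (cases K)
  case (Suc K')
  have "fps_cong l (weyl i j) 0" if "i > 0" for i j
    using fps_cong_weyl_monomial_0[OF u_cong_0, of 0 v i j Q] that by (auto intro: fps_cong_mono)
  then have dilog: "fps_cong l (\<Phi> (weyl i j)) 1" if "i > 0" for i j
    using that by (intro quantum_dilog_cong_1)
  have "fps_cong l (prod_right (\<lambda>p. \<Phi> (weyl (p + 1) p)) (0 + K))
      (prod_right (\<lambda>p. \<Phi> (weyl (p + 1) p)) 0)"
    by (intro fps_cong_prod_right_add dilog) simp
  moreover have "fps_cong l (prod_left (\<lambda>p. \<Phi> (weyl p (p + 1))) (1 + K'))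
      (prod_left (\<lambda>p. \<Phi> (weyl p (p + 1))) 1)"
    by (intro fps_cong_prod_left_add dilog) simp
  ultimately have "fps_cong l (kronecker_prod Q u v K 0) (1 * 1 * \<Phi> v)"
    unfolding kronecker_prod_def Suc by (intro fps_cong_mult) (simp_all add: central_prod_def)
  moreover have "fps_cong l (\<Phi> v * \<Phi> u) (\<Phi> v * 1)"
    by (intro fps_cong_mult quantum_dilog_cong_1 u_cong_0) simp
  ultimately show ?thesis
    by (auto intro: fps_cong_trans fps_cong_sym)
qed (use l_le_K in simp)

lemma kronecker_prod_double:
  "kronecker_prod (Q ^ 2) (inverse Q *\<^sub>F weyl 2 1) (Q *\<^sub>F v) K N =
     prod_right (\<lambda>p. \<Phi>\<^sub>2 (inverse Q *\<^sub>F weyl (2 * p + 2) (2 * p + 1))) K *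
     central_prod (Q ^ 2) (weyl 1 1 ^ 2) N *
     prod_left (\<lambda>p. \<Phi>\<^sub>2 (Q *\<^sub>F weyl (2 * p) (2 * p + 1))) K"
proof -
  have weyl_double: "weyl_monomial (Q ^ 2) (inverse Q *\<^sub>F weyl 2 1) (Q *\<^sub>F v) i j =
      (inverse Q ^ i * Q ^ j) *\<^sub>F weyl (2 * i) (i + j)" for i j
    using weyl_monomial_weyl[of 1 2 0 1 2 "inverse Q" Q i j] by (simp add: mult.commute)
  have scalars: "inverse Q ^ (p + 1) * Q ^ p = inverse Q" "inverse Q ^ p * Q ^ (p + 1) = Q" for p
    using generic by (simp_all add: power_inverse field_simps)
  have exponents: "2 * (p + 1) = 2 * p + 2" "p + 1 + p = 2 * p + 1" "p + (p + 1) = 2 * p + 1"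
    for p :: nat
    by simp_all
  have "weyl_monomial (Q ^ 2) (inverse Q *\<^sub>F weyl 2 1) (Q *\<^sub>F v) (p + 1) p =
      inverse Q *\<^sub>F weyl (2 * p + 2) (2 * p + 1)"
    "weyl_monomial (Q ^ 2) (inverse Q *\<^sub>F weyl 2 1) (Q *\<^sub>F v) p (p + 1) =
      Q *\<^sub>F weyl (2 * p) (2 * p + 1)" for p
    unfolding weyl_double scalars exponents by (rule refl)+
  moreover have "weyl_monomial (Q ^ 2) (inverse Q *\<^sub>F weyl 2 1) (Q *\<^sub>F v) 1 1 = weyl 1 1 ^ 2"
    using generic unfolding weyl_double weyl_power by (simp add: numeral_2_eq_2)
  ultimately show ?thesis
    by (simp only: kronecker_prod_def)
qed

lemma kronecker_prod_Suc_cong: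
  assumes l_le_K: "l \<le> K" and double: "fps_cong l (\<Phi>\<^sub>2 (Q *\<^sub>F v) * \<Phi>\<^sub>2 (inverse Q *\<^sub>F weyl 2 1))
      (kronecker_prod (Q ^ 2) (inverse Q *\<^sub>F weyl 2 1) (Q *\<^sub>F v) K N)"
  shows "fps_cong l (\<Phi> v * \<Phi> u) (kronecker_prod Q u v K (Suc N))"
proof -
  let ?w = "weyl 1 1"
  let ?A = "prod_right (\<lambda>p. \<Phi>\<^sub>2 (inverse Q *\<^sub>F weyl (2 * p + 2) (2 * p + 1))) K"
  let ?C = "prod_left (\<lambda>p. \<Phi>\<^sub>2 (Q *\<^sub>F weyl (2 * p) (2 * p + 1))) K"
  let ?R = "prod_right (\<lambda>p. \<Phi> (weyl (p + 1) p))" and ?L = "prod_left (\<lambda>p. \<Phi> (weyl p (p + 1)))"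
  have truncate_right: "fps_cong l (?R (K + n)) (?R K)"
    and truncate_left: "fps_cong l (?L (K + n)) (?L K)" for n
    using fps_cong_dilog_weyl_1[where c = 1] l_le_K
    by (intro fps_cong_prod_right_add fps_cong_prod_left_add; simp)+
  have "fps_cong l (\<Phi> v * \<Phi> u) ((\<Phi> u * \<Phi>\<^sub>2 (Q *\<^sub>F weyl 2 1) * \<Phi> (Q *\<^sub>F ?w)) *
     (?A * central_prod (Q ^ 2) (?w ^ 2) N * ?C) * (\<Phi> (inverse Q *\<^sub>F ?w) * \<Phi>\<^sub>2 (inverse Q *\<^sub>F v)))"
    unfolding expand_middle using double unfolding kronecker_prod_double
    by (rule fps_cong_mult[OF fps_cong_mult[OF fps_cong_refl] fps_cong_refl])
  also have "\<dots> = (\<Phi> u * \<Phi>\<^sub>2 (Q *\<^sub>F weyl 2 1) * \<Phi> (Q *\<^sub>F ?w) * ?A) * central_prod (Q ^ 2) (?w ^ 2) N *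
      (?C * \<Phi> (inverse Q *\<^sub>F ?w) * \<Phi>\<^sub>2 (inverse Q *\<^sub>F v))"
    by (simp only: mult.assoc)
  also have "\<dots> = ?R (K + (K + 1)) * \<Phi>\<^sub>2 (Q *\<^sub>F weyl (2 * K + 2) (2 * K + 1)) *
      (\<Phi> (Q *\<^sub>F ?w) * central_prod (Q ^ 2) (?w ^ 2) N * \<Phi> (inverse Q *\<^sub>F ?w)) *
      (\<Phi>\<^sub>2 (inverse Q *\<^sub>F weyl (2 * K) (2 * K + 1)) * ?L (K + K))"
    unfolding shuffle_right shuffle_left by (simp only: mult.assoc mult_2 add.assoc)
  also have "fps_cong l \<dots> (?R K * 1 *
      (\<Phi> (Q *\<^sub>F ?w) * central_prod (Q ^ 2) (?w ^ 2) N * \<Phi> (inverse Q *\<^sub>F ?w)) * (1 * ?L K))"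
    using l_le_K by (intro fps_cong_mult truncate_right truncate_left fps_cong_dilog_weyl_1) auto
  also have "\<dots> = kronecker_prod Q u v K (Suc N)"
    using central_prod_Suc[of ?w Q N] by (simp add: kronecker_prod_def weyl_nth_0)
  finally show ?thesis .
qed

end

theorem (in char_0_algebra) kronecker_factorization_cong:
  assumes "quantum_plane scale Q u v" "fps_cong m u 0" "l \<le> m + N" "l \<le> K"
  shows "fps_cong l (quantum_dilog Q v * quantum_dilog Q u) (kronecker_prod Q u v K N)"
  using assms
proof (induction N arbitrary: Q u v m)
  case 0
  then interpret quantum_plane scale Q u v by simp
  show ?case
    using 0 by (intro kronecker_prod_0_cong) (auto intro: fps_cong_mono)
next
  case (Suc N)
  interpret quantum_plane scale Q u v by fact
  have plane: "quantum_plane scale (Q ^ 2) (inverse Q *\<^sub>F weyl 2 1) (Q *\<^sub>F v)"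
    using quantum_plane_weyl[of 1 2 0 1 2 "inverse Q" Q] by simp
  have "fps_cong (m * 2 + 1 * 1) (weyl 2 1) 0"
    using Suc.prems v_nth_0 by (intro fps_cong_weyl_monomial_0) simp_all
  then have "fps_cong (Suc m) (inverse Q *\<^sub>F weyl 2 1) 0"
    by (intro fps_cong_scale_0) (erule fps_cong_mono, linarith)
  moreover have "l \<le> Suc m + N"
    using \<open>l \<le> m + Suc N\<close> by linarith
  ultimately show ?case
    using \<open>l \<le> K\<close> by (intro kronecker_prod_Suc_cong Suc.IH[OF plane])
qed

section \<open>The quantum torus\<close>

text \<open>
  The quantum torus is realised by operators on functions on the lattice, because a type for it
  cannot depend on the bilinear form.
\<close>

typedef (overloaded) ('i, 'k) linop = "{F :: ('i \<Rightarrow> 'k::comm_ring_1) \<Rightarrow> 'i \<Rightarrow> 'k.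
    (\<forall>f g. F (\<lambda>i. f i + g i) = (\<lambda>i. F f i + F g i)) \<and> (\<forall>c f. F (\<lambda>i. c * f i) = (\<lambda>i. c * F f i))}"
  by (rule exI[of _ "\<lambda>_ _. 0"]) auto

setup_lifting type_definition_linop

instantiation linop :: (type, comm_ring_1) ring_1
begin

lift_definition zero_linop :: "('a, 'b) linop" is "\<lambda>_ _. 0" by auto
lift_definition one_linop :: "('a, 'b) linop" is "\<lambda>f. f" by auto
lift_definition plus_linop :: "('a, 'b) linop \<Rightarrow> ('a, 'b) linop \<Rightarrow> ('a, 'b) linop" is
  "\<lambda>F G f i. F f i + G f i"
  by (auto simp: algebra_simps)
lift_definition minus_linop :: "('a, 'b) linop \<Rightarrow> ('a, 'b) linop \<Rightarrow> ('a, 'b) linop" is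
  "\<lambda>F G f i. F f i - G f i"
  by (auto simp: algebra_simps)
lift_definition uminus_linop :: "('a, 'b) linop \<Rightarrow> ('a, 'b) linop" is "\<lambda>F f i. - F f i"
  by (auto simp: algebra_simps)
lift_definition times_linop :: "('a, 'b) linop \<Rightarrow> ('a, 'b) linop \<Rightarrow> ('a, 'b) linop" is
  "\<lambda>F G f. F (G f)"
  by auto

instance
proof
  show "(0 :: ('a, 'b) linop) \<noteq> 1"
    by transfer (metis zero_neq_one)
qed (transfer; auto simp: algebra_simps)+

end

lift_definition scale_linop :: "'k::comm_ring_1 \<Rightarrow> ('i, 'k) linop \<Rightarrow> ('i, 'k) linop" is
  "\<lambda>c F f i. c * F f i"
  by (auto simp: algebra_simps)

lemma unital_algebra_linop: "unital_algebra scale_linop"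
  by unfold_locales (transfer; auto simp: algebra_simps)+

locale quantum_torus =
  fixes form :: "'g::ab_group_add \<Rightarrow> 'g \<Rightarrow> int" and q :: "'k::field_char_0"
  assumes form_add_left: "form (m + m') n = form m n + form m' n"
    and form_add_right: "form m (n + n') = form m n + form m n'"
    and q_nonzero [simp]: "q \<noteq> 0"
begin

sublocale char_0_algebra "scale_linop :: 'k \<Rightarrow> ('g, 'k) linop \<Rightarrow> ('g, 'k) linop"
  by (rule char_0_algebra.intro) (rule unital_algebra_linop)

notation scale_linop (infixr "*\<^sub>K" 73)

abbreviation scale_linop_fps :: "'k \<Rightarrow> ('g, 'k) linop fps \<Rightarrow> ('g, 'k) linop fps"
    (infixr "*\<^sub>F" 73) where
  "c *\<^sub>F f \<equiv> fps_scale scale_linop c f"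

lemma form_zero_left [simp]: "form 0 n = 0"
  using form_add_left[of 0 0 n] by simp

lemma form_zero_right [simp]: "form m 0 = 0"
  using form_add_right[of m 0 0] by simp

lift_definition torus :: "'g \<Rightarrow> ('g, 'k) linop" is "\<lambda>n f m. q powi form n (m - n) * f (m - n)"
  by (auto simp: algebra_simps)

lemma torus_zero: "torus 0 = 1"
  by transfer (simp add: fun_eq_iff)

lemma torus_mult: "torus n * torus k = q powi form n k *\<^sub>K torus (n + k)"
proof (transfer, intro ext)
  fix n k f m
  have "form n (m - n) + form k (m - n - k) = form n k + form (n + k) (m - (n + k))"
    using form_add_right[of n "m - n - k" k] by (simp add: form_add_left algebra_simps)
  then have "q powi form n (m - n) * q powi form k (m - n - k) =
      q powi form n k * q powi form (n + k) (m - (n + k))"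
    by (simp flip: power_int_add)
  then show "q powi form n (m - n) * (q powi form k (m - n - k) * f (m - n - k)) =
      q powi form n k * (q powi form (n + k) (m - (n + k)) * f (m - (n + k)))"
    by (simp add: diff_diff_eq flip: mult.assoc)
qed

lemma sum_torus_eq_iff:
  assumes "finite A"
  shows "(\<Sum>n\<in>A. x n *\<^sub>K torus n) = (\<Sum>n\<in>A. y n *\<^sub>K torus n) \<longleftrightarrow> (\<forall>n\<in>A. x n = y n)"
proof -
  define coeff where "coeff F n = Rep_linop F (\<lambda>m. if m = 0 then 1 else 0) n"
    for F :: "('g, 'k) linop" and n
  have coeff: "coeff (\<Sum>n\<in>A. x n *\<^sub>K torus n) k = x k" if "k \<in> A" for x :: "'g \<Rightarrow> 'k" and k
  proof -
    have coeff_sum: "coeff (\<Sum>n\<in>S. F n) k = (\<Sum>n\<in>S. coeff (F n) k)"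
      for S and F :: "'g \<Rightarrow> ('g, 'k) linop"
      by (induction S rule: infinite_finite_induct)
        (simp_all add: coeff_def zero_linop.rep_eq plus_linop.rep_eq)
    have "coeff (x n *\<^sub>K torus n) k = (if k = n then x n else 0)" for n
      by (simp add: coeff_def scale_linop.rep_eq torus.rep_eq)
    then show ?thesis
      using assms that by (simp add: coeff_sum)
  qed
  show ?thesis
    using coeff by (metis (mono_tags, lifting) sum.cong)
qed

end

section \<open>Exponents and lattice points\<close>

context fixed_data
begin

lemma delta0_pos: "delta0 d > 0"
proof -
  have "0 \<notin> range d" using d_pos by (metis less_irrefl rangeE)
  then show ?thesis unfolding delta0_def by (metis Lcm_0_iff finite finite_imageI gr0I)
qed

lemma fracs_iff: "a \<in> fracs d \<longleftrightarrow> of_nat (delta0 d) * a \<in> \<int>"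
proof
  assume "of_nat (delta0 d) * a \<in> \<int>"
  then obtain k where "of_nat (delta0 d) * a = of_int k" by (rule Ints_cases)
  then have "a = of_int k / of_nat (delta0 d)"
    using delta0_pos by (simp add: field_simps)
  then show "a \<in> fracs d"
    unfolding fracs_def by blast
qed (use delta0_pos in \<open>auto simp: fracs_def\<close>)

lemma fracs_add: "a \<in> fracs d \<Longrightarrow> b \<in> fracs d \<Longrightarrow> a + b \<in> fracs d"
  by (simp add: fracs_iff distrib_left)

lemma fracs_minus: "a \<in> fracs d \<Longrightarrow> - a \<in> fracs d"
  by (simp add: fracs_iff)

lemma fracs_of_nat_mult: "a \<in> fracs d \<Longrightarrow> of_nat j * a \<in> fracs d"
  by (simp add: fracs_iff mult.left_commute[of _ "of_nat j"])

definition qexponent :: "rat \<Rightarrow> int" where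
  "qexponent a = \<lfloor>of_nat (delta0 d) * a\<rfloor>"

lemma of_int_qexponent: "a \<in> fracs d \<Longrightarrow> of_int (qexponent a) = of_nat (delta0 d) * a"
  by (auto simp: fracs_iff qexponent_def elim: Ints_cases)

lemma qexponent_eqI: "of_int k = of_nat (delta0 d) * a \<Longrightarrow> qexponent a = k"
  unfolding qexponent_def by (metis floor_of_int)

lemma qexponent_add: "a \<in> fracs d \<Longrightarrow> b \<in> fracs d \<Longrightarrow> qexponent (a + b) = qexponent a + qexponent b"
  by (intro qexponent_eqI) (simp add: of_int_qexponent distrib_left)

lemma qexponent_minus: "a \<in> fracs d \<Longrightarrow> qexponent (- a) = - qexponent a"
  by (intro qexponent_eqI) (simp add: of_int_qexponent)

lemma qexponent_of_nat_mult: "a \<in> fracs d \<Longrightarrow> qexponent (of_nat j * a) = int j * qexponent a"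
  by (intro qexponent_eqI) (simp add: of_int_qexponent)

lemma qpow_eq: "qpow d a = tvar powi qexponent a"
  by (simp add: qpow_def qexponent_def)

lemma B_scale_left: "B (int k *s x) y = of_nat k * B x y"
proof (induction k)
  case 0
  show ?case using add_left[of 0 0 y] by simp
next
  case (Suc k)
  have "int (Suc k) *s x = x + int k *s x"
    by (simp add: vec_eq_iff algebra_simps)
  with Suc show ?case
    by (simp add: add_left algebra_simps)
qed

lemma B_in_fracs: "B x y \<in> fracs d"
proof -
  have d_dvd_delta0: "d i dvd delta0 d" for i
    by (simp add: delta0_def)
  define a where "a i = int (delta0 d div d i) * vec_nth x i" for i
  have "int (delta0 d) * vec_nth x j = (\<Sum>i\<in>UNIV. a i * int (d i) * vec_nth (axis i 1) j)" for j
  proof -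
    have "(\<Sum>i\<in>UNIV. a i * int (d i) * vec_nth (axis i 1) j) =
        (\<Sum>i\<in>UNIV. if i = j then a i * int (d i) else 0)"
      by (intro sum.cong) (auto simp: axis_def)
    also have "\<dots> = int (delta0 d) * vec_nth x j"
      using d_dvd_delta0[of j] by (simp add: a_def algebra_simps flip: of_nat_mult)
    finally show ?thesis ..
  qed
  then have "int (delta0 d) *s x = (\<Sum>i\<in>UNIV. (a i * int (d i)) *s axis i 1)"
    by (simp add: vec_eq_iff)
  then have "int (delta0 d) *s x \<in> sublattice d"
    unfolding sublattice_def by blast
  from integral[OF this] show ?thesis
    by (simp add: B_scale_left fracs_iff)
qed

definition omega :: "int ^ 'r \<Rightarrow> int ^ 'r \<Rightarrow> int" where
  "omega m n = qexponent (B m n)"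

lemma omega_skew: "omega m n = - omega n m"
  using skew[of m n] by (simp add: omega_def qexponent_minus B_in_fracs)

lemma omega_scale_left: "omega (int k *s m) n = int k * omega m n"
  by (simp add: omega_def B_scale_left qexponent_of_nat_mult B_in_fracs)

lemma omega_scale_right: "omega m (int k *s n) = int k * omega m n"
  using omega_scale_left[of k n m] omega_skew[of m n] omega_skew[of m "int k *s n"] by simp

end

lemma tvar_nonzero [simp]: "tvar \<noteq> 0"
  by (simp add: tvar_def eq_fract Zero_fract_def)

lemma tvar_power: "tvar ^ k = Fract (monom 1 k) 1"
  by (induction k) (auto simp: tvar_def One_fract_def monom_altdef one_pCons)

lemma generic_param_tvar: "generic_param tvar"
proof -
  have "tvar ^ j \<noteq> 1" if "j > 0" for j
  proof
    assume "tvar ^ j = 1"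
    then have "monom (1::rat) j = 1"
      by (simp add: tvar_power One_fract_def eq_fract)
    with that show False
      using degree_monom_eq[of "1::rat" j] by simp
  qed
  then show ?thesis
    by (simp add: generic_param_def)
qed

sublocale fixed_data \<subseteq> quantum_torus omega tvar
  by unfold_locales (simp_all add: omega_def add_left add_right qexponent_add B_in_fracs)

context fixed_data
begin

lemma generic_param_qpow:
  assumes "a \<in> fracs d" "a > 0"
  shows "generic_param (qpow d a)"
proof -
  have "(of_int (qexponent a) :: rat) > 0"
    unfolding of_int_qexponent[OF assms(1)] using assms(2) delta0_pos by simp
  then have pos: "qexponent a > 0" by simp
  then have "qpow d a = tvar ^ nat (qexponent a)"
    by (simp add: qpow_eq power_int_def)
  then show ?thesis
    using generic_param_power[OF generic_param_tvar, of "nat (qexponent a)"] pos by simp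
qed

lemma qpow_add: "a \<in> fracs d \<Longrightarrow> b \<in> fracs d \<Longrightarrow> qpow d (a + b) = qpow d a * qpow d b"
  by (simp add: qpow_eq qexponent_add power_int_add)

lemma qpow_minus: "a \<in> fracs d \<Longrightarrow> qpow d (- a) = inverse (qpow d a)"
  by (simp add: qpow_eq qexponent_minus power_int_minus)

lemma qpow_of_nat_mult: "a \<in> fracs d \<Longrightarrow> qpow d (of_nat j * a) = qpow d a ^ j"
  by (simp add: qpow_eq qexponent_of_nat_mult power_int_mult mult.commute[of "int j"])

definition qdiff :: ratfun where
  "qdiff = qpow d 1 - qpow d (- 1)"

lemma qdiff_nonzero [simp]: "qdiff \<noteq> 0"
proof -
  have one_fracs: "1 \<in> fracs d" by (simp add: fracs_iff)
  then have "generic_param (qpow d 1)"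
    by (rule generic_param_qpow) simp
  from generic_param_diff_nonzero[OF this, of 1] show ?thesis
    by (simp add: qdiff_def qpow_minus one_fracs)
qed

lemma qnum_eq: "a \<in> fracs d \<Longrightarrow> qnum d a = (qpow d a - inverse (qpow d a)) / qdiff"
  by (simp add: qnum_def qdiff_def qpow_minus)

end

definition Nnonneg :: "(int ^ 'r::finite) set" where
  "Nnonneg = {n. \<forall>i. 0 \<le> vec_nth n i}"

lemma Nnonneg_add: "m \<in> Nnonneg \<Longrightarrow> n \<in> Nnonneg \<Longrightarrow> m + n \<in> Nnonneg"
  by (simp add: Nnonneg_def)

lemma Nnonneg_scale: "n \<in> Nnonneg \<Longrightarrow> int k *s n \<in> Nnonneg"
  by (simp add: Nnonneg_def)

lemma deg_add_Nnonneg: "m \<in> Nnonneg \<Longrightarrow> n \<in> Nnonneg \<Longrightarrow> deg (m + n) = deg m + deg n"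
  by (simp add: Nnonneg_def deg_def sum.distrib nat_add_distrib sum_nonneg)

lemma deg_0 [simp]: "deg 0 = 0"
  by (simp add: deg_def)

lemma deg_scale: "deg (int k *s n) = k * deg n"
  by (simp add: deg_def nat_mult_distrib flip: sum_distrib_left)

lemma Nplus_iff: "n \<in> Nplus \<longleftrightarrow> n \<in> Nnonneg \<and> deg n > 0"
  by (simp add: Nplus_def Nnonneg_def deg_def)

lemma Nplus_scale: "n \<in> Nplus \<Longrightarrow> k > 0 \<Longrightarrow> int k *s n \<in> Nplus"
  by (simp add: Nplus_iff Nnonneg_scale deg_scale)

lemma Nplus_combination:
  "n \<in> Nplus \<Longrightarrow> n' \<in> Nplus \<Longrightarrow> i + j > 0 \<Longrightarrow> int i *s n + int j *s n' \<in> Nplus"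
  by (auto simp: Nplus_iff Nnonneg_add Nnonneg_scale deg_add_Nnonneg deg_scale)

definition level :: "nat \<Rightarrow> (int ^ 'r::finite) set" where
  "level k = {n \<in> Nplus. deg n = k}"

lemma level_0 [simp]: "level 0 = {}"
  by (auto simp: level_def Nplus_iff)

lemma finite_level [simp]: "finite (level k)"
proof (rule finite_subset)
  let ?A = "vec_lambda ` (\<Pi>\<^sub>E i\<in>UNIV. {0..int k})"
  show "level k \<subseteq> ?A"
  proof
    fix n :: "int ^ 'r" assume n_level: "n \<in> level k"
    have "vec_nth n i \<le> (\<Sum>i\<in>UNIV. vec_nth n i)" for i
      using n_level by (intro member_le_sum) (auto simp: level_def Nplus_def)
    with n_level have "vec_nth n i \<in> {0..int k}" for i
      by (auto simp: level_def Nplus_def deg_def)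
    then show "n \<in> ?A"
      by (intro image_eqI[of _ _ "vec_nth n"]) auto
  qed
  show "finite ?A"
    by (intro finite_imageI finite_PiE) auto
qed

section \<open>The group as a group of power series over the quantum torus\<close>

context fixed_data
begin

definition torus_fps :: "'r series \<Rightarrow> (int ^ 'r, ratfun) linop fps" where
  "torus_fps x = Abs_fps (\<lambda>k. \<Sum>n\<in>level k. (x n / qdiff) *\<^sub>K torus n)"

lemma torus_fps_nth: "torus_fps x $ k = (\<Sum>n\<in>level k. (x n / qdiff) *\<^sub>K torus n)"
  by (simp add: torus_fps_def)

lemma torus_fps_nth_0 [simp]: "torus_fps x $ 0 = 0"
  by (simp add: torus_fps_nth)

lemma torus_fps_zero [simp]: "torus_fps (\<lambda>_. 0) = 0"
  by (simp add: fps_eq_iff torus_fps_nth)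

lemma torus_fps_uminus: "torus_fps (\<lambda>n. - x n) = - torus_fps x"
  by (simp add: fps_eq_iff torus_fps_nth sum_negf)

lemma fps_cong_torus_fps_iff:
  "fps_cong m (torus_fps x) (torus_fps y) \<longleftrightarrow> (\<forall>n\<in>Nplus. deg n < m \<longrightarrow> x n = y n)"
  unfolding fps_cong_def torus_fps_nth sum_torus_eq_iff[OF finite_level] by (auto simp: level_def)

lemma torus_fps_mult_nth:
  "(torus_fps x * torus_fps y) $ k =
    (\<Sum>(m, m')\<in>{(m, m'). m \<in> Nplus \<and> m' \<in> Nplus \<and> deg m + deg m' = k}.
     (x m * y m' / (qdiff * qdiff)) *\<^sub>K (torus m * torus m'))"
proof -
  let ?f = "\<lambda>(m, m'). (x m * y m' / (qdiff * qdiff)) *\<^sub>K (torus m * torus m')"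
  have "(torus_fps x * torus_fps y) $ k = (\<Sum>i\<le>k. \<Sum>p\<in>level i \<times> level (k - i). ?f p)"
    by (simp add: fps_mult_nth torus_fps_nth sum_product scale_mult sum.cartesian_product
        atLeast0AtMost case_prod_beta mult.commute[of "y _"])
  also have "\<dots> = sum ?f (\<Union>i\<le>k. level i \<times> level (k - i))"
    by (rule sum.UNION_disjoint[symmetric])
      (auto simp: level_def[abs_def] intro: finite_level[unfolded level_def])
  also have "(\<Union>i\<le>k. level i \<times> level (k - i)) =
      {(m, m'). m \<in> Nplus \<and> m' \<in> Nplus \<and> deg m + deg m' = k}"
    by (auto simp: level_def)
  finally show ?thesis .
qed

lemma torus_commutator:
  "torus m * torus m' - torus m' * torus m = (qdiff * qnum d (B m m')) *\<^sub>K torus (m + m')"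
proof -
  have "qdiff * qnum d (B m m') = tvar powi omega m m' - tvar powi omega m' m"
    using omega_skew[of m' m] by (simp add: qnum_eq B_in_fracs qpow_eq omega_def power_int_minus)
  then show ?thesis
    by (simp add: torus_mult add.commute scale_left_diff_distrib)
qed

lemma torus_fps_lie: "torus_fps (lie B d x y) = ad (torus_fps x) (torus_fps y)"
proof (rule fps_ext)
  fix k
  let ?P = "{(m, m'). m \<in> Nplus \<and> m' \<in> Nplus \<and> deg m + deg m' = k} :: ((int ^ 'r) \<times> (int ^ 'r)) set"
  let ?Q = "\<lambda>n. {(m, m'). m \<in> Nplus \<and> m' \<in> Nplus \<and> m + m' = (n :: int ^ 'r)}"
  let ?c = "\<lambda>m m'. x m * y m' / (qdiff * qdiff)"
  have "torus_fps (lie B d x y) $ k =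
      (\<Sum>n\<in>level k. \<Sum>(m, m')\<in>?Q n. (x m * y m' * qnum d (B m m') / qdiff) *\<^sub>K torus (m + m'))"
    unfolding torus_fps_nth lie_def sum_divide_distrib scale_sum_left
    by (intro sum.cong) auto
  also have "\<dots> = (\<Sum>(m, m')\<in>(\<Union>n\<in>level k. ?Q n). (x m * y m' * qnum d (B m m') / qdiff) *\<^sub>K
      torus (m + m'))"
    by (rule sum.UNION_disjoint[symmetric]) (use finite_lie_index in auto)
  also have "(\<Union>n\<in>level k. ?Q n) = ?P"
    by (auto simp: level_def deg_add Nplus_add)
  also have "(\<Sum>(m, m')\<in>?P. (x m * y m' * qnum d (B m m') / qdiff) *\<^sub>K torus (m + m')) =
      (\<Sum>(m, m')\<in>?P. ?c m m' *\<^sub>K (torus m * torus m' - torus m' * torus m))"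
    by (simp add: torus_commutator mult_ac)
  also have "\<dots> = (\<Sum>(m, m')\<in>?P. ?c m m' *\<^sub>K (torus m * torus m')) -
      (\<Sum>(m, m')\<in>?P. ?c m m' *\<^sub>K (torus m' * torus m))"
    by (simp add: scale_right_diff_distrib sum_subtractf case_prod_beta)
  also have "(\<Sum>(m, m')\<in>?P. ?c m m' *\<^sub>K (torus m' * torus m)) = (torus_fps y * torus_fps x) $ k"
    unfolding torus_fps_mult_nth
    by (rule sum.reindex_bij_witness[of _ prod.swap prod.swap]) (auto simp: mult.commute)
  finally show "torus_fps (lie B d x y) $ k = ad (torus_fps x) (torus_fps y) $ k"
    by (simp add: ad_def torus_fps_mult_nth)
qed

lemma torus_fps_nested: "torus_fps (nested B d ws) = right_nested (map torus_fps ws)"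
  by (induction ws rule: induct_list012) (auto simp: torus_fps_lie)

lemma torus_fps_bch: "torus_fps (bch B d x y) = bch_series (torus_fps x) (torus_fps y)"
proof (rule fps_ext)
  fix k
  let ?c = "\<lambda>ps n. dynkin_coeff ps *\<^sub>K (nested B d (dynkin_word x y ps) n / qdiff) *\<^sub>K torus n"
  have coeff: "dynkin_coeff = bch_coeff"
    by (simp add: fun_eq_iff dynkin_coeff_def bch_coeff_def)
  have "torus_fps (bch B d x y) $ k = (\<Sum>n\<in>level k. \<Sum>m = 1..k. \<Sum>ps\<in>dynkin_index m. ?c ps n)"
    unfolding torus_fps_nth bch_def sum_divide_distrib scale_sum_left
    by (intro sum.cong) (auto simp: level_def)
  also have "\<dots> = (\<Sum>m = 1..k. \<Sum>ps\<in>dynkin_index m. \<Sum>n\<in>level k. ?c ps n)"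
    by (subst sum.swap) (intro sum.cong sum.swap refl)
  also have "\<dots> = bch_series (torus_fps x) (torus_fps y) $ k"
    by (simp add: bch_series_nth coeff torus_fps_nth scale_sum_right flip: map_dynkin_word
        torus_fps_nested)
  finally show "torus_fps (bch B d x y) $ k = bch_series (torus_fps x) (torus_fps y) $ k" .
qed

definition torus_exp :: "'r series \<Rightarrow> (int ^ 'r, ratfun) linop fps" where
  "torus_exp x = nc_exp (torus_fps x)"

lemma torus_exp_bch: "torus_exp (bch B d x y) = torus_exp x * torus_exp y"
  by (simp add: torus_exp_def torus_fps_bch nc_exp_bch_series)

lemma torus_exp_zero [simp]: "torus_exp (\<lambda>_. 0) = 1"
  by (simp add: torus_exp_def)

lemma fps_cong_torus_exp_iff:
  "fps_cong m (torus_exp x) (torus_exp y) \<longleftrightarrow> (\<forall>n\<in>Nplus. deg n < m \<longrightarrow> x n = y n)"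
  by (simp add: torus_exp_def fps_cong_nc_exp_iff fps_cong_torus_fps_iff)

lemma torus_exp_inj:
  assumes "torus_exp x = torus_exp y" "x \<in> ghat" "y \<in> ghat"
  shows "x = y"
proof
  fix n
  show "x n = y n"
    using fps_cong_torus_exp_iff[of "Suc (deg n)" x y] assms
    by (cases "n \<in> Nplus") (auto simp: ghat_def)
qed

lemma nested_in_ghat: "ws \<noteq> [] \<Longrightarrow> set ws \<subseteq> ghat \<Longrightarrow> nested B d ws \<in> ghat"
  by (induction ws rule: induct_list012) (auto simp: lie_in_ghat)

lemma bch_in_ghat:
  assumes "x \<in> ghat" "y \<in> ghat"
  shows "bch B d x y \<in> ghat"
proof -
  have "nested B d (dynkin_word x y ps) \<in> ghat" if "ps \<in> dynkin_index m" for ps m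
    using dynkin_word_not_Nil[OF that, of x y] set_dynkin_word[of x y ps] assms
    by (intro nested_in_ghat) auto
  then show ?thesis
    unfolding ghat_def bch_def by (auto intro!: sum.neutral)
qed

lemma group_qgroup: "group (qgroup B d)"
proof (rule groupI)
  fix x assume x_carrier: "x \<in> carrier (qgroup B d)"
  let ?y = "\<lambda>n. - x n"
  have uminus_in_ghat: "?y \<in> ghat" using x_carrier by (simp add: qgroup_def ghat_def)
  have "torus_exp ?y * torus_exp x = 1"
    using nc_exp_mult_uminus[of "torus_fps ?y"] by (simp add: torus_exp_def torus_fps_uminus)
  then have "bch B d ?y x = (\<lambda>_. 0)"
    using x_carrier uminus_in_ghat
    by (intro torus_exp_inj bch_in_ghat) (auto simp: torus_exp_bch qgroup_def ghat_def)
  with uminus_in_ghat show "\<exists>y\<in>carrier (qgroup B d). y \<otimes>\<^bsub>qgroup B d\<^esub> x = \<one>\<^bsub>qgroup B d\<^esub>"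
    by (auto simp: qgroup_def)
next
  fix x y z
  assume "x \<in> carrier (qgroup B d)" "y \<in> carrier (qgroup B d)" "z \<in> carrier (qgroup B d)"
  then show "x \<otimes>\<^bsub>qgroup B d\<^esub> y \<otimes>\<^bsub>qgroup B d\<^esub> z = x \<otimes>\<^bsub>qgroup B d\<^esub> (y \<otimes>\<^bsub>qgroup B d\<^esub> z)"
    by (auto simp: qgroup_def torus_exp_bch mult.assoc intro!: torus_exp_inj bch_in_ghat)
next
  fix x assume "x \<in> carrier (qgroup B d)"
  then have "bch B d (\<lambda>_. 0) x = x"
    by (intro torus_exp_inj bch_in_ghat) (auto simp: qgroup_def torus_exp_bch ghat_def)
  then show "\<one>\<^bsub>qgroup B d\<^esub> \<otimes>\<^bsub>qgroup B d\<^esub> x = x"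
    by (simp add: qgroup_def)
qed (auto simp: qgroup_def bch_in_ghat, simp add: ghat_def)

sublocale G: group "qgroup B d"
  by (rule group_qgroup)

lemma carrier_qgroup [simp]: "carrier (qgroup B d) = ghat"
  by (simp add: qgroup_def)

lemma mult_in_ghat: "x \<in> ghat \<Longrightarrow> y \<in> ghat \<Longrightarrow> x \<otimes>\<^bsub>qgroup B d\<^esub> y \<in> ghat"
  using G.m_closed by simp

lemma inv_in_ghat: "x \<in> ghat \<Longrightarrow> inv\<^bsub>qgroup B d\<^esub> x \<in> ghat"
  using G.inv_closed by simp

lemma torus_exp_mult: "torus_exp (x \<otimes>\<^bsub>qgroup B d\<^esub> y) = torus_exp x * torus_exp y"
  by (simp add: qgroup_def torus_exp_bch)

lemma torus_exp_one: "torus_exp \<one>\<^bsub>qgroup B d\<^esub> = 1"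
  by (simp add: qgroup_def)

lemma torus_exp_mult_inv: "x \<in> ghat \<Longrightarrow> torus_exp x * torus_exp (inv\<^bsub>qgroup B d\<^esub> x) = 1"
  by (simp add: torus_exp_one flip: torus_exp_mult)

lemma qgroup_gt_iff: "x \<in> qgroup_gt l \<longleftrightarrow> x \<in> ghat \<and> fps_cong (Suc l) (torus_exp x) 1"
proof -
  have "fps_cong (Suc l) (torus_exp x) 1 \<longleftrightarrow> (\<forall>n\<in>Nplus. deg n \<le> l \<longrightarrow> x n = 0)"
    using fps_cong_torus_exp_iff[of "Suc l" x "\<lambda>_. 0"] by (simp add: less_Suc_eq_le)
  then show ?thesis
    by (auto simp: qgroup_gt_def ghat_def not_less[symmetric])
qed

lemma subgroup_qgroup_gt: "subgroup (qgroup_gt l) (qgroup B d)"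
proof (rule G.subgroupI)
  show "(qgroup_gt l :: 'r series set) \<noteq> {}"
    using G.one_closed qgroup_gt_iff[of "\<one>\<^bsub>qgroup B d\<^esub>" l] by (auto simp: torus_exp_one)
next
  fix x :: "'r series" assume x_gt: "x \<in> qgroup_gt l"
  then have "fps_cong (Suc l) (torus_exp x * torus_exp (inv\<^bsub>qgroup B d\<^esub> x))
      (1 * torus_exp (inv\<^bsub>qgroup B d\<^esub> x))"
    by (intro fps_cong_mult) (auto simp: qgroup_gt_iff)
  with x_gt show "inv\<^bsub>qgroup B d\<^esub> x \<in> qgroup_gt l"
    by (auto simp: qgroup_gt_iff inv_in_ghat torus_exp_mult_inv intro: fps_cong_sym)
next
  fix x y :: "'r series" assume xy_gt: "x \<in> qgroup_gt l" "y \<in> qgroup_gt l"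
  then have "fps_cong (Suc l) (torus_exp x * torus_exp y) (1 * 1)"
    by (intro fps_cong_mult) (auto simp: qgroup_gt_iff)
  with xy_gt show "x \<otimes>\<^bsub>qgroup B d\<^esub> y \<in> qgroup_gt l"
    by (auto simp: qgroup_gt_iff torus_exp_mult mult_in_ghat)
qed (auto simp: qgroup_gt_iff)

lemma qgroup_gt_coset_eqI:
  assumes "x \<in> ghat" "y \<in> ghat" "fps_cong (Suc l) (torus_exp x) (torus_exp y)"
  shows "qgroup_gt l #>\<^bsub>qgroup B d\<^esub> x = qgroup_gt l #>\<^bsub>qgroup B d\<^esub> y"
proof -
  let ?h = "x \<otimes>\<^bsub>qgroup B d\<^esub> inv\<^bsub>qgroup B d\<^esub> y"
  have "fps_cong (Suc l) (torus_exp ?h) (torus_exp y * torus_exp (inv\<^bsub>qgroup B d\<^esub> y))"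
    unfolding torus_exp_mult by (intro fps_cong_mult assms) simp
  then have "?h \<in> qgroup_gt l"
    using assms by (simp add: qgroup_gt_iff torus_exp_mult_inv mult_in_ghat inv_in_ghat)
  moreover have "x = ?h \<otimes>\<^bsub>qgroup B d\<^esub> y"
    using assms by (simp add: G.m_assoc inv_in_ghat)
  ultimately have "x \<in> qgroup_gt l #>\<^bsub>qgroup B d\<^esub> y"
    by (auto simp: r_coset_def)
  then show ?thesis
    using G.repr_independence[OF _ _ subgroup_qgroup_gt] assms by simp
qed

lemma has_limit_exists:
  assumes s_in_ghat: "\<And>k. s k \<in> ghat"
    and Cauchy: "\<And>k. fps_cong k (torus_exp (s (Suc k))) (torus_exp (s k))"
  obtains g where "g \<in> ghat" "has_limit B d s g" "\<And>k. fps_cong k (torus_exp (s k)) (torus_exp g)"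
proof -
  define g where "g n = s (Suc (deg n)) n" for n
  have g_in_ghat: "g \<in> ghat"
    using s_in_ghat by (auto simp: ghat_def g_def)
  have mono: "fps_cong m (torus_exp (s k)) (torus_exp (s m))" if "m \<le> k" for m k
    using that by (induction rule: dec_induct)
      (auto intro: fps_cong_trans[OF fps_cong_mono[OF Cauchy]])
  have cong: "fps_cong k (torus_exp (s k)) (torus_exp g)" for k
    unfolding fps_cong_torus_exp_iff
  proof (intro ballI impI)
    fix n :: "int ^ 'r" assume "n \<in> Nplus" "deg n < k"
    then show "s k n = g n"
      using mono[of "Suc (deg n)" k] by (auto simp: fps_cong_torus_exp_iff g_def)
  qed
  have "qgroup_gt l #>\<^bsub>qgroup B d\<^esub> s k = qgroup_gt l #>\<^bsub>qgroup B d\<^esub> g" if "Suc l \<le> k" for l k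
    using that by (intro qgroup_gt_coset_eqI s_in_ghat g_in_ghat fps_cong_mono[OF cong])
  then have "has_limit B d s g"
    using g_in_ghat by (auto simp: has_limit_def eventually_sequentially)
  with g_in_ghat cong that show ?thesis by blast
qed

lemma torus_exp_list_prod: "torus_exp (list_prod (qgroup B d) xs) = prod_list (map torus_exp xs)"
  by (induction xs) (auto simp: list_prod_def torus_exp_mult torus_exp_one)

lemma list_prod_in_ghat: "set xs \<subseteq> ghat \<Longrightarrow> list_prod (qgroup B d) xs \<in> ghat"
proof (induction xs)
  case Nil
  then show ?case using G.one_closed by (simp add: list_prod_def)
next
  case (Cons x xs)
  then show ?case using mult_in_ghat[of x "list_prod (qgroup B d) xs"] by (simp add: list_prod_def)
qed

lemma has_prod_right_exists:
  assumes f_in_ghat: "\<And>p. f p \<in> ghat" and f_cong_1: "\<And>p. fps_cong p (torus_exp (f p)) 1"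
  obtains g where "g \<in> ghat" "has_prod_right B d f g"
    "\<And>k. fps_cong k (prod_right (\<lambda>p. torus_exp (f p)) k) (torus_exp g)"
proof -
  let ?s = "\<lambda>k. list_prod (qgroup B d) (map f [0..<k])"
  have torus_exp_partial_prod: "torus_exp (?s k) = prod_right (\<lambda>p. torus_exp (f p)) k" for k
    by (simp add: torus_exp_list_prod prod_right_def comp_def)
  have "fps_cong k (torus_exp (?s (Suc k))) (torus_exp (?s k))" for k
    using fps_cong_mult[OF fps_cong_refl f_cong_1, of k "torus_exp (?s k)"]
    unfolding torus_exp_partial_prod prod_right_simps by simp
  moreover have "?s k \<in> ghat" for k
    using f_in_ghat by (intro list_prod_in_ghat) auto
  ultimately obtain g where "g \<in> ghat" "has_limit B d ?s g"
    "\<And>k. fps_cong k (torus_exp (?s k)) (torus_exp g)"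
    using has_limit_exists[of ?s] by metis
  then show ?thesis
    unfolding torus_exp_partial_prod by (intro that) (simp_all add: has_prod_right_def)
qed

lemma has_prod_left_exists:
  assumes f_in_ghat: "\<And>p. f p \<in> ghat" and f_cong_1: "\<And>p. fps_cong p (torus_exp (f p)) 1"
  obtains g where "g \<in> ghat" "has_prod_left B d f g"
    "\<And>k. fps_cong k (prod_left (\<lambda>p. torus_exp (f p)) k) (torus_exp g)"
proof -
  let ?s = "\<lambda>k. list_prod (qgroup B d) (map f (rev [0..<k]))"
  have torus_exp_partial_prod: "torus_exp (?s k) = prod_left (\<lambda>p. torus_exp (f p)) k" for k
    by (simp add: torus_exp_list_prod prod_left_def comp_def rev_map)
  have "fps_cong k (torus_exp (?s (Suc k))) (torus_exp (?s k))" for k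
    using fps_cong_mult[OF f_cong_1 fps_cong_refl, of k "torus_exp (?s k)"]
    unfolding torus_exp_partial_prod prod_left_simps by simp
  moreover have "?s k \<in> ghat" for k
    using f_in_ghat by (intro list_prod_in_ghat) auto
  ultimately obtain g where "g \<in> ghat" "has_limit B d ?s g"
    "\<And>k. fps_cong k (torus_exp (?s k)) (torus_exp g)"
    using has_limit_exists[of ?s] by metis
  then show ?thesis
    unfolding torus_exp_partial_prod by (intro that) (simp_all add: has_prod_left_def)
qed

end

section \<open>Quantum dilogarithm elements of the group\<close>

context fixed_data
begin

definition torus_monomial :: "int ^ 'r \<Rightarrow> rat \<Rightarrow> (int ^ 'r, ratfun) linop fps" where
  "torus_monomial n b = fps_const (qpow d b *\<^sub>K torus n) * fps_X ^ deg n"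

lemma torus_monomial_nth: "torus_monomial n b $ k = (if k = deg n then qpow d b *\<^sub>K torus n else 0)"
  by (simp add: torus_monomial_def)

lemma torus_monomial_nth_0 [simp]: "n \<in> Nplus \<Longrightarrow> torus_monomial n b $ 0 = 0"
  by (simp add: torus_monomial_nth Nplus_iff)

lemma torus_monomial_0 [simp]: "torus_monomial 0 0 = 1"
  by (simp add: torus_monomial_def torus_zero qpow_def)

lemma torus_monomial_mult:
  assumes "m \<in> Nnonneg" "n \<in> Nnonneg" "a \<in> fracs d" "b \<in> fracs d"
  shows "torus_monomial m a * torus_monomial n b =
      tvar powi omega m n *\<^sub>F torus_monomial (m + n) (a + b)"
  using assms by (simp add: torus_monomial_def fps_monomial_mult scale_mult torus_mult qpow_add
      deg_add_Nnonneg)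
    (simp add: fps_eq_iff mult_ac)

lemma torus_monomial_power:
  assumes "n \<in> Nnonneg" "b \<in> fracs d"
  shows "torus_monomial n b ^ j = torus_monomial (int j *s n) (of_nat j * b)"
proof (induction j)
  case (Suc j)
  have "omega n (int j *s n) = 0"
    using omega_skew[of n n] by (simp add: omega_scale_right)
  moreover have "n + int j *s n = int (Suc j) *s n" "b + of_nat j * b = of_nat (Suc j) * b"
    by (simp_all add: vec_eq_iff algebra_simps)
  ultimately show ?case
    using torus_monomial_mult[of n "int j *s n" b "of_nat j * b"] assms
    by (simp add: Suc Nnonneg_scale fracs_of_nat_mult del: of_nat_Suc)
qed simp

lemma scale_torus_monomial:
  "a \<in> fracs d \<Longrightarrow> b \<in> fracs d \<Longrightarrow> qpow d a *\<^sub>F torus_monomial n b = torus_monomial n (b + a)"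
  by (simp add: fps_eq_iff torus_monomial_nth qpow_add mult.commute)

lemma qdilog_over_qdiff:
  assumes "a \<in> fracs d" "b \<in> fracs d"
  shows "qdilog d n a b m / qdiff =
    (\<Sum>j | j \<ge> 1 \<and> int j *s n = m. qdilog_log (qpow d a) $ j * qpow d b ^ j)"
proof -
  have "qnum d (of_nat j * a) = (qpow d a ^ j - inverse (qpow d a) ^ j) / qdiff" for j
    using assms by (simp only: qnum_eq fracs_of_nat_mult qpow_of_nat_mult power_inverse)
  then show ?thesis
    unfolding qdilog_def qdilog_log_def fps_nth_Abs_fps sum_divide_distrib
      qpow_of_nat_mult[OF assms(2)] by simp
qed

lemma qdilog_in_ghat:
  assumes "n \<in> Nplus"
  shows "qdilog d n a b \<in> ghat"
proof -
  have "qdilog d n a b m = 0" if "m \<notin> Nplus" for m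
  proof -
    have no_multiple: "{j. j \<ge> 1 \<and> int j *s n = m} = {}"
      using Nplus_scale[OF assms] that by auto
    show ?thesis
      unfolding qdilog_def no_multiple by simp
  qed
  then show ?thesis
    by (simp add: ghat_def)
qed

lemma torus_fps_qdilog:
  assumes n_Nplus: "n \<in> Nplus" and a_fracs: "a \<in> fracs d" and b_fracs: "b \<in> fracs d"
  shows "torus_fps (qdilog d n a b) = fps_eval (qdilog_log (qpow d a)) (torus_monomial n b)"
proof (rule fps_ext)
  fix k
  let ?L = "qdilog_log (qpow d a)" and ?S = "{j. 1 \<le> j \<and> j \<le> k \<and> k = j * deg n}"
  let ?t = "\<lambda>j. (?L $ j * qpow d b ^ j) *\<^sub>K torus (int j *s n)"
  have index: "{j \<in> ?S. int j *s n = m} = {j. j \<ge> 1 \<and> int j *s n = m}" if "m \<in> level k" for m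
    using that n_Nplus by (auto simp: level_def deg_scale Nplus_iff)
  have "torus_fps (qdilog d n a b) $ k = (\<Sum>m\<in>level k. \<Sum>j\<in>{j \<in> ?S. int j *s n = m}. ?t j)"
    unfolding torus_fps_nth qdilog_over_qdiff[OF a_fracs b_fracs] scale_sum_left
    by (intro sum.cong, simp_all only: index) auto
  also have "\<dots> = (\<Sum>j\<in>?S. ?t j)"
    using n_Nplus by (intro sum.group finite_level) (auto simp: level_def Nplus_scale deg_scale)
  also have "\<dots> = (\<Sum>j\<le>k. if k = j * deg n then ?t j else 0)"
    by (intro sum.mono_neutral_cong_left) (auto simp: Suc_le_eq)
  also have "\<dots> = fps_eval ?L (torus_monomial n b) $ k"
    using n_Nplus by (simp add: fps_eval_def torus_monomial_power Nplus_iff b_fracs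
        torus_monomial_nth deg_scale qpow_of_nat_mult if_distrib[of "\<lambda>F. _ *\<^sub>K F"] cong: if_cong)
  finally show "torus_fps (qdilog d n a b) $ k = \<dots>" .
qed

lemma torus_exp_qdilog:
  assumes "n \<in> Nplus" "a \<in> fracs d" "b \<in> fracs d"
  shows "torus_exp (qdilog d n a b) = quantum_dilog (qpow d a) (torus_monomial n b)"
  using assms by (simp add: torus_exp_def torus_fps_qdilog quantum_dilog_eq_nc_exp)

end

locale dilog_pair = fixed_data B d
  for B :: "int ^ 'r::finite \<Rightarrow> int ^ 'r \<Rightarrow> rat" and d :: "'r \<Rightarrow> nat" +
  fixes n n' :: "int ^ 'r" and c b b' :: rat
  assumes n_Nplus: "n \<in> Nplus" and n'_Nplus: "n' \<in> Nplus" and c_eq: "B n' n = c" "c > 0"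
    and b_fracs: "b \<in> fracs d" and b'_fracs: "b' \<in> fracs d" and c_half_fracs: "c / 2 \<in> fracs d"
begin

abbreviation Q :: ratfun where
  "Q \<equiv> qpow d (c / 2)"

lemma tvar_powi_omega: "tvar powi omega n' n = Q ^ 2"
proof -
  have "omega n' n = qexponent (of_nat 2 * (c / 2))"
    by (simp add: omega_def c_eq)
  then show ?thesis
    by (simp only: qpow_of_nat_mult[OF c_half_fracs] flip: qpow_eq)
qed

lemma tvar_powi_omega_combination:
  "tvar powi omega (int i *s n) (int j *s n') = inverse (Q ^ (2 * i * j))"
proof -
  have "omega (int i *s n) (int j *s n') = - (omega n' n * int (i * j))"
    using omega_skew[of n n'] by (simp add: omega_scale_left omega_scale_right)
  then have "tvar powi omega (int i *s n) (int j *s n') =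
      inverse ((tvar powi omega n' n) ^ (i * j))"
    by (simp only: power_int_minus power_int_mult power_int_of_nat)
  then show ?thesis
    by (simp add: tvar_powi_omega mult.assoc flip: power_mult)
qed

sublocale quantum_plane
  "scale_linop :: ratfun \<Rightarrow> (int ^ 'r, ratfun) linop \<Rightarrow> (int ^ 'r, ratfun) linop"
  Q "torus_monomial n b" "torus_monomial n' b'"
proof
  show "generic_param Q"
    using c_eq c_half_fracs by (intro generic_param_qpow) auto
  have "Q ^ 4 * inverse (Q ^ 2) = Q ^ 2"
    using \<open>generic_param Q\<close> by (simp add: field_simps flip: power_add)
  moreover have "tvar powi omega n n' = inverse (Q ^ 2)"
    using tvar_powi_omega_combination[of 1 1] by simp
  ultimately show "torus_monomial n' b' * torus_monomial n b =
      Q ^ 4 *\<^sub>F (torus_monomial n b * torus_monomial n' b')"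
    using n_Nplus n'_Nplus b_fracs b'_fracs
    by (simp add: torus_monomial_mult Nplus_iff tvar_powi_omega add.commute)
qed (simp_all add: n_Nplus n'_Nplus)

lemma weyl_eq_torus_monomial:
  "weyl i j = torus_monomial (int i *s n + int j *s n') (of_nat i * b + of_nat j * b')"
  using n_Nplus n'_Nplus b_fracs b'_fracs generic
  by (simp add: weyl_monomial_def torus_monomial_power torus_monomial_mult Nplus_iff Nnonneg_scale
      fracs_of_nat_mult tvar_powi_omega_combination)

lemma qdilog_combination:
  assumes "i + j > 0"
  defines "x \<equiv> qdilog d (int i *s n + int j *s n') (c / 2) (of_nat i * b + of_nat j * b')"
  shows "x \<in> ghat" "torus_exp x = \<Phi> (weyl i j)"
  unfolding x_def using assms n_Nplus n'_Nplus b_fracs b'_fracs c_half_fracs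
  by (simp_all add: qdilog_in_ghat Nplus_combination torus_exp_qdilog fracs_add fracs_of_nat_mult
      weyl_eq_torus_monomial)

definition right_factor :: "nat \<Rightarrow> 'r series" where
  "right_factor p = qdilog d (int (p + 1) *s n + int p *s n') (c / 2)
    (of_nat (p + 1) * b + of_nat p * b')"

definition left_factor :: "nat \<Rightarrow> 'r series" where
  "left_factor p = qdilog d (int p *s n + int (p + 1) *s n') (c / 2)
    (of_nat p * b + of_nat (p + 1) * b')"

definition central_factor :: "nat \<Rightarrow> 'r series" where
  "central_factor p =
     qdilog d (2 ^ p *s (n + n')) (2 powi (int p - 1) * c)
       (2 ^ p * (b + b') - 2 powi (int p - 1) * c)
     \<otimes>\<^bsub>qgroup B d\<^esub>
     qdilog d (2 ^ p *s (n + n')) (2 powi (int p - 1) * c)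
       (2 ^ p * (b + b') + 2 powi (int p - 1) * c)"

lemma right_factor_in_ghat: "right_factor p \<in> ghat"
  and torus_exp_right_factor: "torus_exp (right_factor p) = \<Phi> (weyl (p + 1) p)"
  unfolding right_factor_def by (rule qdilog_combination; simp)+

lemma left_factor_in_ghat: "left_factor p \<in> ghat"
  and torus_exp_left_factor: "torus_exp (left_factor p) = \<Phi> (weyl p (p + 1))"
  unfolding left_factor_def by (rule qdilog_combination; simp)+

lemma qdilog_sum_multiple:
  fixes k :: nat
  assumes "k > 0" "a \<in> fracs d"
  defines "x \<equiv> qdilog d (int k *s (n + n')) (of_nat k * (c / 2)) (of_nat k * (b + b') + a)"
  shows "x \<in> ghat" "torus_exp x = quantum_dilog (Q ^ k) (qpow d a *\<^sub>F weyl 1 1 ^ k)"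
proof -
  have sum_Nplus: "n + n' \<in> Nplus" and sum_fracs: "b + b' \<in> fracs d"
    using n_Nplus n'_Nplus b_fracs b'_fracs by (simp_all add: Nplus_add fracs_add)
  then have multiple: "int k *s (n + n') \<in> Nplus"
    using assms(1) by (intro Nplus_scale)
  show "x \<in> ghat"
    unfolding x_def using multiple by (rule qdilog_in_ghat)
  have "weyl 1 1 ^ k = torus_monomial (int k *s (n + n')) (of_nat k * (b + b'))"
    using sum_Nplus sum_fracs by (simp add: weyl_eq_torus_monomial torus_monomial_power Nplus_iff)
  then show "torus_exp x = quantum_dilog (Q ^ k) (qpow d a *\<^sub>F weyl 1 1 ^ k)"
    unfolding x_def using multiple sum_fracs assms(2) c_half_fracs
    by (simp only: torus_exp_qdilog fracs_of_nat_mult fracs_add qpow_of_nat_mult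
        scale_torus_monomial)
qed

lemma central_factor_in_ghat: "central_factor p \<in> ghat"
  and torus_exp_central_factor: "torus_exp (central_factor p) =
    quantum_dilog (Q ^ 2 ^ p) (inverse (Q ^ 2 ^ p) *\<^sub>F weyl 1 1 ^ 2 ^ p) *
    quantum_dilog (Q ^ 2 ^ p) (Q ^ 2 ^ p *\<^sub>F weyl 1 1 ^ 2 ^ p)"
proof -
  let ?a = "of_nat (2 ^ p) * (c / 2)"
  have a_fracs: "?a \<in> fracs d"
    by (rule fracs_of_nat_mult[OF c_half_fracs])
  have qpow: "qpow d ?a = Q ^ 2 ^ p" "qpow d (- ?a) = inverse (Q ^ 2 ^ p)"
    using a_fracs by (simp_all only: qpow_minus qpow_of_nat_mult[OF c_half_fracs])
  have "central_factor p =
      qdilog d (int (2 ^ p) *s (n + n')) ?a (of_nat (2 ^ p) * (b + b') + - ?a) \<otimes>\<^bsub>qgroup B d\<^esub>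
      qdilog d (int (2 ^ p) *s (n + n')) ?a (of_nat (2 ^ p) * (b + b') + ?a)"
    by (simp add: central_factor_def power_int_diff)
  moreover note qdilog_sum_multiple[of "2 ^ p", OF _ a_fracs]
      qdilog_sum_multiple[of "2 ^ p", OF _ fracs_minus[OF a_fracs]]
  ultimately show "central_factor p \<in> ghat"
    "torus_exp (central_factor p) =
      quantum_dilog (Q ^ 2 ^ p) (inverse (Q ^ 2 ^ p) *\<^sub>F weyl 1 1 ^ 2 ^ p) *
      quantum_dilog (Q ^ 2 ^ p) (Q ^ 2 ^ p *\<^sub>F weyl 1 1 ^ 2 ^ p)"
    unfolding qpow by (simp_all add: mult_in_ghat torus_exp_mult)
qed

lemma fps_cong_torus_exp_factor_1:
  shows "fps_cong p (torus_exp (right_factor p)) 1" "fps_cong p (torus_exp (left_factor p)) 1"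
    "fps_cong p (torus_exp (central_factor p)) 1"
proof -
  show "fps_cong p (torus_exp (right_factor p)) 1" "fps_cong p (torus_exp (left_factor p)) 1"
    unfolding torus_exp_right_factor torus_exp_left_factor
    by (intro quantum_dilog_cong_1 fps_cong_mono[OF fps_cong_weyl_0], simp)+
  have "p \<le> (1 + 1) * 2 ^ p"
    by (rule order_trans[OF less_imp_le[OF less_exp]]) simp
  then have "fps_cong p (weyl 1 1 ^ 2 ^ p) 0"
    using fps_cong_mono[OF fps_cong_power_0[OF fps_cong_weyl_0]] by blast
  then have dilog: "fps_cong p (quantum_dilog R (a *\<^sub>F weyl 1 1 ^ 2 ^ p)) 1" for R a
    by (intro quantum_dilog_cong_1 fps_cong_scale_0)
  show "fps_cong p (torus_exp (central_factor p)) 1"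
    using fps_cong_mult[OF dilog dilog] unfolding torus_exp_central_factor mult_1_right .
qed

theorem qdilog_factorization:
  "\<exists>P M R. has_prod_right B d right_factor P \<and> has_prod_right B d central_factor M \<and>
    has_prod_left B d left_factor R \<and>
    qdilog d n' (c / 2) b' \<otimes>\<^bsub>qgroup B d\<^esub> qdilog d n (c / 2) b = P \<otimes>\<^bsub>qgroup B d\<^esub> M \<otimes>\<^bsub>qgroup B d\<^esub> R"
proof -
  obtain P where P_prod: "P \<in> ghat" "has_prod_right B d right_factor P"
    "\<And>k. fps_cong k (prod_right (\<lambda>p. torus_exp (right_factor p)) k) (torus_exp P)"
    using has_prod_right_exists[OF right_factor_in_ghat fps_cong_torus_exp_factor_1(1)] by blast
  obtain M where M_prod: "M \<in> ghat" "has_prod_right B d central_factor M"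
    "\<And>k. fps_cong k (prod_right (\<lambda>p. torus_exp (central_factor p)) k) (torus_exp M)"
    using has_prod_right_exists[OF central_factor_in_ghat fps_cong_torus_exp_factor_1(3)] by blast
  obtain R where R_prod: "R \<in> ghat" "has_prod_left B d left_factor R"
    "\<And>k. fps_cong k (prod_left (\<lambda>p. torus_exp (left_factor p)) k) (torus_exp R)"
    using has_prod_left_exists[OF left_factor_in_ghat fps_cong_torus_exp_factor_1(2)] by blast
  let ?x = "qdilog d n' (c / 2) b'" and ?y = "qdilog d n (c / 2) b"
  have "torus_exp (?x \<otimes>\<^bsub>qgroup B d\<^esub> ?y) = torus_exp (P \<otimes>\<^bsub>qgroup B d\<^esub> M \<otimes>\<^bsub>qgroup B d\<^esub> R)"
  proof (rule fps_cong_all_imp_eq)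
    fix k
    have "torus_exp (?x \<otimes>\<^bsub>qgroup B d\<^esub> ?y) = \<Phi> (torus_monomial n' b') * \<Phi> (torus_monomial n b)"
      using n_Nplus n'_Nplus b_fracs b'_fracs c_half_fracs
      by (simp add: torus_exp_mult torus_exp_qdilog)
    also have "fps_cong k \<dots> (kronecker_prod Q (torus_monomial n b) (torus_monomial n' b') k k)"
      by (rule kronecker_factorization_cong[where m = 0]) (use quantum_plane_axioms in simp_all)
    also have "fps_cong k \<dots> (torus_exp P * torus_exp M * torus_exp R)"
      unfolding kronecker_prod_def central_prod_def torus_exp_right_factor[symmetric]
        torus_exp_left_factor[symmetric] torus_exp_central_factor[symmetric]
      by (intro fps_cong_mult P_prod M_prod R_prod)
    finally show "fps_cong k (torus_exp (?x \<otimes>\<^bsub>qgroup B d\<^esub> ?y))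
        (torus_exp (P \<otimes>\<^bsub>qgroup B d\<^esub> M \<otimes>\<^bsub>qgroup B d\<^esub> R))"
      by (simp only: torus_exp_mult)
  qed
  then have "?x \<otimes>\<^bsub>qgroup B d\<^esub> ?y = P \<otimes>\<^bsub>qgroup B d\<^esub> M \<otimes>\<^bsub>qgroup B d\<^esub> R"
    using n_Nplus n'_Nplus P_prod(1) M_prod(1) R_prod(1)
    by (intro torus_exp_inj mult_in_ghat qdilog_in_ghat)
  with P_prod(2) M_prod(2) R_prod(2) show ?thesis by blast
qed

end

theorem theoremA4:
  shows
  "(\<forall>(B :: int ^ 'r::finite \<Rightarrow> int ^ 'r \<Rightarrow> rat) d n n' c b b'.
      fixed_data B d \<and> n \<in> Nplus \<and> n' \<in> Nplus \<and> B n' n = c \<and> c > 0 \<and>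
      b \<in> fracs d \<and> b' \<in> fracs d \<and> c / 2 \<in> fracs d \<longrightarrow>
      (\<exists>P Q R.
        has_prod_right B d
          (\<lambda>p. qdilog d (int (p + 1) *s n + int p *s n') (c / 2)
                 (of_nat (p + 1) * b + of_nat p * b')) P \<and>
        has_prod_right B d
          (\<lambda>p. qdilog d (2 ^ p *s (n + n')) (2 powi (int p - 1) * c)
                 (2 ^ p * (b + b') - 2 powi (int p - 1) * c) \<otimes>\<^bsub>qgroup B d\<^esub>
               qdilog d (2 ^ p *s (n + n')) (2 powi (int p - 1) * c)
                 (2 ^ p * (b + b') + 2 powi (int p - 1) * c)) Q \<and>
        has_prod_left B d
          (\<lambda>p. qdilog d (int p *s n + int (p + 1) *s n') (c / 2)
                 (of_nat p * b + of_nat (p + 1) * b')) R \<and>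
        qdilog d n' (c / 2) b' \<otimes>\<^bsub>qgroup B d\<^esub> qdilog d n (c / 2) b
          = P \<otimes>\<^bsub>qgroup B d\<^esub> Q \<otimes>\<^bsub>qgroup B d\<^esub> R))
   \<and>
   (\<forall>(B :: int ^ 2 \<Rightarrow> int ^ 2 \<Rightarrow> rat) d e\<^sub>1 e\<^sub>2.
      fixed_data B d \<and> d 1 = 2 \<and> d 2 = 2 \<and> e\<^sub>1 = axis 1 1 \<and> e\<^sub>2 = axis 2 1 \<and> B e\<^sub>2 e\<^sub>1 = 1 \<longrightarrow>
      (\<exists>P Q R.
        has_prod_right B d
          (\<lambda>p. qdilog d (int (p + 1) *s e\<^sub>1 + int p *s e\<^sub>2) (1 / 2) 0) P \<and>
        has_prod_right B d
          (\<lambda>j. qdilog d (2 ^ j *s (e\<^sub>1 + e\<^sub>2)) (2 powi (int j - 1)) (- (2 powi (int j - 1)))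
               \<otimes>\<^bsub>qgroup B d\<^esub>
               qdilog d (2 ^ j *s (e\<^sub>1 + e\<^sub>2)) (2 powi (int j - 1)) (2 powi (int j - 1))) Q \<and>
        has_prod_left B d
          (\<lambda>p. qdilog d (int p *s e\<^sub>1 + int (p + 1) *s e\<^sub>2) (1 / 2) 0) R \<and>
        qdilog d e\<^sub>2 (1 / 2) 0 \<otimes>\<^bsub>qgroup B d\<^esub> qdilog d e\<^sub>1 (1 / 2) 0
          = P \<otimes>\<^bsub>qgroup B d\<^esub> Q \<otimes>\<^bsub>qgroup B d\<^esub> R))"
proof (intro conjI allI impI, goal_cases)
  case (1 B d n n' c b b')
  then interpret dilog_pair B d n n' c b b'
    by (simp add: dilog_pair_def dilog_pair_axioms_def)
  show ?case
    using qdilog_factorization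
    unfolding right_factor_def[abs_def] central_factor_def[abs_def] left_factor_def[abs_def] .
next
  case (2 B d e\<^sub>1 e\<^sub>2)
  then have "range d = {2}" and basis: "e\<^sub>1 = axis 1 1" "e\<^sub>2 = axis 2 1"
    by (auto simp: UNIV_2)
  then have "1 / 2 \<in> fracs d" "0 \<in> fracs d"
    unfolding fracs_def delta0_def by (auto intro: exI[of _ 1] exI[of _ 0])
  moreover have "e\<^sub>1 \<in> Nplus" "e\<^sub>2 \<in> Nplus"
    by (auto simp: basis Nplus_def axis_def)
  ultimately interpret dilog_pair B d e\<^sub>1 e\<^sub>2 1 0 0
    using 2 by (auto simp: dilog_pair_def dilog_pair_axioms_def)
  show ?case
    using qdilog_factorization
    by (simp add: right_factor_def[abs_def] central_factor_def[abs_def] left_factor_def[abs_def])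
qed

end
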